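(* Let $F\in\mathbb C[[\boldsymbol t]]$, $F^o\in\mathbb C[[\boldsymbol t,s]]$, $\boldsymbol t=(t^1,\dots,t^n)$, be solutions of the WDVV and open WDVV equations. If the underlying $(n+1)$-dimensional formal flat $F$-manifold is semisimple and not strictly doubly resonant, then both $F$ and $F^o$ are convergent (in a neighbourhood of the origin).
   Context: Summation over repeated Greek indices in $\{1,\dots,n\}$ is understood. All free indices range in $\{1,\dots,n\}$. WDVV equations for $F$: $\frac{\partial^3F}{\partial t^1\partial t^\alpha\partial t^\beta}=\eta_{\alpha\beta}$ is constant with $\eta=(\eta_{\alpha\beta})$ invertible, $\eta^{-1}=(\eta^{\alpha\beta})$; $\frac{\partial^3F}{\partial t^\alpha\partial t^\beta\partial t^\mu}\eta^{\mu\nu}\frac{\partial^3F}{\partial t^\nu\partial t^\gamma\partial t^\delta}=\frac{\partial^3F}{\partial t^\delta\partial t^\beta\partial t^\mu}\eta^{\mu\nu}\frac{\partial^3F}{\partial t^\nu\partial t^\gamma\partial t^\alpha}$; $E^\nu\frac{\partial F}{\partial t^\nu}=(3-d)F+Q(\boldsymbol t)$, where $E^\nu=(1-q^\nu)t^\nu+r^\nu$ (no sum), $d,q^\nu,r^\nu\in\mathbb C$ and $Q$ is a polynomial of degree at most $2$. Open WDVV equations for $F^o$: $\frac{\partial^3F}{\partial t^\alpha\partial t^\beta\partial t^\mu}\eta^{\mu\nu}\frac{\partial^2F^o}{\partial t^\nu\partial t^\gamma}+\frac{\partial^2F^o}{\partial t^\alpha\partial t^\beta}\frac{\partial^2F^o}{\partial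 s\partial t^\gamma}=\frac{\partial^3F}{\partial t^\gamma\partial t^\beta\partial t^\mu}\eta^{\mu\nu}\frac{\partial^2F^o}{\partial t^\nu\partial t^\alpha}+\frac{\partial^2F^o}{\partial t^\gamma\partial t^\beta}\frac{\partial^2F^o}{\partial s\partial t^\alpha}$; $\frac{\partial^3F}{\partial t^\alpha\partial t^\beta\partial t^\mu}\eta^{\mu\nu}\frac{\partial^2F^o}{\partial t^\nu\partial s}+\frac{\partial^2F^o}{\partial t^\alpha\partial t^\beta}\frac{\partial^2F^o}{\partial s^2}=\frac{\partial^2F^o}{\partial s\partial t^\beta}\frac{\partial^2F^o}{\partial s\partial t^\alpha}$; $\frac{\partial^2F^o}{\partial t^1\partial t^\alpha}=0$, $\frac{\partial^2F^o}{\partial t^1\partial s}=1$; $E^\nu\frac{\partial F^o}{\partial t^\nu}+\left(\frac{1-d}2s+r^{n+1}\right)\frac{\partial F^o}{\partial s}=\frac{3-d}2F^o+L(\boldsymbol t)$, with $r^{n+1}\in\mathbb C$ and $L$ a polynomial of degree at most $1$. Underlying formal flat $F$-manifold: with coordinates $(x^1,\dots,x^{n+1})=(t^1,\dots,t^n,s)$ and vector potential $(\Phi^1,\dots,\Phi^{n+1})=\left(\frac{\partial F}{\partial t^\mu}\eta^{\mu1},\dots,\frac{\partial F}{\partial t^\mu}\eta^{\mu n},F^o\right)$, the product is $\frac{\partial}{\partial x^b}\circ\frac{\partial}{\partial x^c}=\sum_{a}\frac{\partial^2\Phi^a}{\partial x^b\partial x^c}\frac{\partial}{\partial x^a}$ (associative,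 with unit $\frac{\partial}{\partial t^1}$), with Euler vector field $\widehat E=\sum_\nu E^\nu\frac{\partial}{\partial t^\nu}+(\frac{1-d}2s+r^{n+1})\frac{\partial}{\partial s}=\sum_a((1-q_a)x^a+r^a)\frac{\partial}{\partial x^a}$, where $q_a=q^a$ for $a\le n$ and $q_{n+1}=\frac{1+d}2$. Let $\circ_0$ be the product at the origin. Semisimple: there is a basis of idempotents $\pi_1,\dots,\pi_{n+1}$ with $\pi_i\circ_0\pi_j=\delta_{ij}\pi_i$. Let $\widehat E|_0\circ_0\pi_i=u^i_o\pi_i$ and $\mu^0(\pi_i)\circ_0\pi_i=\delta_i\pi_i$, with $\mu^0(\frac{\partial}{\partial x^a})=q_a\frac{\partial}{\partial x^a}$. Strictly doubly resonant: $u_o^i=u_o^j$ and $\delta_i-\delta_j\in\mathbb Z\setminus\{0\}$ for some $i\ne j$. *)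

theory Defs
  imports "HOL-Analysis.Analysis"
begin

section \<open>Formal power series in finitely many variables\<close>

text \<open>
  The variables are indexed by a finite type \<open>'v\<close>; a monomial is an exponent vector \<open>k :: 'v \<Rightarrow> nat\<close>.
  Exponent vectors carry the pointwise order and pointwise subtraction of the function type.
\<close>

typedef ('v, 'a) mfps = "UNIV :: (('v \<Rightarrow> nat) \<Rightarrow> 'a) set"
  morphisms mfps_nth Abs_mfps
  by simp

setup_lifting type_definition_mfps

lemma mfps_eq_iff: "f = g \<longleftrightarrow> (\<forall>k. mfps_nth f k = mfps_nth g k)"
  by (metis ext mfps_nth_inject)

lemma mfps_eqI: "(\<And>k. mfps_nth f k = mfps_nth g k) \<Longrightarrow> f = g"
  by (simp add: mfps_eq_iff)

lift_definition mfps_const :: "'a::zero \<Rightarrow> ('v, 'a) mfps"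
  is "\<lambda>c k. if k = (\<lambda>_. 0) then c else 0" .

lift_definition mfps_X :: "'v \<Rightarrow> ('v, 'a::zero_neq_one) mfps"
  is "\<lambda>i k. if k = (\<lambda>_. 0)(i := 1) then 1 else 0" .

lift_definition mfps_deriv :: "'v \<Rightarrow> ('v, 'a::semiring_1) mfps \<Rightarrow> ('v, 'a) mfps"
  is "\<lambda>i f k. of_nat (k i + 1) * f (k(i := k i + 1))" .

lemma finite_exponents_atMost: "finite {..k :: 'v::finite \<Rightarrow> nat}"
proof -
  have "{..k} = (\<Pi>\<^sub>E i\<in>UNIV. {..k i})"
    by (auto simp: le_fun_def PiE_iff)
  then show ?thesis
    by (simp add: finite_PiE)
qed

instantiation mfps :: (finite, comm_ring_1) comm_ring_1
begin

lift_definition zero_mfps :: "('a, 'b) mfps" is "\<lambda>_. 0" .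
lift_definition one_mfps :: "('a, 'b) mfps" is "\<lambda>k. if k = (\<lambda>_. 0) then 1 else 0" .
lift_definition plus_mfps :: "('a, 'b) mfps \<Rightarrow> ('a, 'b) mfps \<Rightarrow> ('a, 'b) mfps"
  is "\<lambda>f g k. f k + g k" .
lift_definition uminus_mfps :: "('a, 'b) mfps \<Rightarrow> ('a, 'b) mfps"
  is "\<lambda>f k. - f k" .
lift_definition minus_mfps :: "('a, 'b) mfps \<Rightarrow> ('a, 'b) mfps \<Rightarrow> ('a, 'b) mfps"
  is "\<lambda>f g k. f k - g k" .
lift_definition times_mfps :: "('a, 'b) mfps \<Rightarrow> ('a, 'b) mfps \<Rightarrow> ('a, 'b) mfps"
  is "\<lambda>f g k. \<Sum>a\<le>k. f a * g (k - a)" .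

instance
proof
  fix f g h :: "('a, 'b) mfps"
  show "f + g + h = f + (g + h)" by transfer (simp add: add.assoc)
  show "f + g = g + f" by transfer (simp add: add.commute)
  show "0 + f = f" by transfer simp
  show "- f + f = 0" by transfer simp
  show "f - g = f + - g" by transfer simp
  show "(0 :: ('a, 'b) mfps) \<noteq> 1" by transfer (metis zero_neq_one)
  show "(f + g) * h = f * h + g * h"
    by transfer (simp add: distrib_right sum.distrib)
  show "1 * f = f"
  proof (rule mfps_eqI)
    fix k
    have "mfps_nth (1 * f) k = (\<Sum>a\<le>k. if a = (\<lambda>_. 0) then mfps_nth f k else 0)"
      by transfer (intro sum.cong, auto simp: fun_diff_def)
    also have "\<dots> = mfps_nth f k"
      by (simp add: finite_exponents_atMost le_fun_def)
    finally show "mfps_nth (1 * f) k = mfps_nth f k" .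
  qed
  show "f * g = g * f"
  proof transfer
    fix f g :: "('a \<Rightarrow> nat) \<Rightarrow> 'b"
    have "(\<Sum>a\<le>k. f a * g (k - a)) = (\<Sum>a\<le>k. g a * f (k - a))" for k
      by (rule sum.reindex_bij_witness[of _ "\<lambda>a. k - a" "\<lambda>a. k - a"])
         (auto simp: le_fun_def fun_diff_def fun_eq_iff mult.commute)
    then show "(\<lambda>k. \<Sum>a\<le>k. f a * g (k - a)) = (\<lambda>k. \<Sum>a\<le>k. g a * f (k - a))"
      by blast
  qed
  show "f * g * h = f * (g * h)"
  proof transfer
    fix f g h :: "('a \<Rightarrow> nat) \<Rightarrow> 'b"
    have "(\<Sum>a\<le>k. (\<Sum>b\<le>a. f b * g (a - b)) * h (k - a)) =
          (\<Sum>a\<le>k. f a * (\<Sum>b\<le>k - a. g b * h (k - a - b)))" for k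
    proof -
      have "(\<Sum>a\<le>k. (\<Sum>b\<le>a. f b * g (a - b)) * h (k - a)) =
            (\<Sum>(a, b)\<in>Sigma {..k} (\<lambda>a. {..a}). f b * g (a - b) * h (k - a))"
        by (simp add: sum.Sigma finite_exponents_atMost sum_distrib_right)
      also have "\<dots> = (\<Sum>(a, b)\<in>Sigma {..k} (\<lambda>a. {..k - a}). f a * (g b * h (k - a - b)))"
      proof (rule sum.reindex_bij_witness[of _ "\<lambda>(a, b). (\<lambda>i. a i + b i, a)" "\<lambda>(a, b). (b, a - b)"])
        fix x assume "x \<in> Sigma {..k} (\<lambda>a. {..a})"
        then obtain a b where x: "x = (a, b)" and le: "\<And>i. a i \<le> k i" "\<And>i. b i \<le> a i"
          by (auto simp: le_fun_def)
        show "(case (case x of (a, b) \<Rightarrow> (b, a - b)) of (a, b) \<Rightarrow> (\<lambda>i. a i + b i, a)) = x"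
          using le by (simp add: x fun_diff_def)
        show "(case x of (a, b) \<Rightarrow> (b, a - b)) \<in> Sigma {..k} (\<lambda>a. {..k - a})"
          using le by (auto simp: x le_fun_def fun_diff_def intro: order_trans diff_le_mono)
        have "k - b - (a - b) = k - a"
          using le by (simp add: fun_diff_def fun_eq_iff)
        then show "(case (case x of (a, b) \<Rightarrow> (b, a - b)) of (a, b) \<Rightarrow> f a * (g b * h (k - a - b))) =
              (case x of (a, b) \<Rightarrow> f b * g (a - b) * h (k - a))"
          by (simp add: x mult.assoc)
      next
        fix y assume "y \<in> Sigma {..k} (\<lambda>a. {..k - a})"
        then obtain a b where y: "y = (a, b)" and le: "\<And>i. a i \<le> k i" "\<And>i. b i \<le> k i - a i"
          by (auto simp: le_fun_def fun_diff_def)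
        show "(case (case y of (a, b) \<Rightarrow> (\<lambda>i. a i + b i, a)) of (a, b) \<Rightarrow> (b, a - b)) = y"
          by (simp add: y fun_diff_def)
        have "a i + b i \<le> k i" for i
          using le[of i] by linarith
        then show "(case y of (a, b) \<Rightarrow> (\<lambda>i. a i + b i, a)) \<in> Sigma {..k} (\<lambda>a. {..a})"
          by (auto simp: y le_fun_def)
      qed
      also have "\<dots> = (\<Sum>a\<le>k. f a * (\<Sum>b\<le>k - a. g b * h (k - a - b)))"
        by (simp add: sum.Sigma finite_exponents_atMost sum_distrib_left)
      finally show ?thesis .
    qed
    then show "(\<lambda>k. \<Sum>a\<le>k. (\<Sum>b\<le>a. f b * g (a - b)) * h (k - a)) =
               (\<lambda>k. \<Sum>a\<le>k. f a * (\<Sum>b\<le>k - a. g b * h (k - a - b)))"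
      by blast
  qed
qed

end

definition mfps_poly_deg_le :: "nat \<Rightarrow> ('v::finite, 'a::zero) mfps \<Rightarrow> bool" where
  "mfps_poly_deg_le m f \<longleftrightarrow> (\<forall>k. m < (\<Sum>i\<in>UNIV. k i) \<longrightarrow> mfps_nth f k = 0)"

text \<open>Absolute convergence of the power series at every point of some neighbourhood of the origin
  (for families of complex numbers, \<^const>\<open>summable_on\<close> is absolute summability).\<close>

definition mfps_convergent :: "('v::finite, complex) mfps \<Rightarrow> bool" where
  "mfps_convergent f \<longleftrightarrow>
     (\<forall>\<^sub>F z in nhds (0 :: complex ^ 'v). (\<lambda>k. mfps_nth f k * (\<Prod>i\<in>UNIV. (z $ i) ^ k i)) summable_on UNIV)"


section \<open>WDVV and open WDVV equations\<close>

text \<open>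
  The index range of \<open>t\<^sup>1, \<dots>, t\<^sup>n\<close> is the finite type \<open>'n\<close>, with \<open>o1 :: 'n\<close> playing the role
  of the index \<open>1\<close>. The \<open>n+1\<close> variables \<open>(t, s)\<close> are indexed by \<open>'n option\<close>: \<open>Some \<alpha>\<close> stands for
  \<open>t\<^sup>\<alpha>\<close> and \<open>None\<close> for \<open>s\<close>. The following map is the inclusion of series in \<open>t\<close> into series in \<open>(t, s)\<close>.
\<close>

lift_definition mfps_incl :: "('n, 'a::zero) mfps \<Rightarrow> ('n option, 'a) mfps"
  is "\<lambda>f k. if k None = 0 then f (\<lambda>i. k (Some i)) else 0" .

text \<open>Components of the vector field \<open>\<Sum>a. ((1 - q a) x\<^sup>a + r a) \<partial>/\<partial>x\<^sup>a\<close>.\<close>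

definition euler :: "('v::finite \<Rightarrow> complex) \<Rightarrow> ('v \<Rightarrow> complex) \<Rightarrow> 'v \<Rightarrow> ('v, complex) mfps" where
  "euler q r a = mfps_const (1 - q a) * mfps_X a + mfps_const (r a)"

definition mfps_deriv2 :: "'v \<Rightarrow> 'v \<Rightarrow> ('v, complex) mfps \<Rightarrow> ('v, complex) mfps" where
  "mfps_deriv2 a b f = mfps_deriv a (mfps_deriv b f)"

definition mfps_deriv3 :: "'v \<Rightarrow> 'v \<Rightarrow> 'v \<Rightarrow> ('v, complex) mfps \<Rightarrow> ('v, complex) mfps" where
  "mfps_deriv3 a b c f = mfps_deriv a (mfps_deriv b (mfps_deriv c f))"

definition wdvv ::
    "'n::finite \<Rightarrow> complex ^ 'n ^ 'n \<Rightarrow> complex \<Rightarrow> ('n \<Rightarrow> complex) \<Rightarrow> ('n \<Rightarrow> complex)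
      \<Rightarrow> ('n, complex) mfps \<Rightarrow> bool" where
  "wdvv o1 \<eta> d q r F \<longleftrightarrow>
     invertible \<eta> \<and>
     (\<forall>\<alpha> \<beta>. mfps_deriv3 o1 \<alpha> \<beta> F = mfps_const (\<eta> $ \<alpha> $ \<beta>)) \<and>
     (\<forall>\<alpha> \<beta> \<gamma> \<delta>.
        (\<Sum>\<mu>\<in>UNIV. \<Sum>\<nu>\<in>UNIV.
           mfps_deriv3 \<alpha> \<beta> \<mu> F * mfps_const (matrix_inv \<eta> $ \<mu> $ \<nu>) * mfps_deriv3 \<nu> \<gamma> \<delta> F) =
        (\<Sum>\<mu>\<in>UNIV. \<Sum>\<nu>\<in>UNIV.
           mfps_deriv3 \<delta> \<beta> \<mu> F * mfps_const (matrix_inv \<eta> $ \<mu> $ \<nu>) * mfps_deriv3 \<nu> \<gamma> \<alpha> F)) \<and>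
     (\<exists>Q. mfps_poly_deg_le 2 Q \<and>
        (\<Sum>\<nu>\<in>UNIV. euler q r \<nu> * mfps_deriv \<nu> F) = mfps_const (3 - d) * F + Q)"

text \<open>\<open>rs\<close> is the constant \<open>r\<^sup>n\<^sup>+\<^sup>1\<close>. The polynomial \<open>L\<close> involves the variables \<open>t\<close> only.\<close>

definition open_wdvv ::
    "'n::finite \<Rightarrow> complex ^ 'n ^ 'n \<Rightarrow> complex \<Rightarrow> ('n \<Rightarrow> complex) \<Rightarrow> ('n \<Rightarrow> complex) \<Rightarrow> complex
      \<Rightarrow> ('n, complex) mfps \<Rightarrow> ('n option, complex) mfps \<Rightarrow> bool" where
  "open_wdvv o1 \<eta> d q r rs F Fo \<longleftrightarrow>
     (\<forall>\<alpha> \<beta> \<gamma>.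
        (\<Sum>\<mu>\<in>UNIV. \<Sum>\<nu>\<in>UNIV.
           mfps_incl (mfps_deriv3 \<alpha> \<beta> \<mu> F) * mfps_const (matrix_inv \<eta> $ \<mu> $ \<nu>)
             * mfps_deriv2 (Some \<nu>) (Some \<gamma>) Fo)
          + mfps_deriv2 (Some \<alpha>) (Some \<beta>) Fo * mfps_deriv2 None (Some \<gamma>) Fo =
        (\<Sum>\<mu>\<in>UNIV. \<Sum>\<nu>\<in>UNIV.
           mfps_incl (mfps_deriv3 \<gamma> \<beta> \<mu> F) * mfps_const (matrix_inv \<eta> $ \<mu> $ \<nu>)
             * mfps_deriv2 (Some \<nu>) (Some \<alpha>) Fo)
          + mfps_deriv2 (Some \<gamma>) (Some \<beta>) Fo * mfps_deriv2 None (Some \<alpha>) Fo) \<and>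
     (\<forall>\<alpha> \<beta>.
        (\<Sum>\<mu>\<in>UNIV. \<Sum>\<nu>\<in>UNIV.
           mfps_incl (mfps_deriv3 \<alpha> \<beta> \<mu> F) * mfps_const (matrix_inv \<eta> $ \<mu> $ \<nu>)
             * mfps_deriv2 (Some \<nu>) None Fo)
          + mfps_deriv2 (Some \<alpha>) (Some \<beta>) Fo * mfps_deriv2 None None Fo =
        mfps_deriv2 None (Some \<beta>) Fo * mfps_deriv2 None (Some \<alpha>) Fo) \<and>
     (\<forall>\<alpha>. mfps_deriv2 (Some o1) (Some \<alpha>) Fo = 0) \<and>
     mfps_deriv2 (Some o1) None Fo = 1 \<and>
     (\<exists>L. mfps_poly_deg_le 1 L \<and>
        (\<Sum>\<nu>\<in>UNIV. mfps_incl (euler q r \<nu>) * mfps_deriv (Some \<nu>) Fo)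
          + (mfps_const ((1 - d) / 2) * mfps_X None + mfps_const rs) * mfps_deriv None Fo =
        mfps_const ((3 - d) / 2) * Fo + mfps_incl L)"


section \<open>The underlying formal flat F-manifold\<close>

definition open_vector_potential ::
    "complex ^ 'n ^ 'n \<Rightarrow> ('n::finite, complex) mfps \<Rightarrow> ('n option, complex) mfps
      \<Rightarrow> 'n option \<Rightarrow> ('n option, complex) mfps" where
  "open_vector_potential \<eta> F Fo a =
     (case a of
        Some \<alpha> \<Rightarrow> \<Sum>\<mu>\<in>UNIV. mfps_incl (mfps_deriv \<mu> F) * mfps_const (matrix_inv \<eta> $ \<mu> $ \<alpha>)
      | None \<Rightarrow> Fo)"

definition open_q :: "complex \<Rightarrow> ('n \<Rightarrow> complex) \<Rightarrow> 'n option \<Rightarrow> complex" where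
  "open_q d q a = (case a of Some \<alpha> \<Rightarrow> q \<alpha> | None \<Rightarrow> (1 + d) / 2)"

definition open_r :: "('n \<Rightarrow> complex) \<Rightarrow> complex \<Rightarrow> 'n option \<Rightarrow> complex" where
  "open_r r rs a = (case a of Some \<alpha> \<Rightarrow> r \<alpha> | None \<Rightarrow> rs)"

text \<open>
  The remaining notions are stated for a general vector potential \<open>\<Phi>\<close> in flat coordinates indexed by
  \<open>'v\<close>. The value of a formal vector field at the origin is the vector of constant coefficients of its
  components.
\<close>

definition product_at_0 ::
    "('v::finite \<Rightarrow> ('v, complex) mfps) \<Rightarrow> complex ^ 'v \<Rightarrow> complex ^ 'v \<Rightarrow> complex ^ 'v" where
  "product_at_0 \<Phi> v w =
     (\<chi> a. \<Sum>b\<in>UNIV. \<Sum>c\<in>UNIV. mfps_nth (mfps_deriv2 b c (\<Phi> a)) (\<lambda>_. 0) * v $ b * w $ c)"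

definition euler_at_0 :: "('v::finite \<Rightarrow> complex) \<Rightarrow> ('v \<Rightarrow> complex) \<Rightarrow> complex ^ 'v" where
  "euler_at_0 q r = (\<chi> a. mfps_nth (euler q r a) (\<lambda>_. 0))"

definition mu_at_0 :: "('v::finite \<Rightarrow> complex) \<Rightarrow> complex ^ 'v \<Rightarrow> complex ^ 'v" where
  "mu_at_0 q v = (\<chi> a. q a * v $ a)"

text \<open>The basis is indexed by the same type as the coordinates, whose cardinality is the dimension;
  the prefix \<open>vec\<close> refers to the \<open>complex\<close>-linear notions.\<close>

definition idempotent_basis ::
    "('v::finite \<Rightarrow> ('v, complex) mfps) \<Rightarrow> ('v \<Rightarrow> complex ^ 'v) \<Rightarrow> bool" where
  "idempotent_basis \<Phi> \<pi> \<longleftrightarrow>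
     inj \<pi> \<and> vec.independent (range \<pi>) \<and> vec.span (range \<pi>) = UNIV \<and>
     (\<forall>i j. product_at_0 \<Phi> (\<pi> i) (\<pi> j) = (if i = j then \<pi> i else 0))"

definition semisimple :: "('v::finite \<Rightarrow> ('v, complex) mfps) \<Rightarrow> bool" where
  "semisimple \<Phi> \<longleftrightarrow> (\<exists>\<pi>. idempotent_basis \<Phi> \<pi>)"

text \<open>For a semisimple \<open>\<Phi>\<close> the idempotent basis is unique up to reordering and determines \<open>u\<close> and
  \<open>\<delta>\<close>, so quantifying existentially over these data is harmless.\<close>

definition strictly_doubly_resonant ::
    "('v::finite \<Rightarrow> ('v, complex) mfps) \<Rightarrow> ('v \<Rightarrow> complex) \<Rightarrow> ('v \<Rightarrow> complex) \<Rightarrow> bool" where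
  "strictly_doubly_resonant \<Phi> q r \<longleftrightarrow>
     (\<exists>\<pi> u \<delta>. idempotent_basis \<Phi> \<pi> \<and>
        (\<forall>i. product_at_0 \<Phi> (euler_at_0 q r) (\<pi> i) = u i *s \<pi> i) \<and>
        (\<forall>i. product_at_0 \<Phi> (mu_at_0 q (\<pi> i)) (\<pi> i) = \<delta> i *s \<pi> i) \<and>
        (\<exists>i j. i \<noteq> j \<and> u i = u j \<and> \<delta> i - \<delta> j \<in> \<int> - {0}))"

end

theory Submission
  imports Defs
begin

text \<open>
  Write \<open>c\<^sup>a\<^sub>b\<^sub>d = \<partial>\<^sub>b \<partial>\<^sub>d \<Phi>\<^sup>a\<close> for the structure constants of the flat F-manifold. They contain the
  second derivatives of \<open>F\<^sup>o\<close> and, up to the constant matrix \<open>\<eta>\<close>, the third derivatives of \<open>F\<close>. Integration only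
  makes coefficients smaller, so it suffices to bound those of the \<open>c\<^sup>a\<^sub>b\<^sub>d\<close> geometrically. The WDVV and
  open WDVV equations say that the \<open>c\<^sup>a\<^sub>b\<^sub>d\<close> define a commutative associative algebra over the ring of formal
  power series (\<open>open_wdvv_solution.c_assoc\<close>), homogeneous with respect to the Euler field \<open>E\<close>.

  The idempotents at the origin lift to formal vector fields \<open>\<pi>\<^sub>i\<close>. With the dual frame \<open>\<lambda>\<^sup>i\<close> one has
  \<open>c\<^sup>a\<^sub>b\<^sub>d = \<Sum>\<^sub>i \<pi>\<^sub>i\<^sup>a \<lambda>\<^sup>i\<^sub>b \<lambda>\<^sup>i\<^sub>d\<close> (\<open>formal_algebra.formal_diagonalization\<close>), so the convergence of this frame is
  what has to be shown. Homogeneity gives \<open>\<lambda>\<^sup>i = du\<^sub>i\<close> for the eigenvalues \<open>u\<^sub>i\<close> of multiplication by \<open>E\<close>, and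
  symmetry of the third derivatives of \<open>\<Phi>\<close> determines the derivatives of the frame: for \<open>i \<noteq> j\<close> the coefficient
  \<open>\<beta>\<^sub>b\<^sup>i\<^sup>j\<close> of \<open>\<pi>\<^sub>i\<close> in \<open>\<partial>\<^sub>b \<pi>\<^sub>j\<close> satisfies
  \<open>(u\<^sub>j - u\<^sub>i) \<beta>\<^sub>b\<^sup>i\<^sup>j = (\<lambda>\<^sup>i\<^sub>b - \<lambda>\<^sup>j\<^sub>b) V\<^sub>i\<^sub>j\<close>, where \<open>V\<^sub>i\<^sub>j = \<lambda>\<^sup>i(\<mu> \<pi>\<^sub>j)\<close>. This is a differential system for
  the frame that is singular where \<open>u\<^sub>i\<close> and \<open>u\<^sub>j\<close> coalesce at the origin.

  The singularity disappears along the vector field \<open>w = \<Sum>\<^sub>i (u\<^sub>i - u\<^sub>i(0)) \<pi>\<^sub>i\<close>, the Euler field of the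
  canonical coordinates centred at the origin. Contraction with \<open>w\<close> turns \<open>\<lambda>\<^sup>i - \<lambda>\<^sup>j\<close> into
  \<open>(u\<^sub>i - u\<^sub>i(0)) - (u\<^sub>j - u\<^sub>j(0))\<close>, and its quotient by \<open>u\<^sub>i - u\<^sub>j\<close> is \<open>1\<close> if the two eigenvalues coalesce and a
  power series if they do not. Together with these quotients, which obey \<open>w(h) = h (1 - h)\<close>, the frame therefore
  solves a polynomial system \<open>w(y) = f(y)\<close>, and \<open>w\<close> differs from the Euler operator \<open>\<Sum>\<^sub>a x\<^sup>a \<partial>\<^sub>a\<close>
  only in terms of order at least two that are again polynomial in \<open>y\<close>.

  A formal solution of such a Briot-Bouquet system converges (\<open>briot_bouquet\<close>): on homogeneous parts of
  degree \<open>n\<close> the left-hand side is multiplication by \<open>n\<close>, and for large \<open>n\<close> this dominates everything in the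
  equation that involves the part of degree \<open>n\<close>; the rest depends on parts of lower degree and is controlled by
  a majorant.
\<close>

section \<open>Calculus of formal power series\<close>

definition degree_of :: "('v::finite \<Rightarrow> nat) \<Rightarrow> nat" where
  "degree_of k = (\<Sum>i\<in>UNIV. k i)"

abbreviation const_coeff :: "('v::finite, 'a) mfps \<Rightarrow> 'a" where
  "const_coeff f \<equiv> mfps_nth f (\<lambda>_. 0)"

lemma degree_of_zero [simp]: "degree_of (\<lambda>_. 0) = 0"
  by (simp add: degree_of_def)

lemma degree_of_eq_0_iff [simp]: "degree_of k = 0 \<longleftrightarrow> k = (\<lambda>_. 0)"
  by (auto simp: degree_of_def fun_eq_iff)

lemma degree_of_incr [simp]: "degree_of (k(i := Suc (k i))) = Suc (degree_of k)"
proof -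
  have "degree_of (k(i := Suc (k i))) = (\<Sum>j\<in>UNIV. k j + (if j = i then 1 else 0))"
    unfolding degree_of_def by (intro sum.cong) auto
  also have "\<dots> = Suc (degree_of k)"
    by (simp add: sum.distrib degree_of_def)
  finally show ?thesis .
qed

lemma degree_of_diff: "a \<le> k \<Longrightarrow> degree_of (k - a) = degree_of k - degree_of a"
  by (auto simp: degree_of_def le_fun_def fun_diff_def sum_subtractf_nat)

lemma degree_of_mono: "a \<le> k \<Longrightarrow> degree_of a \<le> degree_of k"
  by (auto simp: degree_of_def le_fun_def intro: sum_mono)

lemma component_le_degree_of: "k i \<le> degree_of k"
  unfolding degree_of_def by (rule member_le_sum) auto

lemma finite_degree_le: "finite {k :: 'v::finite \<Rightarrow> nat. degree_of k \<le> n}"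
proof (rule finite_subset)
  show "{k. degree_of k \<le> n} \<subseteq> {..(\<lambda>_::'v. n)}"
    using component_le_degree_of by (fastforce simp: le_fun_def intro: order_trans)
qed (rule finite_exponents_atMost)

lemma finite_degree_eq: "finite {k :: 'v::finite \<Rightarrow> nat. degree_of k = n}"
  by (rule finite_subset[OF _ finite_degree_le[of n]]) auto

lemma mfps_nth_add [simp]: "mfps_nth (f + g) k = mfps_nth f k + mfps_nth g k"
  and mfps_nth_diff [simp]: "mfps_nth (f - g) k = mfps_nth f k - mfps_nth g k"
  and mfps_nth_minus [simp]: "mfps_nth (- f) k = - mfps_nth f k"
  and mfps_nth_zero [simp]: "mfps_nth 0 k = 0"
  and mfps_nth_one: "mfps_nth 1 k = (if k = (\<lambda>_. 0) then 1 else 0)"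
  and mfps_nth_mult: "mfps_nth (f * g) k = (\<Sum>a\<le>k. mfps_nth f a * mfps_nth g (k - a))"
  for f g :: "('v::finite, 'a::comm_ring_1) mfps"
  by (simp_all add: plus_mfps.rep_eq minus_mfps.rep_eq uminus_mfps.rep_eq zero_mfps.rep_eq
      one_mfps.rep_eq times_mfps.rep_eq)

lemma mfps_nth_const: "mfps_nth (mfps_const c) k = (if k = (\<lambda>_. 0) then c else 0)"
  by (simp add: mfps_const.rep_eq)

lemma mfps_nth_deriv: "mfps_nth (mfps_deriv i f) k = of_nat (Suc (k i)) * mfps_nth f (k(i := Suc (k i)))"
  by (simp add: mfps_deriv.rep_eq)

lemma mfps_nth_sum [simp]:
  fixes f :: "'b \<Rightarrow> ('v::finite, 'a::comm_ring_1) mfps"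
  shows "mfps_nth (\<Sum>x\<in>A. f x) k = (\<Sum>x\<in>A. mfps_nth (f x) k)"
  by (induction A rule: infinite_finite_induct) auto

lemma mfps_const_zero [simp]: "mfps_const 0 = (0 :: ('v::finite, 'a::comm_ring_1) mfps)"
  by (rule mfps_eqI) (simp add: mfps_nth_const)

lemma mfps_const_one [simp]: "mfps_const 1 = (1 :: ('v::finite, 'a::comm_ring_1) mfps)"
  by (rule mfps_eqI) (simp add: mfps_nth_const mfps_nth_one)

lemma mfps_nth_const_mult [simp]:
  fixes f :: "('v::finite, 'a::comm_ring_1) mfps"
  shows "mfps_nth (mfps_const c * f) k = c * mfps_nth f k"
proof -
  have "mfps_nth (mfps_const c * f) k = (\<Sum>a\<le>k. if a = (\<lambda>_. 0) then c * mfps_nth f k else 0)"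
    unfolding mfps_nth_mult by (intro sum.cong) (auto simp: mfps_nth_const fun_diff_def)
  then show ?thesis
    by (simp add: finite_exponents_atMost le_fun_def)
qed

lemma const_coeff_one [simp]: "const_coeff (1 :: ('v::finite, 'a::comm_ring_1) mfps) = 1"
  by (simp add: mfps_nth_one)

lemma const_coeff_const [simp]: "const_coeff (mfps_const c) = c"
  by (simp add: mfps_nth_const)

lemma const_coeff_mult [simp]:
  fixes f g :: "('v::finite, 'a::comm_ring_1) mfps"
  shows "const_coeff (f * g) = const_coeff f * const_coeff g"
proof -
  have "{..(\<lambda>_::'v. 0::nat)} = {\<lambda>_. 0}"
    by (auto simp: le_fun_def)
  then show ?thesis
    by (simp add: mfps_nth_mult fun_diff_def)
qed

lemma mfps_const_add: "mfps_const (a + b) = mfps_const a + (mfps_const b :: ('v::finite, 'a::comm_ring_1) mfps)"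
  and mfps_const_diff: "mfps_const (a - b) = mfps_const a - (mfps_const b :: ('v::finite, 'a::comm_ring_1) mfps)"
  and mfps_const_mult: "mfps_const (a * b) = mfps_const a * (mfps_const b :: ('v::finite, 'a::comm_ring_1) mfps)"
  by (rule mfps_eqI, simp add: mfps_nth_const)+

lemma mfps_const_sum:
  "mfps_const (\<Sum>x\<in>A. f x) = (\<Sum>x\<in>A. mfps_const (f x) :: ('v::finite, 'a::comm_ring_1) mfps)"
  by (rule mfps_eqI) (simp add: mfps_nth_const)

lemma mfps_deriv_add [simp]: "mfps_deriv i (f + g) = mfps_deriv i f + mfps_deriv i g"
  and mfps_deriv_diff [simp]: "mfps_deriv i (f - g) = mfps_deriv i f - mfps_deriv i g"
  and mfps_deriv_zero [simp]: "mfps_deriv i 0 = (0 :: ('v, 'a) mfps)"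
  and mfps_deriv_const [simp]: "mfps_deriv i (mfps_const c) = (0 :: ('v, 'a) mfps)"
  for f g :: "('v::finite, 'a::comm_ring_1) mfps"
  by (rule mfps_eqI, auto simp: mfps_nth_deriv mfps_nth_const fun_eq_iff algebra_simps)+

lemma mfps_deriv_one [simp]: "mfps_deriv i (1 :: ('v::finite, 'a::comm_ring_1) mfps) = 0"
  using mfps_deriv_const[of i 1] by simp

lemma mfps_deriv_sum [simp]:
  fixes f :: "'b \<Rightarrow> ('v::finite, 'a::comm_ring_1) mfps"
  shows "mfps_deriv i (\<Sum>x\<in>A. f x) = (\<Sum>x\<in>A. mfps_deriv i (f x))"
  by (induction A rule: infinite_finite_induct) auto

lemma mfps_deriv_X:
  "mfps_deriv i (mfps_X j) = (if i = j then 1 else (0 :: ('v::finite, 'a::comm_ring_1) mfps))"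
proof (rule mfps_eqI)
  fix k :: "'v \<Rightarrow> nat"
  have "k(i := Suc (k i)) = (\<lambda>_. 0)(j := 1) \<longleftrightarrow> i = j \<and> k = (\<lambda>_. 0)"
  proof
    assume *: "k(i := Suc (k i)) = (\<lambda>_. 0)(j := 1)"
    have ij: "i = j"
      using fun_cong[OF *, of i] by (auto split: if_splits)
    moreover have "k a = 0" for a
      using fun_cong[OF *, of a] ij by (auto split: if_splits)
    ultimately show "i = j \<and> k = (\<lambda>_. 0)" by auto
  qed auto
  then show "mfps_nth (mfps_deriv i (mfps_X j)) k = mfps_nth (if i = j then 1 else (0 :: ('v, 'a) mfps)) k"
    by (auto simp: mfps_nth_deriv mfps_X.rep_eq mfps_nth_one)
qed

lemma mfps_deriv_commute:
  fixes f :: "('v::finite, 'a::comm_ring_1) mfps"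
  shows "mfps_deriv i (mfps_deriv j f) = mfps_deriv j (mfps_deriv i f)"
proof (cases "i = j")
  case False
  then show ?thesis
    by (intro mfps_eqI) (simp add: mfps_nth_deriv fun_upd_twist algebra_simps)
qed simp

text \<open>The factor \<open>k\<^sub>i + 1\<close> of a coefficient of \<open>\<partial>\<^sub>i (f g)\<close> is split over each term of the
  convolution as \<open>a\<^sub>i + (k\<^sub>i + 1 - a\<^sub>i)\<close>; each half is a shifted convolution.\<close>

lemma sum_shifted_convolution:
  fixes F :: "('v::finite \<Rightarrow> nat) \<Rightarrow> 'a::comm_ring_1"
  shows "(\<Sum>a\<le>k(i := Suc (k i)). of_nat (a i) * F a) =
         (\<Sum>a\<le>k. of_nat (Suc (a i)) * F (a(i := Suc (a i))))"
proof -
  let ?k = "k(i := Suc (k i))"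
  have "(\<Sum>a\<le>?k. of_nat (a i) * F a) = (\<Sum>a\<in>{a. a \<le> ?k \<and> a i > 0}. of_nat (a i) * F a)"
    by (rule sum.mono_neutral_right) (auto simp: finite_exponents_atMost)
  also have "\<dots> = (\<Sum>a\<le>k. of_nat (Suc (a i)) * F (a(i := Suc (a i))))"
  proof (rule sum.reindex_bij_witness[of _ "\<lambda>a. a(i := Suc (a i))" "\<lambda>a. a(i := a i - 1)"])
    fix a assume a: "a \<in> {a. a \<le> ?k \<and> a i > 0}"
    then have le: "a j \<le> ?k j" for j by (simp add: le_fun_def)
    show "a(i := a i - 1) \<in> {..k}"
      using le by (fastforce simp: le_fun_def split: if_splits)
  qed (auto simp: le_fun_def)
  finally show ?thesis .
qed

lemma mfps_deriv_mult [simp]: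
  fixes f g :: "('v::finite, 'a::comm_ring_1) mfps"
  shows "mfps_deriv i (f * g) = mfps_deriv i f * g + f * mfps_deriv i g"
proof (rule mfps_eqI)
  fix k :: "'v \<Rightarrow> nat"
  let ?k = "k(i := Suc (k i))"
  define T where "T a = mfps_nth f a * mfps_nth g (?k - a)" for a
  have split: "of_nat (Suc (k i)) * T a = of_nat (a i) * T a + of_nat ((?k - a) i) * T a" if "a \<le> ?k" for a
  proof -
    have "a i \<le> Suc (k i)" using that by (auto simp: le_fun_def dest: spec[of _ i])
    then have "of_nat (Suc (k i)) = (of_nat (a i) + of_nat ((?k - a) i) :: 'a)"
      unfolding of_nat_add[symmetric] by (simp add: fun_diff_def)
    then show ?thesis by (simp add: distrib_right)
  qed
  have upd: "?k - a(i := Suc (a i)) = k - a" for a :: "'v \<Rightarrow> nat"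
    by (auto simp: fun_diff_def)
  have upd2: "?k - (k - a) = a(i := Suc (a i))" if "a \<le> k" for a :: "'v \<Rightarrow> nat"
    using that by (force simp: fun_diff_def le_fun_def fun_eq_iff Suc_diff_le)
  have diff_diff: "K - (K - a) = a" if "a \<le> K" for a K :: "'v \<Rightarrow> nat"
    using that by (auto simp: le_fun_def fun_diff_def fun_eq_iff)
  have swap: "(\<Sum>a\<le>K. G a) = (\<Sum>a\<le>K. G (K - a))" for G :: "('v \<Rightarrow> nat) \<Rightarrow> 'a" and K
    by (rule sum.reindex_bij_witness[of _ "\<lambda>a. K - a" "\<lambda>a. K - a"])
       (auto simp: le_fun_def fun_diff_def fun_eq_iff)
  have "mfps_nth (mfps_deriv i (f * g)) k = (\<Sum>a\<le>?k. of_nat (Suc (k i)) * T a)"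
    by (simp add: mfps_nth_deriv mfps_nth_mult T_def sum_distrib_left)
  also have "\<dots> = (\<Sum>a\<le>?k. of_nat (a i) * T a) + (\<Sum>a\<le>?k. of_nat ((?k - a) i) * T a)"
    unfolding sum.distrib[symmetric] by (intro sum.cong refl split) auto
  also have "(\<Sum>a\<le>?k. of_nat (a i) * T a) = mfps_nth (mfps_deriv i f * g) k"
    unfolding sum_shifted_convolution
    by (simp add: T_def upd mfps_nth_mult mfps_nth_deriv mult.assoc mult.left_commute del: of_nat_Suc)
  also have "(\<Sum>a\<le>?k. of_nat ((?k - a) i) * T a) = (\<Sum>a\<le>?k. of_nat (a i) * T (?k - a))"
    unfolding swap[of "\<lambda>a. of_nat ((?k - a) i) * T a"] by (intro sum.cong) (auto simp: diff_diff)
  also have "\<dots> = (\<Sum>a\<le>k. of_nat (Suc (a i)) * T (k - a))"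
    using sum_shifted_convolution[where F = "\<lambda>a. T (?k - a)"] by (simp add: upd)
  also have "\<dots> = (\<Sum>a\<le>k. of_nat (Suc ((k - a) i)) * T a)"
    unfolding swap[of "\<lambda>a. of_nat (Suc ((k - a) i)) * T a"] by (intro sum.cong) (auto simp: diff_diff)
  also have "\<dots> = mfps_nth (f * mfps_deriv i g) k"
  proof -
    have "?k - a = (k - a)(i := Suc ((k - a) i))" if "a \<le> k" for a :: "'v \<Rightarrow> nat"
      using that by (force simp: fun_diff_def le_fun_def fun_eq_iff Suc_diff_le)
    then show ?thesis
      by (auto simp: T_def mfps_nth_mult mfps_nth_deriv mult.assoc mult.left_commute simp del: of_nat_Suc intro!: sum.cong)
  qed
  finally show "mfps_nth (mfps_deriv i (f * g)) k = mfps_nth (mfps_deriv i f * g + f * mfps_deriv i g) k"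
    by simp
qed

text \<open>The operator \<open>\<Sum>\<^sub>i x\<^sub>i \<partial>\<^sub>i\<close> multiplies a monomial by its total degree. It is the model of the differential
  operator in the convergence theorem below.\<close>

lemma euler_operator_nth:
  fixes f :: "('v::finite, complex) mfps"
  shows "mfps_nth (\<Sum>i\<in>UNIV. mfps_X i * mfps_deriv i f) k = of_nat (degree_of k) * mfps_nth f k"
proof -
  have "mfps_nth (mfps_X i * mfps_deriv i f) k = of_nat (k i) * mfps_nth f k" for i
  proof (cases "k i")
    case 0
    then have "\<not> (\<lambda>_. 0)(i := Suc 0) \<le> k"
      by (auto simp: le_fun_def)
    then show ?thesis
      using 0 by (auto simp: mfps_nth_mult mfps_X.rep_eq intro!: sum.neutral)
  next
    case (Suc m)
    let ?e = "(\<lambda>_. 0)(i := Suc 0)"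
    have le: "?e \<le> k" using Suc by (auto simp: le_fun_def)
    have "mfps_nth (mfps_X i * mfps_deriv i f) k = (\<Sum>a\<le>k. if a = ?e then mfps_nth (mfps_deriv i f) (k - ?e) else 0)"
      by (auto simp: mfps_nth_mult mfps_X.rep_eq intro!: sum.cong)
    also have "\<dots> = mfps_nth (mfps_deriv i f) (k - ?e)"
      using le by (simp add: finite_exponents_atMost)
    also have "(k - ?e)(i := Suc ((k - ?e) i)) = k"
      using Suc by (auto simp: fun_diff_def fun_eq_iff)
    then have "mfps_nth (mfps_deriv i f) (k - ?e) = of_nat (k i) * mfps_nth f k"
      using Suc by (simp add: mfps_nth_deriv fun_diff_def)
    finally show ?thesis .
  qed
  then show ?thesis
    by (simp add: degree_of_def sum_distrib_right)
qed

section \<open>Norms of homogeneous parts\<close>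

text \<open>The \<open>\<ell>\<^sup>1\<close> norm of the homogeneous part of degree \<open>n\<close>: with it the passage from several variables to one
  is submultiplicative, and convergence becomes a question about sequences of real numbers.\<close>

definition hnorm :: "('v::finite, complex) mfps \<Rightarrow> nat \<Rightarrow> real" where
  "hnorm f n = (\<Sum>k | degree_of k = n. norm (mfps_nth f k))"

lemma hnorm_nonneg [simp]: "0 \<le> hnorm f n"
  by (simp add: hnorm_def sum_nonneg)

lemma hnorm_add_le: "hnorm (f + g) n \<le> hnorm f n + hnorm g n"
  unfolding hnorm_def sum.distrib[symmetric] by (rule sum_mono) (simp add: norm_triangle_ineq)

lemma hnorm_minus [simp]: "hnorm (- f) n = hnorm f n"
  by (simp add: hnorm_def)

lemma hnorm_diff_le: "hnorm (f - g) n \<le> hnorm f n + hnorm g n"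
  using hnorm_add_le[of f "- g" n] by simp

lemma hnorm_zero [simp]: "hnorm 0 n = 0"
  by (simp add: hnorm_def)

lemma hnorm_sum_le: "hnorm (\<Sum>x\<in>A. f x) n \<le> (\<Sum>x\<in>A. hnorm (f x) n)"
  by (induction A rule: infinite_finite_induct) (auto intro: order_trans[OF hnorm_add_le])

lemma hnorm_const: "hnorm (mfps_const c) n = (if n = 0 then norm c else 0)"
proof -
  have "{k :: 'a \<Rightarrow> nat. degree_of k = 0} = {\<lambda>_. 0}" by auto
  then show ?thesis
    by (auto simp: hnorm_def mfps_nth_const intro!: sum.neutral)
qed

lemma hnorm_const_mult: "hnorm (mfps_const c * f) n = norm c * hnorm f n"
  by (simp add: hnorm_def norm_mult sum_distrib_left)

lemma hnorm_mult_le: "hnorm (f * g) n \<le> (\<Sum>j\<le>n. hnorm f j * hnorm g (n - j))"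
proof -
  let ?D = "\<lambda>n. {k :: 'a \<Rightarrow> nat. degree_of k = n}"
  let ?t = "\<lambda>a b. norm (mfps_nth f a) * norm (mfps_nth g b)"
  have "hnorm (f * g) n \<le> (\<Sum>k\<in>?D n. \<Sum>a\<le>k. ?t a (k - a))"
    unfolding hnorm_def
    by (intro sum_mono) (auto simp: mfps_nth_mult norm_mult intro!: order_trans[OF norm_sum] sum_mono)
  also have "\<dots> = (\<Sum>(k, a)\<in>Sigma (?D n) (\<lambda>k. {..k}). ?t a (k - a))"
    by (simp add: sum.Sigma finite_degree_eq finite_exponents_atMost)
  also have "\<dots> = (\<Sum>(j, a, b)\<in>Sigma {..n} (\<lambda>j. ?D j \<times> ?D (n - j)). ?t a b)"
  proof (rule sum.reindex_bij_witness[of _ "\<lambda>(j, a, b). (\<lambda>i. a i + b i, a)" "\<lambda>(k, a). (degree_of a, a, k - a)"])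
    fix x assume "x \<in> Sigma {..n} (\<lambda>j. ?D j \<times> ?D (n - j))"
    then obtain j a b where x: "x = (j, a, b)" and d: "j \<le> n" "degree_of a = j" "degree_of b = n - j"
      by auto
    have "degree_of (\<lambda>i. a i + b i) = n"
      using d by (simp add: degree_of_def sum.distrib)
    then show "(case x of (j, a, b) \<Rightarrow> (\<lambda>i. a i + b i, a)) \<in> Sigma (?D n) (\<lambda>k. {..k})"
      by (auto simp: x le_fun_def)
    show "(case (case x of (j, a, b) \<Rightarrow> (\<lambda>i. a i + b i, a)) of (k, a) \<Rightarrow> (degree_of a, a, k - a)) = x"
      by (auto simp: x d fun_diff_def)
  next
    fix x assume "x \<in> Sigma (?D n) (\<lambda>k. {..k})"
    then obtain k a where x: "x = (k, a)" and d: "degree_of k = n" "a \<le> k" by auto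
    have "degree_of (k - a) = n - degree_of a"
      using d by (simp add: degree_of_diff)
    moreover have "degree_of a \<le> n" using degree_of_mono[OF d(2)] d(1) by simp
    ultimately show "(case x of (k, a) \<Rightarrow> (degree_of a, a, k - a)) \<in> Sigma {..n} (\<lambda>j. ?D j \<times> ?D (n - j))"
      by (simp add: x)
    have "(\<lambda>i. a i + (k - a) i) = k"
      using d(2) by (auto simp: le_fun_def fun_diff_def)
    then show "(case (case x of (k, a) \<Rightarrow> (degree_of a, a, k - a)) of (j, a, b) \<Rightarrow> (\<lambda>i. a i + b i, a)) = x"
      by (simp add: x)
  qed auto
  also have "\<dots> = (\<Sum>j\<le>n. hnorm f j * hnorm g (n - j))"
  proof -
    have "hnorm f j * hnorm g (n - j) = (\<Sum>(a, b)\<in>?D j \<times> ?D (n - j). ?t a b)" for j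
      unfolding hnorm_def sum_product by (rule sum.cartesian_product)
    then show ?thesis
      by (simp add: sum.Sigma finite_degree_eq)
  qed
  finally show ?thesis .
qed

lemma hnorm_deriv_le: "hnorm (mfps_deriv i f) n \<le> real (Suc n) * hnorm f (Suc n)"
proof -
  let ?D = "\<lambda>n. {k :: 'a \<Rightarrow> nat. degree_of k = n}"
  let ?s = "\<lambda>k :: 'a \<Rightarrow> nat. k(i := Suc (k i))"
  have inj: "inj_on ?s (?D n)"
  proof (rule inj_onI)
    fix x y :: "'a \<Rightarrow> nat" assume eq: "?s x = ?s y"
    show "x = y"
    proof
      fix j show "x j = y j" using fun_cong[OF eq, of j] by (auto split: if_splits)
    qed
  qed
  have "hnorm (mfps_deriv i f) n \<le> (\<Sum>k\<in>?D n. real (Suc n) * norm (mfps_nth f (?s k)))"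
    unfolding hnorm_def
  proof (rule sum_mono)
    fix k assume "k \<in> ?D n"
    then have "k i \<le> n" using component_le_degree_of[of k i] by auto
    moreover have "norm (of_nat (Suc (k i)) :: complex) = real (Suc (k i))"
      by (simp only: norm_of_nat)
    ultimately show "norm (mfps_nth (mfps_deriv i f) k) \<le> real (Suc n) * norm (mfps_nth f (?s k))"
      by (simp add: mfps_nth_deriv norm_mult mult_right_mono del: of_nat_Suc)
  qed
  also have "\<dots> = real (Suc n) * (\<Sum>k\<in>?s ` ?D n. norm (mfps_nth f k))"
    by (simp add: sum.reindex[OF inj] sum_distrib_left)
  also have "\<dots> \<le> real (Suc n) * hnorm f (Suc n)"
    unfolding hnorm_def by (intro mult_left_mono sum_mono2) (auto simp: finite_degree_eq)
  finally show ?thesis .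
qed

lemma hnorm_euler_operator: "hnorm (\<Sum>i\<in>UNIV. mfps_X i * mfps_deriv i f) n = real n * hnorm f n"
proof -
  have "norm (mfps_nth (\<Sum>i\<in>UNIV. mfps_X i * mfps_deriv i f) k) = real n * norm (mfps_nth f k)"
    if "degree_of k = n" for k
    unfolding euler_operator_nth norm_mult using that by simp
  then show ?thesis
    by (simp add: hnorm_def sum_distrib_left)
qed

text \<open>A bound \<open>C R\<^sup>n\<close> can always be brought to the form \<open>R\<^sup>n\<^sup>+\<^sup>1\<close> by enlarging \<open>R\<close>; a single constant keeps the
  closure properties short.\<close>

definition geom_bounded :: "('v::finite, complex) mfps \<Rightarrow> bool" where
  "geom_bounded f \<longleftrightarrow> (\<exists>R\<ge>1. \<forall>n. hnorm f n \<le> R ^ Suc n)"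

lemma geom_bounded_add:
  assumes "geom_bounded f" "geom_bounded g"
  shows "geom_bounded (f + g)"
proof -
  obtain R R' where R: "R \<ge> 1" "\<And>n. hnorm f n \<le> R ^ Suc n"
    and R': "R' \<ge> 1" "\<And>n. hnorm g n \<le> R' ^ Suc n"
    using assms unfolding geom_bounded_def by blast
  have super: "R ^ Suc n + R' ^ Suc n \<le> (R + R') ^ Suc n" for n
  proof (induction n)
    case (Suc n)
    have "R ^ Suc (Suc n) + R' ^ Suc (Suc n) \<le> (R + R') * (R ^ Suc n + R' ^ Suc n)"
      using R(1) R'(1) by (simp add: algebra_simps)
    also have "\<dots> \<le> (R + R') * (R + R') ^ Suc n"
      using Suc R(1) R'(1) by (intro mult_left_mono) auto
    finally show ?case by simp
  qed simp
  have "hnorm (f + g) n \<le> (R + R') ^ Suc n" for n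
    using hnorm_add_le[of f g n] R(2)[of n] R'(2)[of n] super[of n] by linarith
  then show ?thesis
    unfolding geom_bounded_def using R(1) R'(1) by (intro exI[of _ "R + R'"]) auto
qed

lemma geom_bounded_mult:
  assumes "geom_bounded f" "geom_bounded g"
  shows "geom_bounded (f * g)"
proof -
  obtain R1 R2 where R1: "R1 \<ge> 1" "\<And>n. hnorm f n \<le> R1 ^ Suc n"
    and R2: "R2 \<ge> 1" "\<And>n. hnorm g n \<le> R2 ^ Suc n"
    using assms unfolding geom_bounded_def by blast
  define R where "R = max R1 R2"
  have R: "R \<ge> 1" using R1 by (simp add: R_def)
  have "hnorm f n \<le> R ^ Suc n" "hnorm g n \<le> R ^ Suc n" for n
    using R1 R2 by (auto simp: R_def intro!: order_trans[OF R1(2)] order_trans[OF R2(2)] power_mono simp del: power_Suc)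
  then have "hnorm (f * g) n \<le> (\<Sum>j\<le>n. R ^ Suc j * R ^ Suc (n - j))" for n
    using R by (intro order_trans[OF hnorm_mult_le] sum_mono mult_mono) auto
  also have "(\<Sum>j\<le>n. R ^ Suc j * R ^ Suc (n - j)) = real (Suc n) * R ^ (n + 2)" for n
  proof -
    have "R ^ Suc j * R ^ Suc (n - j) = R ^ (n + 2)" if "j \<le> n" for j
      using that by (subst power_add[symmetric]) (simp del: power_Suc)
    then show ?thesis by (simp del: power_Suc)
  qed
  also have "real (Suc n) * R ^ (n + 2) \<le> 2 ^ Suc n * (R ^ 2) ^ Suc n" for n
  proof (rule mult_mono)
    have "Suc n \<le> 2 ^ Suc n" using less_exp[of "Suc n"] by linarith
    then show "real (Suc n) \<le> 2 ^ Suc n"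
      by (metis of_nat_le_iff of_nat_numeral of_nat_power)
    show "R ^ (n + 2) \<le> (R ^ 2) ^ Suc n"
      unfolding power_mult[symmetric] using R by (intro power_increasing) auto
  qed (use R in auto)
  also have "2 ^ Suc n * (R ^ 2) ^ Suc n = (2 * R ^ 2) ^ Suc n" for n
    by (simp only: power_mult_distrib)
  finally have "hnorm (f * g) n \<le> (2 * R ^ 2) ^ Suc n" for n .
  moreover have "2 * R ^ 2 \<ge> 1"
    using one_le_power[OF R, of 2] by linarith
  ultimately show ?thesis
    unfolding geom_bounded_def by blast
qed

lemma geom_bounded_const: "geom_bounded (mfps_const c)"
  unfolding geom_bounded_def
  by (rule exI[of _ "1 + norm c"]) (auto simp: hnorm_const)

lemma geom_bounded_zero: "geom_bounded 0"
  using geom_bounded_const[of 0] by simp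

lemma geom_bounded_sum: "(\<And>x. x \<in> A \<Longrightarrow> geom_bounded (f x)) \<Longrightarrow> geom_bounded (\<Sum>x\<in>A. f x)"
  by (induction A rule: infinite_finite_induct) (auto intro: geom_bounded_add geom_bounded_zero)

text \<open>Every monomial of positive degree is a monomial of some derivative multiplied by one variable,
  and integration divides its coefficient by a positive integer.\<close>

lemma geom_bounded_if_derivs:
  fixes f :: "('v::finite, complex) mfps"
  assumes "\<And>i. geom_bounded (mfps_deriv i f)"
  shows "geom_bounded f"
proof -
  have "\<forall>i. \<exists>R\<ge>1. \<forall>n. hnorm (mfps_deriv i f) n \<le> R ^ Suc n"
    using assms by (simp add: geom_bounded_def)
  then obtain R where R: "\<And>i. R i \<ge> 1" "\<And>i n. hnorm (mfps_deriv i f) n \<le> R i ^ Suc n"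
    by metis
  let ?D = "\<lambda>n. {k :: 'v \<Rightarrow> nat. degree_of k = n}"
  have le: "hnorm f (Suc n) \<le> (\<Sum>i\<in>UNIV. hnorm (mfps_deriv i f) n)" for n
  proof -
    have "real (Suc n) * hnorm f (Suc n) = hnorm (\<Sum>i\<in>UNIV. mfps_X i * mfps_deriv i f) (Suc n)"
      by (simp add: hnorm_euler_operator)
    also have "\<dots> \<le> (\<Sum>i\<in>UNIV. hnorm (mfps_X i * mfps_deriv i f) (Suc n))"
      by (rule hnorm_sum_le)
    also have "\<dots> \<le> (\<Sum>i\<in>UNIV. hnorm (mfps_deriv i f) n)"
    proof (rule sum_mono)
      fix i :: 'v
      have X: "hnorm (mfps_X i :: ('v, complex) mfps) j = (if j = 1 then 1 else 0)" for j
      proof -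
        have "hnorm (mfps_X i :: ('v, complex) mfps) j = (\<Sum>k\<in>?D j. if k = (\<lambda>_. 0)(i := 1) then 1 else 0)"
          unfolding hnorm_def by (intro sum.cong) (auto simp: mfps_X.rep_eq)
        also have "\<dots> = (if j = 1 then 1 else 0)"
          using degree_of_incr[of "\<lambda>_. 0" i] by (auto simp: finite_degree_eq)
        finally show ?thesis .
      qed
      have "hnorm (mfps_X i * mfps_deriv i f) (Suc n) \<le>
          (\<Sum>j\<le>Suc n. hnorm (mfps_X i :: ('v, complex) mfps) j * hnorm (mfps_deriv i f) (Suc n - j))"
        by (rule hnorm_mult_le)
      also have "\<dots> = (\<Sum>j\<le>Suc n. if j = 1 then hnorm (mfps_deriv i f) n else 0)"
        by (intro sum.cong) (auto simp: X)
      finally show "hnorm (mfps_X i * mfps_deriv i f) (Suc n) \<le> hnorm (mfps_deriv i f) n"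
        by (simp del: sum.atMost_Suc)
    qed
    finally have "real (Suc n) * hnorm f (Suc n) \<le> (\<Sum>i\<in>UNIV. hnorm (mfps_deriv i f) n)" .
    moreover have "hnorm f (Suc n) \<le> real (Suc n) * hnorm f (Suc n)"
      by (simp add: mult_right_mono algebra_simps)
    ultimately show ?thesis by linarith
  qed
  define T where "T = 1 + hnorm f 0 + (\<Sum>i\<in>UNIV. R i)"
  have sum_nonneg: "(\<Sum>i\<in>UNIV. R i) \<ge> 0"
    by (intro sum_nonneg) (use R(1) order_trans zero_le_one in blast)
  then have T: "T \<ge> 1" "hnorm f 0 \<le> T" "(\<Sum>i\<in>UNIV. R i) \<le> T"
    by (simp_all add: T_def)
  have "hnorm f n \<le> T ^ Suc n" for n
  proof (cases n)
    case (Suc m)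
    have Ri: "0 \<le> R i" for i
      using R(1)[of i] by linarith
    have "hnorm f (Suc m) \<le> (\<Sum>i\<in>UNIV. R i * R i ^ m)"
      using le[of m] R(2) by (simp add: order_trans[OF _ sum_mono])
    also have "\<dots> \<le> (\<Sum>i\<in>UNIV. R i * T ^ m)"
    proof (intro sum_mono mult_left_mono power_mono Ri)
      fix i show "R i \<le> T"
        using T(3) member_le_sum[of i UNIV R] Ri by force
    qed
    also have "\<dots> \<le> T * T ^ m"
      unfolding sum_distrib_right[symmetric] using T by (intro mult_right_mono) auto
    also have "\<dots> \<le> T ^ Suc (Suc m)"
      using T(1) by (simp add: mult_left_mono power_increasing)
    finally show ?thesis by (simp add: Suc)
  qed (use T in simp)
  then show ?thesis
    unfolding geom_bounded_def using T(1) by blast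
qed

lemma mfps_convergent_if_geom_bounded:
  fixes f :: "('v::finite, complex) mfps"
  assumes "geom_bounded f"
  shows "mfps_convergent f"
proof -
  obtain R where R: "R \<ge> 1" "\<And>n. hnorm f n \<le> R ^ Suc n"
    using assms by (auto simp: geom_bounded_def)
  (* At this radius the sum over all homogeneous parts is dominated by a geometric series of ratio 1/2. *)
  define r where "r = 1 / (2 * R)"
  have r: "r > 0" "R * r = 1 / 2"
    using R(1) by (simp_all add: r_def)
  have "(\<lambda>k. mfps_nth f k * (\<Prod>i\<in>UNIV. (z $ i) ^ k i)) summable_on UNIV"
    if z: "norm z < r" for z :: "complex ^ 'v"
  proof -
    let ?t = "\<lambda>k. norm (mfps_nth f k * (\<Prod>i\<in>UNIV. (z $ i) ^ k i))"
    have t: "?t k \<le> norm (mfps_nth f k) * r ^ degree_of k" for k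
    proof -
      have "norm (\<Prod>i\<in>UNIV. (z $ i) ^ k i) = (\<Prod>i\<in>UNIV. norm (z $ i) ^ k i)"
        by (simp add: prod_norm[symmetric] norm_power)
      also have "\<dots> \<le> (\<Prod>i\<in>UNIV. r ^ k i)"
      proof (intro prod_mono conjI power_mono)
        fix i show "norm (z $ i) \<le> r"
          using Finite_Cartesian_Product.norm_nth_le[of z i] z by linarith
      qed auto
      also have "\<dots> = r ^ degree_of k"
        by (simp add: degree_of_def power_sum)
      finally show ?thesis
        by (simp add: norm_mult mult_left_mono)
    qed
    have "sum ?t A \<le> 2 * R" if A: "finite A" for A
    proof -
      define N where "N = Max (insert 0 (degree_of ` A))"
      have N: "degree_of k \<le> N" if "k \<in> A" for k
        using A that by (simp add: N_def)
      have "sum ?t A \<le> (\<Sum>k\<in>A. norm (mfps_nth f k) * r ^ degree_of k)"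
        by (intro sum_mono t)
      also have "\<dots> \<le> (\<Sum>k\<in>{k. degree_of k \<le> N}. norm (mfps_nth f k) * r ^ degree_of k)"
        using N r by (intro sum_mono2) (auto simp: finite_degree_le)
      also have "{k :: 'v \<Rightarrow> nat. degree_of k \<le> N} = (\<Union>n\<in>{..N}. {k. degree_of k = n})"
        by auto
      also have "(\<Sum>k\<in>\<dots>. norm (mfps_nth f k) * r ^ degree_of k) = (\<Sum>n\<le>N. hnorm f n * r ^ n)"
        by (subst sum.UNION_disjoint) (auto simp: finite_degree_eq hnorm_def sum_distrib_right)
      also have "\<dots> \<le> (\<Sum>n\<le>N. R ^ Suc n * r ^ n)"
        using r R(2) by (intro sum_mono mult_right_mono) auto
      also have "\<dots> = R * (\<Sum>n\<le>N. (1 / 2) ^ n)"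
        by (simp add: sum_distrib_left mult.assoc r(2)[symmetric] power_mult_distrib)
      also have "\<dots> \<le> R * 2"
      proof (intro mult_left_mono)
        show "(\<Sum>n\<le>N. (1 / 2) ^ n) \<le> (2 :: real)"
        proof -
          have "(\<Sum>n\<le>N. (1 / 2) ^ n) = 2 - (1 / 2 :: real) ^ N"
            by (induction N) auto
          then show ?thesis by simp
        qed
      qed (use R in simp)
      finally show ?thesis by simp
    qed
    then have "?t summable_on UNIV"
      by (intro nonneg_bdd_above_summable_on bdd_aboveI[of _ "2 * R"]) auto
    then show ?thesis
      by (rule abs_summable_summable)
  qed
  moreover have "\<forall>\<^sub>F z in nhds (0 :: complex ^ 'v). norm z < r"
    using r(1) by (auto simp: eventually_nhds_metric dist_norm)
  ultimately show ?thesis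
    unfolding mfps_convergent_def by (auto elim!: eventually_mono)
qed

section \<open>A convergence theorem for quasilinear Briot-Bouquet systems\<close>

definition truncated_eval :: "nat \<Rightarrow> real \<Rightarrow> real fps \<Rightarrow> real" where
  "truncated_eval n \<rho> G = (\<Sum>k\<le>n. fps_nth G k * \<rho> ^ k)"

abbreviation fps_nonneg :: "real fps \<Rightarrow> bool" where
  "fps_nonneg G \<equiv> \<forall>n. 0 \<le> fps_nth G n"

lemma fps_nonneg_mult: "fps_nonneg G \<Longrightarrow> fps_nonneg H \<Longrightarrow> fps_nonneg (G * H)"
  by (auto simp: fps_mult_nth intro: sum_nonneg)

lemma fps_nonneg_power: "fps_nonneg G \<Longrightarrow> fps_nonneg (G ^ p)"
  by (induction p) (auto intro!: fps_nonneg_mult[rule_format])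

lemma truncated_eval_nonneg: "fps_nonneg G \<Longrightarrow> \<rho> \<ge> 0 \<Longrightarrow> 0 \<le> truncated_eval n \<rho> G"
  unfolding truncated_eval_def by (intro sum_nonneg) auto

lemma truncated_eval_add: "truncated_eval n \<rho> (G + H) = truncated_eval n \<rho> G + truncated_eval n \<rho> H"
  by (simp add: truncated_eval_def distrib_right sum.distrib)

lemma truncated_eval_of_nat: "truncated_eval n \<rho> (of_nat p) = of_nat p"
proof -
  have "truncated_eval n \<rho> (of_nat p) = (\<Sum>k\<le>n. if k = 0 then of_nat p else 0)"
    unfolding truncated_eval_def by (intro sum.cong) (auto simp: fps_nth_of_nat)
  then show ?thesis by simp
qed

lemma truncated_eval_mult_le:
  assumes "fps_nonneg G" "fps_nonneg H" "\<rho> \<ge> 0"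
  shows "truncated_eval n \<rho> (G * H) \<le> truncated_eval n \<rho> G * truncated_eval n \<rho> H"
proof -
  let ?t = "\<lambda>i j. fps_nth G i * \<rho> ^ i * (fps_nth H j * \<rho> ^ j)"
  have "truncated_eval n \<rho> (G * H) = (\<Sum>k\<le>n. \<Sum>i\<le>k. ?t i (k - i))"
    unfolding truncated_eval_def fps_mult_nth sum_distrib_right atLeast0AtMost
    by (intro sum.cong refl) (auto simp: algebra_simps power_add[symmetric])
  also have "\<dots> = (\<Sum>(k, i)\<in>Sigma {..n} (\<lambda>k. {..k}). ?t i (k - i))"
    by (simp add: sum.Sigma)
  also have "\<dots> = (\<Sum>(i, j)\<in>(\<lambda>(k, i). (i, k - i)) ` Sigma {..n} (\<lambda>k. {..k}). ?t i j)"
    by (subst sum.reindex) (auto simp: inj_on_def case_prod_unfold)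
  also have "\<dots> \<le> (\<Sum>(i, j)\<in>{..n} \<times> {..n}. ?t i j)"
    using assms by (intro sum_mono2) auto
  also have "\<dots> = truncated_eval n \<rho> G * truncated_eval n \<rho> H"
    by (simp add: truncated_eval_def sum_product sum.cartesian_product)
  finally show ?thesis .
qed

text \<open>The linear term in \<open>G\<close> has to be isolated because it alone contains coefficients of \<open>G\<close> of the full order.
  The remainder is nonnegative and bounded in terms of \<open>p\<close> as long as \<open>G\<close> stays below \<open>1\<close>.\<close>

lemma one_plus_power_second_order:
  fixes G :: "real fps"
  assumes G: "fps_nonneg G"
  shows "\<exists>Q q. fps_nonneg Q \<and> (1 + G) ^ p = 1 + of_nat p * G + G * G * Q \<and> 0 \<le> q \<and>
           (\<forall>n \<rho>. \<rho> \<ge> 0 \<longrightarrow> truncated_eval n \<rho> G \<le> 1 \<longrightarrow> truncated_eval n \<rho> Q \<le> q)"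
proof (induction p)
  case 0
  show ?case
    by (rule exI[of _ 0], rule exI[of _ 0]) (simp add: truncated_eval_def)
next
  case (Suc p)
  then obtain Q q where Q: "fps_nonneg Q" "(1 + G) ^ p = 1 + of_nat p * G + G * G * Q" and q0: "0 \<le> q"
    and q: "\<And>n \<rho>. \<rho> \<ge> 0 \<Longrightarrow> truncated_eval n \<rho> G \<le> 1 \<Longrightarrow> truncated_eval n \<rho> Q \<le> q"
    by blast
  have H: "fps_nonneg (1 + G)" using G by simp
  have QH: "fps_nonneg (Q * (1 + G))" using fps_nonneg_mult[OF Q(1) H] .
  show ?case
  proof (intro exI conjI allI impI)
    fix n show "0 \<le> fps_nth (of_nat p + Q * (1 + G)) n"
      using QH by (simp add: fps_nth_of_nat)
  next
    show "(1 + G) ^ Suc p = 1 + of_nat (Suc p) * G + G * G * (of_nat p + Q * (1 + G))"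
      using Q(2) by (simp add: algebra_simps)
  next
    show "0 \<le> of_nat p + q * 2" using q0 by simp
  next
    fix n and \<rho> :: real assume \<rho>: "\<rho> \<ge> 0" and ev: "truncated_eval n \<rho> G \<le> 1"
    have one: "truncated_eval n \<rho> 1 = 1"
      using truncated_eval_of_nat[of n \<rho> 1] by simp
    have "truncated_eval n \<rho> (Q * (1 + G)) \<le> truncated_eval n \<rho> Q * truncated_eval n \<rho> (1 + G)"
      by (rule truncated_eval_mult_le[OF Q(1) H \<rho>])
    also have "\<dots> \<le> q * 2"
      using q[OF \<rho> ev] q0 ev truncated_eval_nonneg[OF Q(1) \<rho>] truncated_eval_nonneg[OF G \<rho>]
      by (intro mult_mono) (auto simp: truncated_eval_add one)
    finally show "truncated_eval n \<rho> (of_nat p + Q * (1 + G)) \<le> of_nat p + q * 2"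
      by (simp only: truncated_eval_add truncated_eval_of_nat)
  qed
qed

lemma sum_convolution_le:
  fixes a b :: "nat \<Rightarrow> real"
  assumes "\<And>k. 0 \<le> a k" "\<And>k. 0 \<le> b k"
  shows "(\<Sum>k=2..n. \<Sum>j=2..k - 1. a j * b (Suc k - j)) \<le> (\<Sum>j=2..n - 1. a j) * (\<Sum>j=2..n - 1. b j)"
proof -
  have "(\<Sum>k=2..n. \<Sum>j=2..k - 1. a j * b (Suc k - j)) =
        (\<Sum>(k, j)\<in>Sigma {2..n} (\<lambda>k. {2..k - 1}). a j * b (Suc k - j))"
    by (simp add: sum.Sigma)
  also have "\<dots> = (\<Sum>(j, l)\<in>(\<lambda>(k, j). (j, Suc k - j)) ` Sigma {2..n} (\<lambda>k. {2..k - 1}). a j * b l)"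
    by (subst sum.reindex) (auto simp: inj_on_def case_prod_unfold)
  also have "\<dots> \<le> (\<Sum>(j, l)\<in>{2..n - 1} \<times> {2..n - 1}. a j * b l)"
    using assms by (intro sum_mono2) auto
  also have "\<dots> = (\<Sum>j=2..n - 1. a j) * (\<Sum>j=2..n - 1. b j)"
    by (simp add: sum_product sum.cartesian_product)
  finally show ?thesis .
qed

text \<open>The coefficient of order \<open>n\<close> on the right contains \<open>Y\<^sub>n\<close> itself only linearly, with a factor that does
  not depend on \<open>n\<close>; for large \<open>n\<close> it is absorbed by the factor \<open>n\<close> on the left. All other terms are at
  least quadratic in the \<open>Y\<^sub>j\<close> with \<open>j < n\<close>, so the weighted partial sums \<open>\<Sum>k=2..n. k Y\<^sub>k \<rho>\<^sup>k\<close> stay below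
  \<open>\<epsilon> \<rho>\<close> by induction on \<open>n\<close>: the derivative term contributes \<open>(\<epsilon> \<rho>)\<^sup>2 / \<rho>\<close>, which is small against
  \<open>\<epsilon> \<rho>\<close> for small \<open>\<epsilon>\<close>, and the remaining terms are of order \<open>\<rho>\<^sup>2\<close>.\<close>

lemma majorant_recursion_bound:
  fixes Y :: "nat \<Rightarrow> real"
  assumes Y: "\<And>n. 0 \<le> Y n" and A: "0 \<le> A"
    and rec: "\<And>n. n \<ge> 1 \<Longrightarrow> real n * Y n \<le>
        A * fps_nth ((1 + Abs_fps (\<lambda>n. if n = 0 then 0 else Y n)) ^ p) n +
        A * (\<Sum>j=2..n. Y j * (real (Suc n - j) * Y (Suc n - j)))"
  shows "\<exists>C \<rho>. \<rho> > 0 \<and> (\<forall>n\<ge>1. Y n * \<rho> ^ n \<le> C)"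
proof -
  define G where "G = Abs_fps (\<lambda>n. if n = 0 then 0 else Y n)"
  define Z where "Z = Abs_fps (\<lambda>n. Y (Suc n))"
  have GZ: "G = fps_X * Z"
    by (rule fps_ext) (auto simp: G_def Z_def)
  have G: "fps_nonneg G" and Z: "fps_nonneg Z"
    using Y by (simp_all add: G_def Z_def)
  obtain Q q where Q: "fps_nonneg Q" "(1 + G) ^ p = 1 + of_nat p * G + G * G * Q" and q0: "0 \<le> q"
    and q: "\<And>n \<rho>. \<rho> \<ge> 0 \<Longrightarrow> truncated_eval n \<rho> G \<le> 1 \<Longrightarrow> truncated_eval n \<rho> Q \<le> q"
    using one_plus_power_second_order[OF G] by metis
  define z where "z n = fps_nth (Z * Z * Q) (n - 2)" for n
  define v where "v n = (\<Sum>j=2..n - 1. Y j * (real (Suc n - j) * Y (Suc n - j)))" for n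
  have ZZQ: "fps_nonneg (Z * Z * Q)"
    using Z Q(1) by (intro fps_nonneg_mult) auto
  have z: "0 \<le> z n" for n using ZZQ by (simp add: z_def)
  have v: "0 \<le> v n" for n using Y by (auto simp: v_def intro!: sum_nonneg)
  have power_nth: "fps_nth ((1 + G) ^ p) n = real p * Y n + z n" if "n \<ge> 2" for n
  proof -
    have "G * G * Q = fps_X ^ 2 * (Z * Z * Q)"
      by (simp add: GZ power2_eq_square algebra_simps)
    then have "(1 + G) ^ p = 1 + fps_const (real p) * G + fps_X ^ 2 * (Z * Z * Q)"
      using Q(2) by (simp add: fps_of_nat)
    then have "fps_nth ((1 + G) ^ p) n = real p * fps_nth G n + fps_nth (fps_X ^ 2 * (Z * Z * Q)) n"
      using that by simp
    then show ?thesis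
      using that by (simp add: z_def G_def fps_X_power_mult_nth del: mult_eq_0_iff)
  qed
  (* B is the total factor of Y n on the right-hand side; from K on it is at most n / 2. *)
  define B where "B = A * (real p + Y 1)"
  obtain K :: nat where K: "real K \<ge> 2 * B"
    using real_arch_simple by blast
  have B: "0 \<le> B" using A Y by (simp add: B_def)
  have step: "real n * Y n \<le> 2 * A * (z n + v n) + (if n < K then real n * Y n else 0)" if n: "n \<ge> 2" for n
  proof (cases "n < K")
    case True
    then show ?thesis using A z[of n] v[of n] by simp
  next
    case False
    have "{2..n} = insert n {2..n - 1}" using n by auto
    then have "(\<Sum>j=2..n. Y j * (real (Suc n - j) * Y (Suc n - j))) = Y n * Y 1 + v n"
      using n by (simp add: v_def)
    then have "real n * Y n \<le> A * (real p * Y n + z n) + A * (Y n * Y 1 + v n)"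
      using rec[of n] n power_nth[OF n] by (simp add: G_def)
    then have "(real n - B) * Y n \<le> A * (z n + v n)"
      by (simp add: B_def algebra_simps)
    moreover have "(real n / 2) * Y n \<le> (real n - B) * Y n"
      using False K Y[of n] by (intro mult_right_mono) auto
    ultimately show ?thesis using False by simp
  qed
  (* With this eps the derivative term uses up half of the bound eps * rho. The remaining terms, with the
     finitely many initial ones, are at most L * rho^2, and rho is chosen such that they fit into the other half. *)
  define M where "M = (\<Sum>k=2..K. real k * Y k)"
  define \<epsilon> where "\<epsilon> = 1 / (4 * A + 1)"
  define L where "L = M + 2 * A * q * (Y 1 + \<epsilon>) ^ 2"
  define \<rho> where "\<rho> = min (min 1 (1 / (Y 1 + \<epsilon>))) (\<epsilon> / 2 / (L + 1))"
  have \<epsilon>: "\<epsilon> > 0" "2 * A * \<epsilon> \<le> 1 / 2"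
    using A by (simp_all add: \<epsilon>_def field_simps)
  have M: "0 \<le> M" using Y by (auto simp: M_def intro!: sum_nonneg)
  have L: "0 \<le> L" using M A q0 by (simp add: L_def)
  have Y1: "Y 1 + \<epsilon> > 0" using Y[of 1] \<epsilon> by linarith
  have \<rho>: "0 < \<rho>" "\<rho> \<le> 1" "\<rho> * (Y 1 + \<epsilon>) \<le> 1" "\<rho> * L \<le> \<epsilon> / 2"
  proof -
    show "0 < \<rho>" using Y1 \<epsilon> L by (simp add: \<rho>_def)
    show "\<rho> \<le> 1" by (simp add: \<rho>_def)
    have "\<rho> \<le> 1 / (Y 1 + \<epsilon>)" by (simp add: \<rho>_def)
    then show "\<rho> * (Y 1 + \<epsilon>) \<le> 1" using Y1 by (simp add: field_simps)
    have "\<rho> \<le> \<epsilon> / 2 / (L + 1)" by (simp add: \<rho>_def)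
    then have "\<rho> * (L + 1) \<le> \<epsilon> / 2" using L by (simp add: field_simps)
    then show "\<rho> * L \<le> \<epsilon> / 2" using \<open>0 < \<rho>\<close> by (simp add: algebra_simps)
  qed
  define t where "t n = (\<Sum>k=2..n. real k * Y k * \<rho> ^ k)" for n
  have t_nonneg: "0 \<le> t n" for n using Y \<rho> by (auto simp: t_def intro!: sum_nonneg)
  have t_bound: "t (Suc n) \<le> \<epsilon> * \<rho>" for n
  proof (induction n)
    case 0
    show ?case using \<epsilon> \<rho> by (simp add: t_def)
  next
    case (Suc m)
    define n where "n = Suc (Suc m)"
    have n: "n \<ge> 2" and IH: "t (n - 1) \<le> \<epsilon> * \<rho>"
      using Suc by (simp_all add: n_def)
    have Y_le_t: "(\<Sum>k=2..n - 1. Y k * \<rho> ^ k) \<le> t (n - 1)"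
      unfolding t_def
    proof (rule sum_mono)
      fix k assume "k \<in> {2..n - 1}"
      then have "1 * (Y k * \<rho> ^ k) \<le> real k * (Y k * \<rho> ^ k)"
        using Y \<rho> by (intro mult_right_mono) auto
      then show "Y k * \<rho> ^ k \<le> real k * Y k * \<rho> ^ k"
        by (simp add: mult.assoc)
    qed
    have "t n \<le> (\<Sum>k=2..n. (2 * A * (z k + v k) + (if k < K then real k * Y k else 0)) * \<rho> ^ k)"
      unfolding t_def using \<rho> by (intro sum_mono mult_right_mono step) auto
    also have "\<dots> = 2 * A * (\<Sum>k=2..n. z k * \<rho> ^ k) + 2 * A * (\<Sum>k=2..n. v k * \<rho> ^ k) +
                    (\<Sum>k=2..n. if k < K then real k * Y k * \<rho> ^ k else 0)"
      by (simp add: distrib_right distrib_left sum.distrib sum_distrib_left mult.assoc if_distrib[of "\<lambda>x. x * _"] cong: if_cong)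
    also have "(\<Sum>k=2..n. if k < K then real k * Y k * \<rho> ^ k else 0) \<le> \<rho>\<^sup>2 * M"
    proof -
      have "(\<Sum>k=2..n. if k < K then real k * Y k * \<rho> ^ k else 0) =
            (\<Sum>k\<in>{2..n} \<inter> {..<K}. real k * Y k * \<rho> ^ k)"
        by (simp add: sum.If_cases lessThan_def)
      also have "\<dots> \<le> (\<Sum>k\<in>{2..n} \<inter> {..<K}. real k * Y k * \<rho>\<^sup>2)"
        using \<rho> Y by (intro sum_mono mult_left_mono power_decreasing) auto
      also have "\<dots> \<le> (\<Sum>k=2..K. real k * Y k * \<rho>\<^sup>2)"
        using Y by (intro sum_mono2) auto
      also have "\<dots> = \<rho>\<^sup>2 * M"
        unfolding M_def sum_distrib_right[symmetric] by (rule mult.commute)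
      finally show ?thesis .
    qed
    also have "(\<Sum>k=2..n. z k * \<rho> ^ k) \<le> \<rho>\<^sup>2 * (q * (Y 1 + \<epsilon>)\<^sup>2)"
    proof -
      have G_eval: "truncated_eval (n - 2) \<rho> Z * \<rho> \<le> \<rho> * (Y 1 + \<epsilon>)"
      proof -
        have "truncated_eval (n - 2) \<rho> Z * \<rho> = (\<Sum>k\<le>n - 2. Y (Suc k) * \<rho> ^ Suc k)"
          by (simp add: truncated_eval_def Z_def sum_distrib_right mult.assoc mult.commute[of \<rho>])
        also have "\<dots> = (\<Sum>k=1..n - 1. Y k * \<rho> ^ k)"
          by (rule sum.reindex_bij_witness[of _ "\<lambda>k. k - 1" Suc]) (use n in auto)
        also have "\<dots> = Y 1 * \<rho> + (\<Sum>k=2..n - 1. Y k * \<rho> ^ k)"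
          using n by (subst sum.atLeast_Suc_atMost) (auto simp: numeral_2_eq_2)
        also have "\<dots> \<le> \<rho> * (Y 1 + \<epsilon>)"
          using Y_le_t IH by (simp add: algebra_simps)
        finally show ?thesis .
      qed
      have Z_eval: "truncated_eval (n - 2) \<rho> Z \<le> Y 1 + \<epsilon>"
        using G_eval \<rho>(1) by (simp add: mult.commute)
      have "truncated_eval (n - 2) \<rho> G \<le> truncated_eval (n - 2) \<rho> Z * \<rho>"
      proof -
        have "truncated_eval (n - 2) \<rho> G \<le> truncated_eval (n - 2) \<rho> fps_X * truncated_eval (n - 2) \<rho> Z"
          unfolding GZ using Z \<rho> by (intro truncated_eval_mult_le) (auto simp: fps_X_def)
        also have "truncated_eval (n - 2) \<rho> fps_X \<le> \<rho>"
        proof -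
          have "truncated_eval (n - 2) \<rho> fps_X = (\<Sum>k\<le>n - 2. if k = 1 then \<rho> else 0)"
            unfolding truncated_eval_def by (intro sum.cong) (auto simp: fps_X_def)
          also have "\<dots> \<le> \<rho>" using \<rho>(1) by simp
          finally show ?thesis .
        qed
        finally show ?thesis
          using truncated_eval_nonneg[OF Z, of \<rho> "n - 2"] \<rho> by (simp add: mult.commute mult_right_mono)
      qed
      then have Q_eval: "truncated_eval (n - 2) \<rho> Q \<le> q"
        using q[of \<rho> "n - 2"] \<rho> G_eval by linarith
      have "(\<Sum>k=2..n. z k * \<rho> ^ k) = (\<Sum>k\<le>n - 2. fps_nth (Z * Z * Q) k * \<rho> ^ (k + 2))"
        by (rule sum.reindex_bij_witness[of _ "\<lambda>k. k + 2" "\<lambda>k. k - 2"])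
           (use n in \<open>auto simp: z_def simp del: add_2_eq_Suc add_2_eq_Suc'\<close>)
      also have "\<dots> = \<rho>\<^sup>2 * truncated_eval (n - 2) \<rho> (Z * Z * Q)"
        by (simp add: truncated_eval_def sum_distrib_left power_add power2_eq_square mult_ac)
      also have "\<dots> \<le> \<rho>\<^sup>2 * (truncated_eval (n - 2) \<rho> (Z * Z) * truncated_eval (n - 2) \<rho> Q)"
        using Z Q(1) \<rho> by (intro mult_left_mono truncated_eval_mult_le fps_nonneg_mult) auto
      also have "\<dots> \<le> \<rho>\<^sup>2 * ((Y 1 + \<epsilon>)\<^sup>2 * q)"
      proof (intro mult_left_mono mult_mono Q_eval)
        have "truncated_eval (n - 2) \<rho> (Z * Z) \<le> truncated_eval (n - 2) \<rho> Z * truncated_eval (n - 2) \<rho> Z"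
          using Z \<rho> by (intro truncated_eval_mult_le) auto
        also have "\<dots> \<le> (Y 1 + \<epsilon>)\<^sup>2"
          unfolding power2_eq_square
          using Z_eval truncated_eval_nonneg[OF Z, of \<rho> "n - 2"] \<rho> by (intro mult_mono) auto
        finally show "truncated_eval (n - 2) \<rho> (Z * Z) \<le> (Y 1 + \<epsilon>)\<^sup>2" .
      qed (use truncated_eval_nonneg[OF Q(1), of \<rho> "n - 2"] \<rho> in auto)
      finally show ?thesis by (simp add: mult.commute)
    qed
    also have "(\<Sum>k=2..n. v k * \<rho> ^ k) \<le> \<epsilon>\<^sup>2 * \<rho>"
    proof -
      have "(\<Sum>k=2..n. v k * \<rho> ^ k) * \<rho> =
            (\<Sum>k=2..n. \<Sum>j=2..k - 1. (Y j * \<rho> ^ j) * (real (Suc k - j) * Y (Suc k - j) * \<rho> ^ (Suc k - j)))"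
        unfolding v_def sum_distrib_right
      proof (intro sum.cong refl)
        fix k j assume "k \<in> {2..n}" "j \<in> {2..k - 1}"
        then have "Suc k = j + (Suc k - j)" by auto
        then have "\<rho> ^ k * \<rho> = \<rho> ^ j * \<rho> ^ (Suc k - j)"
          by (metis power_Suc2 power_add)
        then show "Y j * (real (Suc k - j) * Y (Suc k - j)) * \<rho> ^ k * \<rho> =
            (Y j * \<rho> ^ j) * (real (Suc k - j) * Y (Suc k - j) * \<rho> ^ (Suc k - j))"
          by (simp add: mult_ac del: power_Suc)
      qed
      also have "\<dots> \<le> (\<Sum>j=2..n - 1. Y j * \<rho> ^ j) * (\<Sum>j=2..n - 1. real j * Y j * \<rho> ^ j)"
        using Y \<rho> by (intro sum_convolution_le) auto
      also have "\<dots> \<le> (\<epsilon> * \<rho>) * (\<epsilon> * \<rho>)"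
        using Y_le_t IH Y \<rho> t_nonneg[of "n - 1"] \<epsilon>
        by (intro mult_mono) (auto simp: t_def intro!: sum_nonneg)
      finally have "(\<Sum>k=2..n. v k * \<rho> ^ k) * \<rho> \<le> (\<epsilon>\<^sup>2 * \<rho>) * \<rho>"
        by (simp add: power2_eq_square mult_ac)
      then show ?thesis using \<rho>(1) by simp
    qed
    finally have "t n \<le> 2 * A * (\<rho>\<^sup>2 * (q * (Y 1 + \<epsilon>)\<^sup>2)) + 2 * A * (\<epsilon>\<^sup>2 * \<rho>) + \<rho>\<^sup>2 * M"
      using A by (simp add: mult_left_mono)
    also have "\<dots> = \<rho> * (\<rho> * L) + (2 * A * \<epsilon>) * (\<epsilon> * \<rho>)"
      by (simp add: L_def power2_eq_square algebra_simps)
    also have "\<dots> \<le> \<rho> * (\<epsilon> / 2) + (1 / 2) * (\<epsilon> * \<rho>)"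
      using \<rho> \<epsilon> by (intro add_mono mult_left_mono mult_right_mono) auto
    finally show ?case by (simp add: n_def mult.commute)
  qed
  have "Y n * \<rho> ^ n \<le> \<epsilon> * \<rho> + Y 1" if n: "n \<ge> 1" for n
  proof (cases "n = 1")
    case True
    then show ?thesis
      using mult_left_mono[OF \<rho>(2) Y[of 1]] \<epsilon> \<rho> by (simp add: add_increasing)
  next
    case False
    then obtain m where m: "n = Suc m" "n \<ge> 2" using n by (cases n) auto
    have "1 * (Y n * \<rho> ^ n) \<le> real n * (Y n * \<rho> ^ n)"
      using m Y \<rho> by (intro mult_right_mono) auto
    also have "\<dots> \<le> t n"
      unfolding t_def using m Y \<rho>
      by (intro order_trans[OF _ member_le_sum[of n "{2..n}" "\<lambda>k. real k * Y k * \<rho> ^ k"]]) auto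
    also have "\<dots> \<le> \<epsilon> * \<rho>" using t_bound[of m] m by simp
    finally show ?thesis using Y[of 1] by simp
  qed
  then show ?thesis using \<rho>(1) by blast
qed

text \<open>The polynomial growth of a series in the members of \<open>S\<close> is measured by the powers of one real power
  series. Its constant coefficient is \<open>1\<close>, so that the powers increase coefficientwise with the exponent.\<close>

definition majorant :: "('v::finite, complex) mfps set \<Rightarrow> real fps" where
  "majorant S = 1 + Abs_fps (\<lambda>n. if n = 0 then 0 else \<Sum>f\<in>S. hnorm f n)"

definition majorized :: "('v::finite, complex) mfps set \<Rightarrow> nat \<Rightarrow> ('v, complex) mfps \<Rightarrow> bool" where
  "majorized S p f \<longleftrightarrow> (\<exists>A\<ge>0. \<forall>n. hnorm f n \<le> A * fps_nth (majorant S ^ p) n)"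

lemma fps_nonneg_majorant: "fps_nonneg (majorant S)"
  by (auto simp: majorant_def intro!: sum_nonneg)

lemma majorized_mult:
  assumes "majorized S p f" "majorized S p' g"
  shows "majorized S (p + p') (f * g)"
proof -
  obtain A where A: "A \<ge> 0" "\<And>n. hnorm f n \<le> A * fps_nth (majorant S ^ p) n"
    using assms(1) by (auto simp: majorized_def)
  obtain B where B: "B \<ge> 0" "\<And>n. hnorm g n \<le> B * fps_nth (majorant S ^ p') n"
    using assms(2) by (auto simp: majorized_def)
  have nn: "0 \<le> fps_nth (majorant S ^ p) n" for p n
    using fps_nonneg_power[OF fps_nonneg_majorant] by blast
  have "hnorm (f * g) n \<le> A * B * fps_nth (majorant S ^ (p + p')) n" for n
  proof -
    have "hnorm (f * g) n \<le>
        (\<Sum>j\<le>n. (A * fps_nth (majorant S ^ p) j) * (B * fps_nth (majorant S ^ p') (n - j)))"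
      using A B nn by (intro order_trans[OF hnorm_mult_le] sum_mono mult_mono) auto
    also have "\<dots> = A * B * fps_nth (majorant S ^ (p + p')) n"
      by (simp add: power_add fps_mult_nth atLeast0AtMost sum_distrib_left mult_ac)
    finally show ?thesis .
  qed
  then show ?thesis
    using A(1) B(1) unfolding majorized_def by (intro exI[of _ "A * B"]) auto
qed

lemma majorized_mono:
  assumes "majorized S p f" "p \<le> p'"
  shows "majorized S p' f"
proof -
  obtain A where A: "A \<ge> 0" "\<And>n. hnorm f n \<le> A * fps_nth (majorant S ^ p) n"
    using assms(1) by (auto simp: majorized_def)
  have nn: "0 \<le> fps_nth (majorant S ^ p) n" for p n
    using fps_nonneg_power[OF fps_nonneg_majorant] by blast
  have "fps_nth (majorant S ^ p) n \<le> fps_nth (majorant S ^ Suc p) n" for p n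
  proof -
    have "fps_nth (majorant S) 0 * fps_nth (majorant S ^ p) (n - 0) \<le> fps_nth (majorant S * majorant S ^ p) n"
      unfolding fps_mult_nth
      by (rule member_le_sum[of 0 "{0..n}" "\<lambda>i. fps_nth (majorant S) i * fps_nth (majorant S ^ p) (n - i)"])
         (auto intro!: mult_nonneg_nonneg nn fps_nonneg_majorant[rule_format])
    then show ?thesis by (simp add: majorant_def)
  qed
  then have "fps_nth (majorant S ^ p) n \<le> fps_nth (majorant S ^ p') n" for n
    using lift_Suc_mono_le[of "\<lambda>p. fps_nth (majorant S ^ p) n"] assms(2) by blast
  then have "hnorm f n \<le> A * fps_nth (majorant S ^ p') n" for n
    using A by (meson mult_left_mono order_trans)
  then show ?thesis
    using A(1) unfolding majorized_def by blast
qed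

lemma majorized_add:
  assumes "majorized S p f" "majorized S p g"
  shows "majorized S p (f + g)"
proof -
  obtain A B where A: "A \<ge> 0" "\<And>n. hnorm f n \<le> A * fps_nth (majorant S ^ p) n"
    and B: "B \<ge> 0" "\<And>n. hnorm g n \<le> B * fps_nth (majorant S ^ p) n"
    using assms unfolding majorized_def by blast
  have "hnorm (f + g) n \<le> (A + B) * fps_nth (majorant S ^ p) n" for n
    using hnorm_add_le[of f g n] A(2)[of n] B(2)[of n] by (simp add: distrib_right)
  then show ?thesis
    using A(1) B(1) unfolding majorized_def by (intro exI[of _ "A + B"]) auto
qed

lemma majorized_minus: "majorized S p f \<Longrightarrow> majorized S p (- f)"
  by (simp add: majorized_def)

lemma majorized_diff: "majorized S p f \<Longrightarrow> majorized S p g \<Longrightarrow> majorized S p (f - g)"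
  using majorized_add[OF _ majorized_minus, of S p f g] by simp

lemma majorized_zero: "majorized S p 0"
  unfolding majorized_def by (rule exI[of _ 0]) simp

lemma majorized_const: "majorized S p (mfps_const c)"
proof (rule majorized_mono)
  show "majorized S 0 (mfps_const c)"
    unfolding majorized_def by (rule exI[of _ "norm c"]) (simp add: hnorm_const)
qed simp

lemma majorized_sum: "(\<And>x. x \<in> A \<Longrightarrow> majorized S p (f x)) \<Longrightarrow> majorized S p (\<Sum>x\<in>A. f x)"
  by (induction A rule: infinite_finite_induct) (auto intro: majorized_add majorized_zero)

lemma majorized_member:
  assumes "finite S" "f \<in> S"
  shows "majorized S 1 f"
proof -
  have "hnorm f n \<le> (1 + hnorm f 0) * fps_nth (majorant S ^ 1) n" for n
  proof (cases n)
    case (Suc m)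
    have "hnorm f n \<le> (\<Sum>f\<in>S. hnorm f n)"
      using assms by (intro member_le_sum) auto
    also have "\<dots> \<le> (1 + hnorm f 0) * (\<Sum>f\<in>S. hnorm f n)"
      by (simp add: distrib_right sum_nonneg)
    finally show ?thesis by (simp add: majorant_def Suc)
  qed (simp add: majorant_def)
  then show ?thesis
    unfolding majorized_def by (intro exI[of _ "1 + hnorm f 0"]) auto
qed

text \<open>The vector field \<open>w\<close> may depend on the unknowns, which form the set \<open>S\<close>; only its linear part has to be
  that of the Euler operator. The term \<open>(w\<^sup>a - x\<^sup>a) \<partial>\<^sub>a f\<close> loses one derivative, but its first factor has order at
  least two, so that the derivative enters in degree below \<open>n\<close> and the factor it produces is at most \<open>n\<close>.
  Summing over \<open>S\<close> gives the recursion of \<open>majorant_recursion_bound\<close>.\<close>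

theorem briot_bouquet:
  fixes S :: "('v::finite, complex) mfps set" and w :: "'v \<Rightarrow> ('v, complex) mfps"
  assumes S: "finite S"
    and w_low: "\<And>a k. degree_of k \<le> 1 \<Longrightarrow> mfps_nth (w a) k = mfps_nth (mfps_X a) k"
    and w_high: "\<And>a. \<exists>B\<ge>0. \<forall>n\<ge>2. hnorm (w a) n \<le> B * (\<Sum>f\<in>S. hnorm f n)"
    and eqn: "\<And>f. f \<in> S \<Longrightarrow> majorized S p (\<Sum>a\<in>UNIV. w a * mfps_deriv a f)"
    and f: "f \<in> S"
  shows "geom_bounded f"
proof -
  define Y where "Y n = (\<Sum>f\<in>S. hnorm f n)" for n
  have Y: "0 \<le> Y n" for n by (simp add: Y_def sum_nonneg)
  obtain B where B: "\<And>a. B a \<ge> 0" "\<And>a n. n \<ge> 2 \<Longrightarrow> hnorm (w a) n \<le> B a * Y n"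
    using w_high unfolding Y_def by metis
  have "\<exists>A\<ge>0. \<forall>n. hnorm (\<Sum>a\<in>UNIV. w a * mfps_deriv a f) n \<le> A * fps_nth (majorant S ^ p) n" if "f \<in> S" for f
    using eqn[OF that] by (simp add: majorized_def)
  then obtain A where A: "\<And>f. f \<in> S \<Longrightarrow> A f \<ge> 0"
      "\<And>f n. f \<in> S \<Longrightarrow> hnorm (\<Sum>a\<in>UNIV. w a * mfps_deriv a f) n \<le> A f * fps_nth (majorant S ^ p) n"
    by metis
  define A' B' where "A' = (\<Sum>f\<in>S. A f)" and "B' = (\<Sum>a\<in>UNIV. B a)"
  have A': "0 \<le> A'" and B': "0 \<le> B'"
    using A(1) B(1) by (auto simp: A'_def B'_def intro: sum_nonneg)
  have nn: "0 \<le> fps_nth (majorant S ^ p) n" for n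
    using fps_nonneg_power[OF fps_nonneg_majorant] by blast
  define conv where "conv n = (\<Sum>j=2..n. Y j * (real (Suc n - j) * Y (Suc n - j)))" for n
  have conv: "0 \<le> conv n" for n
    unfolding conv_def using Y by (intro sum_nonneg mult_nonneg_nonneg) auto
  have each: "real n * hnorm f n \<le> A f * fps_nth (majorant S ^ p) n +
      (\<Sum>a\<in>UNIV. \<Sum>j=2..n. B a * Y j * (real (Suc n - j) * hnorm f (Suc n - j)))" if "f \<in> S" for f n
  proof -
    let ?W = "\<Sum>a\<in>UNIV. w a * mfps_deriv a f"
    let ?V = "\<lambda>a. w a - mfps_X a"
    have low: "hnorm (?V a) j = 0" if "j < 2" for a j
      using w_low[of _ a] that by (auto simp: hnorm_def)
    have high: "hnorm (?V a) j \<le> B a * Y j" if "j \<ge> 2" for a j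
    proof -
      have "mfps_nth (mfps_X a :: ('v, complex) mfps) k = 0" if "degree_of k = j" for k
        using that \<open>j \<ge> 2\<close> degree_of_incr[of "\<lambda>_. 0" a] by (auto simp: mfps_X.rep_eq)
      then have "hnorm (?V a) j = hnorm (w a) j"
        by (simp add: hnorm_def)
      then show ?thesis using B(2)[OF that] by simp
    qed
    have "(\<Sum>a\<in>UNIV. mfps_X a * mfps_deriv a f) = ?W - (\<Sum>a\<in>UNIV. ?V a * mfps_deriv a f)"
      by (simp add: algebra_simps sum_subtractf)
    then have "real n * hnorm f n \<le> hnorm ?W n + hnorm (\<Sum>a\<in>UNIV. ?V a * mfps_deriv a f) n"
      using hnorm_diff_le[of ?W "\<Sum>a\<in>UNIV. ?V a * mfps_deriv a f" n]
      unfolding hnorm_euler_operator[symmetric] by (simp only:)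
    also have "hnorm ?W n \<le> A f * fps_nth (majorant S ^ p) n"
      using A(2) that by blast
    also have "hnorm (\<Sum>a\<in>UNIV. ?V a * mfps_deriv a f) n \<le> (\<Sum>a\<in>UNIV. hnorm (?V a * mfps_deriv a f) n)"
      by (rule hnorm_sum_le)
    also have "\<dots> \<le> (\<Sum>a\<in>UNIV. \<Sum>j=2..n. B a * Y j * (real (Suc n - j) * hnorm f (Suc n - j)))"
    proof (rule sum_mono)
      fix a
      have "hnorm (?V a * mfps_deriv a f) n \<le> (\<Sum>j\<le>n. hnorm (?V a) j * hnorm (mfps_deriv a f) (n - j))"
        by (rule hnorm_mult_le)
      also have "\<dots> = (\<Sum>j=2..n. hnorm (?V a) j * hnorm (mfps_deriv a f) (n - j))"
        by (rule sum.mono_neutral_right) (auto simp: low)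
      also have "\<dots> \<le> (\<Sum>j=2..n. B a * Y j * (real (Suc n - j) * hnorm f (Suc n - j)))"
      proof (intro sum_mono mult_mono high)
        fix j assume "j \<in> {2..n}"
        then show "hnorm (mfps_deriv a f) (n - j) \<le> real (Suc n - j) * hnorm f (Suc n - j)"
          using hnorm_deriv_le[of a f "n - j"] by (simp add: Suc_diff_le)
      qed (use B(1) Y in auto)
      finally show "hnorm (?V a * mfps_deriv a f) n \<le> \<dots>" .
    qed
    finally show ?thesis by simp
  qed
  have "real n * Y n \<le> A' * fps_nth (majorant S ^ p) n + B' * conv n" for n
  proof -
    have "real n * Y n \<le> (\<Sum>f\<in>S. A f * fps_nth (majorant S ^ p) n +
        (\<Sum>a\<in>UNIV. \<Sum>j=2..n. B a * Y j * (real (Suc n - j) * hnorm f (Suc n - j))))"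
      unfolding Y_def[of n] sum_distrib_left by (intro sum_mono each)
    also have "\<dots> = A' * fps_nth (majorant S ^ p) n +
        (\<Sum>a\<in>UNIV. \<Sum>j=2..n. B a * Y j * (real (Suc n - j) * Y (Suc n - j)))"
    proof -
      have "(\<Sum>f\<in>S. \<Sum>a\<in>UNIV. \<Sum>j=2..n. B a * Y j * (real (Suc n - j) * hnorm f (Suc n - j))) =
            (\<Sum>a\<in>UNIV. \<Sum>j=2..n. \<Sum>f\<in>S. B a * Y j * (real (Suc n - j) * hnorm f (Suc n - j)))"
        by (subst sum.swap) (intro sum.cong refl sum.swap)
      also have "\<dots> = (\<Sum>a\<in>UNIV. \<Sum>j=2..n. B a * Y j * (real (Suc n - j) * Y (Suc n - j)))"
        by (intro sum.cong refl) (simp only: sum_distrib_left[symmetric] Y_def[symmetric])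
      finally show ?thesis
        by (simp only: sum.distrib A'_def sum_distrib_right)
    qed
    also have "(\<Sum>a\<in>UNIV. \<Sum>j=2..n. B a * Y j * (real (Suc n - j) * Y (Suc n - j))) = B' * conv n"
      unfolding B'_def conv_def sum_product by (simp only: mult.assoc)
    finally show ?thesis .
  qed
  also have "A' * fps_nth (majorant S ^ p) n + B' * conv n \<le>
      (A' + B') * fps_nth (majorant S ^ p) n + (A' + B') * conv n" for n
    using A' B' conv[of n] nn[of n] by (intro add_mono mult_right_mono) auto
  finally have rec: "real n * Y n \<le> (A' + B') * fps_nth (majorant S ^ p) n + (A' + B') * conv n" for n .
  have maj: "majorant S = 1 + Abs_fps (\<lambda>n. if n = 0 then 0 else Y n)"
    by (simp only: majorant_def Y_def)
  have "\<exists>C \<rho>. \<rho> > 0 \<and> (\<forall>n\<ge>1. Y n * \<rho> ^ n \<le> C)"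
    by (rule majorant_recursion_bound[where Y = Y and A = "A' + B'" and p = p])
       (use Y rec[unfolded maj conv_def] A' B' in auto)
  then obtain C \<rho> where \<rho>: "\<rho> > 0" and C: "\<And>n. n \<ge> 1 \<Longrightarrow> Y n * \<rho> ^ n \<le> C"
    by blast
  define R where "R = max (1 + 1 / \<rho>) (max C (hnorm f 0))"
  have R: "R \<ge> 1" "1 / \<rho> \<le> R" "C \<le> R" "hnorm f 0 \<le> R"
    using \<rho> by (auto simp: R_def le_max_iff_disj)
  have "hnorm f n \<le> R ^ Suc n" for n
  proof (cases n)
    case (Suc m)
    have "hnorm f n \<le> Y n"
      unfolding Y_def using S f by (intro member_le_sum) auto
    also have "\<dots> \<le> C * (1 / \<rho>) ^ n"
      using C[of n] \<rho> by (simp add: Suc power_one_over field_simps)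
    also have "\<dots> \<le> R * R ^ n"
      using R \<rho> by (intro mult_mono power_mono) auto
    finally show ?thesis by simp
  qed (use R in simp)
  then show ?thesis
    unfolding geom_bounded_def using R(1) by blast
qed

section \<open>Formal linear algebra and lifting of idempotents\<close>

lemma sum_rotate3:
  "(\<Sum>x\<in>A. \<Sum>y\<in>B. \<Sum>z\<in>C. f x y z) = (\<Sum>y\<in>B. \<Sum>z\<in>C. \<Sum>x\<in>A. f x y z)"
  by (subst sum.swap) (rule sum.cong[OF refl], rule sum.swap)

lemma sum_rotate4:
  "(\<Sum>x\<in>A. \<Sum>y\<in>B. \<Sum>z\<in>C. \<Sum>w\<in>D. f x y z w) = (\<Sum>y\<in>B. \<Sum>z\<in>C. \<Sum>w\<in>D. \<Sum>x\<in>A. f x y z w)"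
  by (subst sum.swap) (rule sum.cong[OF refl], rule sum_rotate3)

lemma sum_mult_delta [simp]:
  fixes x :: "'n::finite \<Rightarrow> 'a::comm_ring_1"
  shows "(\<Sum>k\<in>UNIV. x k * (if k = j then 1 else 0)) = x j"
    and "(\<Sum>k\<in>UNIV. x k * (if j = k then 1 else 0)) = x j"
    and "(\<Sum>k\<in>UNIV. (if k = j then 1 else 0) * x k) = x j"
    and "(\<Sum>k\<in>UNIV. (if j = k then 1 else 0) * x k) = x j"
  by (simp_all add: if_distrib[of "\<lambda>c. c * x _"] if_distrib[of "\<lambda>c. x _ * c"] cong: if_cong)

definition order_ge :: "nat \<Rightarrow> ('v::finite, 'a::zero) mfps \<Rightarrow> bool" where
  "order_ge n f \<longleftrightarrow> (\<forall>k. degree_of k < n \<longrightarrow> mfps_nth f k = 0)"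

lemma order_ge_0 [simp]: "order_ge 0 f"
  by (simp add: order_ge_def)

lemma order_ge_1_iff: "order_ge (Suc 0) f \<longleftrightarrow> const_coeff f = 0"
  by (auto simp: order_ge_def less_Suc_eq)

lemma eq_0_if_order_ge: "(\<And>n. order_ge n f) \<Longrightarrow> f = (0 :: ('v::finite, 'a::comm_ring_1) mfps)"
  unfolding order_ge_def by (rule mfps_eqI) (metis lessI mfps_nth_zero)

lemma order_ge_mono: "order_ge n f \<Longrightarrow> m \<le> n \<Longrightarrow> order_ge m f"
  by (auto simp: order_ge_def)

lemma order_ge_zero [simp]: "order_ge n (0 :: ('v::finite, 'a::comm_ring_1) mfps)"
  and order_ge_add: "order_ge n f \<Longrightarrow> order_ge n g \<Longrightarrow> order_ge n (f + g)"
  and order_ge_diff: "order_ge n f \<Longrightarrow> order_ge n g \<Longrightarrow> order_ge n (f - g)"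
  and order_ge_minus: "order_ge n f \<Longrightarrow> order_ge n (- f)"
  for f g :: "('v::finite, 'a::comm_ring_1) mfps"
  by (auto simp: order_ge_def)

lemma order_ge_sum:
  fixes f :: "'b \<Rightarrow> ('v::finite, 'a::comm_ring_1) mfps"
  shows "(\<And>x. x \<in> A \<Longrightarrow> order_ge n (f x)) \<Longrightarrow> order_ge n (\<Sum>x\<in>A. f x)"
  by (auto simp: order_ge_def intro: sum.neutral)

lemma order_ge_mult:
  fixes f g :: "('v::finite, 'a::comm_ring_1) mfps"
  assumes "order_ge m f" "order_ge n g"
  shows "order_ge (m + n) (f * g)"
  unfolding order_ge_def
proof (intro allI impI)
  fix k :: "'v \<Rightarrow> nat" assume k: "degree_of k < m + n"
  have "mfps_nth f a * mfps_nth g (k - a) = 0" if "a \<le> k" for a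
  proof (cases "degree_of a < m")
    case False
    then have "degree_of (k - a) < n"
      using k degree_of_diff[OF that] degree_of_mono[OF that] by linarith
    then show ?thesis using assms(2) by (simp add: order_ge_def)
  qed (use assms(1) in \<open>simp add: order_ge_def\<close>)
  then show "mfps_nth (f * g) k = 0"
    by (simp add: mfps_nth_mult)
qed

lemma order_ge_trans:
  fixes f g h :: "('v::finite, 'a::comm_ring_1) mfps"
  shows "order_ge n (f - g) \<Longrightarrow> order_ge n (g - h) \<Longrightarrow> order_ge n (f - h)"
  using order_ge_add[of n "f - g" "g - h"] by simp

text \<open>The Banach fixed point theorem for the adic metric. Contraction is only required on the ball of
  families that agree with \<open>f0\<close> at the origin; nonlinear equations contract only near a solution of their
  constant part.\<close>

lemma formal_fixed_point:
  fixes T :: "('i \<Rightarrow> ('v::finite, 'a::comm_ring_1) mfps) \<Rightarrow> 'i \<Rightarrow> ('v, 'a) mfps"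
  assumes start: "\<And>f. (\<And>i. order_ge 1 (f i - f0 i)) \<Longrightarrow> (\<And>i. order_ge 1 (T f i - f0 i))"
    and contr: "\<And>n f g. (\<And>i. order_ge 1 (f i - f0 i)) \<Longrightarrow> (\<And>i. order_ge 1 (g i - f0 i)) \<Longrightarrow>
      (\<And>i. order_ge n (f i - g i)) \<Longrightarrow> (\<And>i. order_ge (Suc n) (T f i - T g i))"
  shows "\<exists>f. (\<forall>i. order_ge 1 (f i - f0 i)) \<and> T f = f"
proof -
  define F where "F m = (T ^^ m) f0" for m
  have F_Suc: "F (Suc m) = T (F m)" for m by (simp add: F_def)
  have F_start: "order_ge 1 (F m i - f0 i)" for m i
  proof (induction m arbitrary: i)
    case (Suc m)
    then show ?case unfolding F_Suc by (rule start)
  qed (simp add: F_def)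
  have F_step: "order_ge (Suc m) (F (Suc m) i - F m i)" for m i
  proof (induction m arbitrary: i)
    case 0
    show ?case using F_start[of 1] by (simp add: F_def)
  next
    case (Suc m)
    then show ?case unfolding F_Suc[of "Suc m"] F_Suc[of m]
      by (intro contr) (use F_start in \<open>auto simp: F_Suc[symmetric]\<close>)
  qed
  have F_cauchy: "order_ge (Suc m) (F (m + d) i - F m i)" for m d i
  proof (induction d)
    case (Suc d)
    have "order_ge (Suc m) (F (Suc (m + d)) i - F (m + d) i)"
      using F_step by (rule order_ge_mono) simp
    then show ?case using Suc by (auto intro: order_ge_trans)
  qed simp
  define f where "f i = Abs_mfps (\<lambda>k. mfps_nth (F (degree_of k) i) k)" for i
  have f_lim: "order_ge (Suc m) (F m i - f i)" for m i
    unfolding order_ge_def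
  proof (intro allI impI)
    fix k :: "'v \<Rightarrow> nat" assume "degree_of k < Suc m"
    then obtain d where d: "m = degree_of k + d" using less_Suc_eq_le nat_le_iff_add by auto
    have "mfps_nth (F m i) k = mfps_nth (F (degree_of k) i) k"
      using F_cauchy[of "degree_of k" d i] by (simp add: order_ge_def d)
    then show "mfps_nth (F m i - f i) k = 0"
      by (simp add: f_def Abs_mfps_inverse)
  qed
  have f_start: "order_ge 1 (f i - f0 i)" for i
  proof -
    have "order_ge 1 (f i - F 0 i)"
      using order_ge_minus[OF f_lim[of 0 i]] by simp
    then show ?thesis by (simp add: F_def)
  qed
  have "T f i - f i = 0" for i
  proof (rule eq_0_if_order_ge)
    fix n
    have *: "order_ge n (f i - F n i)" for i
      using order_ge_mono[OF order_ge_minus[OF f_lim[of n i]], of n] by simp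
    have "order_ge (Suc n) (T f i - T (F n) i)"
      by (rule contr) (use f_start F_start * in auto)
    moreover have "order_ge (Suc n) (F (Suc n) i - f i)"
      using order_ge_mono[OF f_lim] by simp
    ultimately have "order_ge (Suc n) (T f i - f i)"
      by (auto simp: F_Suc intro: order_ge_trans)
    then show "order_ge n (T f i - f i)"
      by (rule order_ge_mono) simp
  qed
  then have "T f = f" by (auto simp: fun_eq_iff)
  then show ?thesis using f_start by blast
qed

definition matrix_at_0 :: "('v::finite, 'a) mfps ^ 'n ^ 'm \<Rightarrow> 'a ^ 'n ^ 'm" where
  "matrix_at_0 A = (\<chi> i j. const_coeff (A $ i $ j))"

lemma matrix_at_0_mult:
  fixes A :: "('v::finite, 'a::comm_ring_1) mfps ^ 'n ^ 'm"
  shows "matrix_at_0 (A ** B) = matrix_at_0 A ** matrix_at_0 B"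
  by (simp add: matrix_at_0_def matrix_matrix_mult_def vec_eq_iff)

lemma matrix_at_0_one: "matrix_at_0 (mat 1 :: ('v::finite, 'a::comm_ring_1) mfps ^ 'n ^ 'n) = mat 1"
  by (simp add: matrix_at_0_def mat_def vec_eq_iff)

text \<open>After multiplication by the inverse at the origin the matrix is \<open>1 + N\<close> with \<open>N\<close> of positive order, and
  \<open>K = 1 - K N\<close> is a fixed point equation for its left inverse.\<close>

lemma formal_matrix_left_inverse:
  fixes A :: "('v::finite, 'a::comm_ring_1) mfps ^ 'n ^ 'n"
  assumes B: "B ** matrix_at_0 A = mat 1"
  shows "\<exists>L. L ** A = mat 1"
proof -
  define C :: "('v, 'a) mfps ^ 'n ^ 'n" where "C = (\<chi> i j. mfps_const (B $ i $ j))"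
  have C: "matrix_at_0 C = B"
    by (simp add: C_def matrix_at_0_def vec_eq_iff)
  define N where "N = C ** A - mat 1"
  have N: "order_ge 1 (N $ i $ j)" for i j
  proof -
    have "matrix_at_0 (C ** A) $ i $ j = mat 1 $ i $ j"
      by (simp add: matrix_at_0_mult C B)
    then show ?thesis
      by (auto simp: order_ge_1_iff N_def matrix_at_0_def mat_def)
  qed
  define T where "T K = (\<lambda>(i, j). (mat 1 :: ('v, 'a) mfps ^ 'n ^ 'n) $ i $ j - (\<Sum>k\<in>UNIV. K (i, k) * N $ k $ j))" for K
  have "\<exists>K. (\<forall>x. order_ge 1 (K x - (\<lambda>(i, j). (mat 1 :: ('v, 'a) mfps ^ 'n ^ 'n) $ i $ j) x)) \<and> T K = K"
  proof (rule formal_fixed_point)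
    fix K :: "'n \<times> 'n \<Rightarrow> ('v, 'a) mfps" and x :: "'n \<times> 'n"
    have "order_ge (0 + 1) (K (i, k) * N $ k $ j)" for i k j
      using N by (intro order_ge_mult) auto
    then show "order_ge 1 (T K x - (\<lambda>(i, j). (mat 1 :: ('v, 'a) mfps ^ 'n ^ 'n) $ i $ j) x)"
      by (auto simp: T_def case_prod_unfold intro!: order_ge_sum order_ge_minus)
  next
    fix n and K K' :: "'n \<times> 'n \<Rightarrow> ('v, 'a) mfps" and x :: "'n \<times> 'n" assume *: "\<And>x. order_ge n (K x - K' x)"
    have "T K x - T K' x = - (\<Sum>k\<in>UNIV. (K (fst x, k) - K' (fst x, k)) * N $ k $ snd x)"
      by (simp add: T_def case_prod_unfold sum_subtractf algebra_simps)
    moreover have "order_ge (n + 1) ((K (fst x, k) - K' (fst x, k)) * N $ k $ snd x)" for k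
      using * N by (intro order_ge_mult) auto
    ultimately show "order_ge (Suc n) (T K x - T K' x)"
      by (auto intro!: order_ge_sum order_ge_minus)
  qed
  then obtain K where K: "T K = K" by blast
  define K' where "K' = (\<chi> i j. K (i, j))"
  have "K' $ i $ j = mat 1 $ i $ j - (K' ** N) $ i $ j" for i j
    using fun_cong[OF K, of "(i, j)"] by (simp add: T_def K'_def matrix_matrix_mult_def)
  then have "K' = mat 1 - K' ** N"
    by (simp add: vec_eq_iff)
  moreover have "K' ** (C ** A) = K' + K' ** N"
  proof -
    have "C ** A = mat 1 + N" by (simp add: N_def)
    then show ?thesis by (simp add: matrix_add_ldistrib)
  qed
  ultimately have "K' ** (C ** A) = mat 1"
    by (metis diff_add_cancel)
  then have "(K' ** C) ** A = mat 1"
    by (simp add: matrix_mul_assoc)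
  then show ?thesis by blast
qed

text \<open>The left inverse has a left inverse in its turn, and the latter is the original matrix.\<close>

lemma formal_matrix_inverse:
  fixes A :: "('v::finite, 'a::field) mfps ^ 'n ^ 'n"
  assumes B: "B ** matrix_at_0 A = mat 1"
  shows "\<exists>L. L ** A = mat 1 \<and> A ** L = mat 1"
proof -
  obtain L where L: "L ** A = mat 1"
    using formal_matrix_left_inverse[OF B] by blast
  then have "matrix_at_0 L ** matrix_at_0 A = mat 1"
    by (metis matrix_at_0_mult matrix_at_0_one)
  then have "matrix_at_0 A ** matrix_at_0 L = mat 1"
    by (simp add: matrix_left_right_inverse)
  then obtain L' where L': "L' ** L = mat 1"
    using formal_matrix_left_inverse by blast
  have "L' = L' ** (L ** A)" by (simp add: L)
  also have "\<dots> = A" by (simp add: matrix_mul_assoc L')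
  finally show ?thesis using L L' by blast
qed

lemma formal_inverse:
  fixes f :: "('v::finite, 'a::field) mfps"
  assumes "const_coeff f \<noteq> 0"
  shows "\<exists>g. g * f = 1"
proof -
  let ?A = "(\<chi> i j. f) :: ('v, 'a) mfps ^ 1 ^ 1"
  have "(\<chi> i j. 1 / const_coeff f) ** matrix_at_0 ?A = mat 1"
    using assms by (simp add: matrix_at_0_def matrix_matrix_mult_def vec_eq_iff mat_def)
  then obtain L where "L ** ?A = mat 1"
    using formal_matrix_left_inverse by blast
  then have "L $ 1 $ 1 * f = 1"
    by (simp add: matrix_matrix_mult_def vec_eq_iff mat_def)
  then show ?thesis by blast
qed

text \<open>\<open>c a b d\<close> is the coefficient of \<open>\<partial>\<^sub>a\<close> in \<open>\<partial>\<^sub>b \<star> \<partial>\<^sub>d\<close>, and \<open>e\<close> is the index of the coordinate unit field.\<close>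

locale formal_algebra =
  fixes c :: "'n::finite \<Rightarrow> 'n \<Rightarrow> 'n \<Rightarrow> ('v::finite, 'a::field) mfps" and e :: 'n
  assumes c_commute: "c a b d = c a d b"
    and c_assoc: "(\<Sum>g\<in>UNIV. c g b d * c a g f) = (\<Sum>g\<in>UNIV. c g f d * c a g b)"
    and c_unit: "c a e b = (if a = b then 1 else 0)"
begin

definition prd :: "('v, 'a) mfps ^ 'n \<Rightarrow> ('v, 'a) mfps ^ 'n \<Rightarrow> ('v, 'a) mfps ^ 'n" (infixl "\<star>" 70) where
  "v \<star> w = (\<chi> a. \<Sum>b\<in>UNIV. \<Sum>d\<in>UNIV. c a b d * (v $ b * w $ d))"

lemma prd_commute: "v \<star> w = w \<star> v"
proof -
  have "(\<Sum>b\<in>UNIV. \<Sum>d\<in>UNIV. c a b d * (v $ b * w $ d)) =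
        (\<Sum>b\<in>UNIV. \<Sum>d\<in>UNIV. c a b d * (w $ b * v $ d))" for a
    by (subst sum.swap) (simp add: c_commute[of a] mult.commute)
  then show ?thesis by (simp add: prd_def)
qed

lemma prd_diff_left: "(u - v) \<star> w = u \<star> w - v \<star> w"
  and prd_add_left: "(u + v) \<star> w = u \<star> w + v \<star> w"
  by (simp_all add: prd_def vec_eq_iff algebra_simps sum_subtractf sum.distrib)

lemma prd_diff_right: "w \<star> (u - v) = w \<star> u - w \<star> v"
  and prd_add_right: "w \<star> (u + v) = w \<star> u + w \<star> v"
  by (simp_all add: prd_commute[of w] prd_diff_left prd_add_left)

lemma prd_zero_left [simp]: "0 \<star> w = 0"
  by (simp add: prd_def vec_eq_iff)

lemma prd_triple:
  "((u \<star> v) \<star> w) $ a =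
    (\<Sum>b\<in>UNIV. \<Sum>d\<in>UNIV. \<Sum>f\<in>UNIV. (\<Sum>g\<in>UNIV. c g b d * c a g f) * (u $ b * v $ d * w $ f))"
proof -
  have "((u \<star> v) \<star> w) $ a =
      (\<Sum>g\<in>UNIV. \<Sum>f\<in>UNIV. \<Sum>b\<in>UNIV. \<Sum>d\<in>UNIV. c g b d * c a g f * (u $ b * v $ d * w $ f))"
    by (simp add: prd_def sum_distrib_left sum_distrib_right mult_ac)
  also have "\<dots> = (\<Sum>g\<in>UNIV. \<Sum>b\<in>UNIV. \<Sum>d\<in>UNIV. \<Sum>f\<in>UNIV. c g b d * c a g f * (u $ b * v $ d * w $ f))"
    by (rule sum.cong[OF refl], rule sum_rotate3)
  also have "\<dots> = (\<Sum>b\<in>UNIV. \<Sum>d\<in>UNIV. \<Sum>f\<in>UNIV. \<Sum>g\<in>UNIV. c g b d * c a g f * (u $ b * v $ d * w $ f))"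
    by (rule sum_rotate4)
  finally show ?thesis by (simp add: sum_distrib_right)
qed

lemma prd_assoc: "(u \<star> v) \<star> w = u \<star> (v \<star> w)"
proof -
  have "((u \<star> v) \<star> w) $ a = ((w \<star> v) \<star> u) $ a" for a
  proof -
    have "((u \<star> v) \<star> w) $ a =
      (\<Sum>b\<in>UNIV. \<Sum>d\<in>UNIV. \<Sum>f\<in>UNIV. (\<Sum>g\<in>UNIV. c g f d * c a g b) * (w $ f * v $ d * u $ b))"
      unfolding prd_triple by (subst c_assoc) (simp add: mult_ac)
    also have "\<dots> = (\<Sum>f\<in>UNIV. \<Sum>d\<in>UNIV. \<Sum>b\<in>UNIV. (\<Sum>g\<in>UNIV. c g f d * c a g b) * (w $ f * v $ d * u $ b))"
      by (subst sum_rotate3) (rule sum.swap)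
    finally show ?thesis by (simp add: prd_triple)
  qed
  then show ?thesis
    by (metis prd_commute vec_eq_iff)
qed

definition unit_vector :: "('v, 'a) mfps ^ 'n" where
  "unit_vector = (\<chi> a. if a = e then 1 else 0)"

lemma prd_unit [simp]: "unit_vector \<star> v = v"
proof -
  have "(\<Sum>b\<in>UNIV. \<Sum>d\<in>UNIV. c a b d * (unit_vector $ b * v $ d)) = (\<Sum>b\<in>UNIV. if b = e then v $ a else 0)" for a
    by (intro sum.cong)
       (auto simp: unit_vector_def c_unit if_distrib[of "\<lambda>x. x * _"] cong: if_cong)
  then show ?thesis
    by (simp add: prd_def vec_eq_iff)
qed

lemma order_ge_prd:
  assumes "\<And>a. order_ge m (v $ a)" "\<And>a. order_ge n (w $ a)"
  shows "order_ge (m + n) ((v \<star> w) $ a)"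
proof -
  have "order_ge (0 + (m + n)) (c a b d * (v $ b * w $ d))" for b d
    using assms by (intro order_ge_mult) auto
  then show ?thesis
    by (auto simp: prd_def intro!: order_ge_sum)
qed

text \<open>Squaring doubles the order of vanishing.\<close>

lemma idempotent_eq_0:
  assumes idem: "z \<star> z = z" and z0: "\<And>a. const_coeff (z $ a) = 0"
  shows "z = 0"
proof -
  have "order_ge n (z $ a)" for n a
  proof (induction n arbitrary: a)
    case (Suc n)
    show ?case
    proof (cases n)
      case 0
      then show ?thesis using z0 by (simp add: order_ge_1_iff)
    next
      case (Suc m)
      have "order_ge (n + n) ((z \<star> z) $ a)"
        using Suc.IH by (intro order_ge_prd)
      then show ?thesis
        unfolding idem by (rule order_ge_mono) (simp add: Suc)
    qed
  qed simp
  then show ?thesis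
    by (simp add: vec_eq_iff eq_0_if_order_ge)
qed

text \<open>Simplified Newton iteration for \<open>p\<^sup>2 - p\<close>: its derivative \<open>2p - 1\<close> is taken at the initial value \<open>p0\<close>, where
  it is its own inverse up to terms of positive order.\<close>

lemma lift_idempotent:
  fixes p0 :: "'a ^ 'n"
  assumes p0: "\<And>a. (\<Sum>b\<in>UNIV. \<Sum>d\<in>UNIV. const_coeff (c a b d) * (p0 $ b * p0 $ d)) = p0 $ a"
  shows "\<exists>p. p \<star> p = p \<and> (\<forall>a. const_coeff (p $ a) = p0 $ a)"
proof -
  define P :: "('v, 'a) mfps ^ 'n" where "P = (\<chi> a. mfps_const (p0 $ a))"
  define s where "s = P + P - unit_vector"
  have P_idem: "order_ge 1 ((P \<star> P - P) $ a)" for a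
    using p0[of a] by (simp add: order_ge_1_iff prd_def P_def)
  have ss: "order_ge 1 ((s \<star> s - unit_vector) $ a)" for a
  proof -
    let ?y = "P \<star> P - P"
    have "s \<star> s - unit_vector = (?y + ?y) + (?y + ?y)"
      unfolding s_def prd_diff_left prd_diff_right prd_add_left prd_add_right
        prd_commute[of P unit_vector] prd_unit
      by (simp add: algebra_simps)
    then show ?thesis
      using order_ge_add[OF order_ge_add order_ge_add, OF P_idem[of a] P_idem[of a] P_idem[of a] P_idem[of a]]
      by (simp only: vector_add_component)
  qed
  define N where "N p = p - s \<star> (p \<star> p - p)" for p
  define T where "T f = (\<lambda>a. N (\<chi> b. f b) $ a)" for f
  have square: "order_ge 1 ((p \<star> p - p) $ a)" if p: "\<And>a. order_ge 1 ((p - P) $ a)" for p a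
  proof -
    have "p \<star> p - p = (p + P) \<star> (p - P) - (p - P) + (P \<star> P - P)"
      by (simp add: prd_diff_right prd_add_left prd_commute[of P p] algebra_simps)
    then have eq: "(p \<star> p - p) $ a = ((p + P) \<star> (p - P)) $ a - (p - P) $ a + (P \<star> P - P) $ a"
      by (simp only: vector_add_component vector_minus_component)
    have "order_ge (0 + 1) (((p + P) \<star> (p - P)) $ a)"
      using p by (intro order_ge_prd) auto
    then show ?thesis
      unfolding eq add_0 by (intro order_ge_add order_ge_diff p P_idem)
  qed
  have "\<exists>f. (\<forall>a. order_ge 1 (f a - P $ a)) \<and> T f = f"
  proof (rule formal_fixed_point)
    fix f a assume f: "\<And>a. order_ge 1 (f a - P $ a)"
    have "order_ge (0 + 1) ((s \<star> ((\<chi> b. f b) \<star> (\<chi> b. f b) - (\<chi> b. f b))) $ a)"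
      using f by (intro order_ge_prd square) auto
    moreover have eq: "T f a - P $ a = (f a - P $ a) - (s \<star> ((\<chi> b. f b) \<star> (\<chi> b. f b) - (\<chi> b. f b))) $ a"
      by (simp add: T_def N_def)
    ultimately show "order_ge 1 (T f a - P $ a)"
      unfolding eq add_0 by (intro order_ge_diff f)
  next
    fix n f g a
    assume f: "\<And>a. order_ge 1 (f a - P $ a)" and g: "\<And>a. order_ge 1 (g a - P $ a)"
      and fg: "\<And>a. order_ge n (f a - g a)"
    let ?f = "\<chi> b. f b" and ?g = "\<chi> b. g b"
    let ?D = "?f - ?g"
    have "N ?f - N ?g = ?D - s \<star> ((?f + ?g) \<star> ?D - ?D)"
      by (simp add: N_def prd_diff_right prd_add_left prd_add_right prd_commute[of ?g ?f] algebra_simps)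
    also have "(?f + ?g) \<star> ?D - ?D = s \<star> ?D + ((?f - P) + (?g - P)) \<star> ?D"
      by (simp add: s_def prd_diff_left prd_add_left algebra_simps)
    also have "?D - s \<star> (s \<star> ?D + ((?f - P) + (?g - P)) \<star> ?D) =
        - ((s \<star> s - unit_vector) \<star> ?D) - s \<star> (((?f - P) + (?g - P)) \<star> ?D)"
      by (simp add: prd_add_right prd_diff_left prd_assoc)
    finally have N_diff: "N ?f - N ?g =
        - ((s \<star> s - unit_vector) \<star> ?D) - s \<star> (((?f - P) + (?g - P)) \<star> ?D)" .
    have "T f a - T g a =
        - ((s \<star> s - unit_vector) \<star> ?D) $ a - (s \<star> (((?f - P) + (?g - P)) \<star> ?D)) $ a"
      using arg_cong[OF N_diff, of "\<lambda>v. v $ a"]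
      by (simp only: T_def vector_minus_component vector_uminus_component)
    moreover have "order_ge (1 + n) (((s \<star> s - unit_vector) \<star> ?D) $ a)"
      using ss fg by (intro order_ge_prd) auto
    moreover have "order_ge (0 + (1 + n)) ((s \<star> (((?f - P) + (?g - P)) \<star> ?D)) $ a)"
    proof -
      have "order_ge 1 (((?f - P) + (?g - P)) $ b)" for b
        by (simp only: vector_add_component vector_minus_component vec_lambda_beta) (intro order_ge_add f g)
      moreover have "order_ge n (?D $ b)" for b
        using fg by simp
      ultimately show ?thesis by (intro order_ge_prd order_ge_0)
    qed
    ultimately show "order_ge (Suc n) (T f a - T g a)"
      by (auto intro!: order_ge_diff order_ge_minus)
  qed
  then obtain f where f: "\<And>a. order_ge 1 (f a - P $ a)" "T f = f" by blast
  define p where "p = (\<chi> a. f a)"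
  define z where "z = p \<star> p - p"
  have "N p = p"
    using f(2) by (simp add: T_def p_def vec_eq_iff fun_eq_iff)
  then have sz: "s \<star> z = 0"
    by (simp add: N_def z_def)
  have z_eq: "z = - ((s \<star> s - unit_vector) \<star> z)"
    using sz by (simp add: prd_diff_left prd_assoc prd_commute[of s 0])
  have "order_ge n (z $ a)" for n a
  proof (induction n arbitrary: a)
    case (Suc n)
    have "order_ge (1 + n) (((s \<star> s - unit_vector) \<star> z) $ a)"
      using ss Suc by (intro order_ge_prd) auto
    then show ?case
      by (subst z_eq) (auto intro: order_ge_minus)
  qed simp
  then have "z = 0"
    by (simp add: vec_eq_iff eq_0_if_order_ge)
  then have "p \<star> p = p" by (simp add: z_def)
  moreover have "const_coeff (p $ a) = p0 $ a" for a
    using f(1)[of a] by (simp add: p_def order_ge_1_iff P_def)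
  ultimately show ?thesis by blast
qed

text \<open>The product of two lifted idempotents is an idempotent that vanishes at the origin, hence zero.
  The lifted basis is then orthogonal, and expressing \<open>\<partial>\<^sub>b \<star> \<partial>\<^sub>d\<close> in it diagonalizes the product.\<close>

lemma formal_diagonalization:
  fixes p0 :: "'n \<Rightarrow> 'a ^ 'n" and l0 :: "'a ^ 'n ^ 'n"
  assumes p0: "\<And>i j a. (\<Sum>b\<in>UNIV. \<Sum>d\<in>UNIV. const_coeff (c a b d) * (p0 i $ b * p0 j $ d)) =
                 (if i = j then p0 i $ a else 0)"
    and l0: "l0 ** (\<chi> a i. p0 i $ a) = mat 1"
  obtains p l :: "'n \<Rightarrow> 'n \<Rightarrow> ('v, 'a) mfps"
  where "\<And>i a. const_coeff (p i a) = p0 i $ a"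
    and "\<And>i j. (\<Sum>a\<in>UNIV. l i a * p j a) = (if i = j then 1 else 0)"
    and "\<And>a b. (\<Sum>i\<in>UNIV. p i a * l i b) = (if a = b then 1 else 0)"
    and "\<And>a b d. c a b d = (\<Sum>i\<in>UNIV. p i a * l i b * l i d)"
    and "\<And>a. (\<Sum>i\<in>UNIV. p i a) = (if a = e then 1 else 0)"
proof -
  have "\<exists>p. p \<star> p = p \<and> (\<forall>a. const_coeff (p $ a) = p0 i $ a)" for i
    using p0[of _ i i] by (intro lift_idempotent) simp
  then obtain P where P: "\<And>i. P i \<star> P i = P i" "\<And>i a. const_coeff (P i $ a) = p0 i $ a"
    by metis
  have orth: "P i \<star> P j = 0" if "i \<noteq> j" for i j
  proof (rule idempotent_eq_0)
    have "(P i \<star> P j) \<star> (P i \<star> P j) = (P i \<star> P i) \<star> (P j \<star> P j)"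
      by (metis prd_assoc prd_commute)
    then show "(P i \<star> P j) \<star> (P i \<star> P j) = P i \<star> P j"
      by (simp add: P)
    show "const_coeff ((P i \<star> P j) $ a) = 0" for a
      using p0[of a i j] that by (simp add: prd_def P)
  qed
  define M where "M = (\<chi> a i. P i $ a)"
  have "l0 ** matrix_at_0 M = mat 1"
    using l0 by (simp add: M_def matrix_at_0_def P)
  then obtain L where L: "L ** M = mat 1" "M ** L = mat 1"
    using formal_matrix_inverse by blast
  define p where "p i a = P i $ a" for i a
  define l where "l i a = L $ i $ a" for i a
  have lp: "(\<Sum>a\<in>UNIV. l i a * p j a) = (if i = j then 1 else 0)" for i j
    using arg_cong[OF L(1), of "\<lambda>A. A $ i $ j"]
    by (simp add: matrix_matrix_mult_def M_def p_def l_def mat_def)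
  have pl: "(\<Sum>i\<in>UNIV. p i a * l i b) = (if a = b then 1 else 0)" for a b
    using arg_cong[OF L(2), of "\<lambda>A. A $ a $ b"]
    by (simp add: matrix_matrix_mult_def M_def p_def l_def mat_def)
  have prod: "(\<Sum>b\<in>UNIV. \<Sum>d\<in>UNIV. c a b d * (p i b * p j d)) = (if i = j then p i a else 0)" for i j a
    using arg_cong[OF P(1)[of i], of "\<lambda>v. v $ a"] arg_cong[OF orth[of i j], of "\<lambda>v. v $ a"]
    by (auto simp: prd_def p_def)
  have diag: "c a b d = (\<Sum>i\<in>UNIV. p i a * l i b * l i d)" for a b d
  proof -
    have "c a b d = (\<Sum>b'\<in>UNIV. \<Sum>d'\<in>UNIV. c a b' d' * ((\<Sum>i\<in>UNIV. p i b' * l i b) * (\<Sum>j\<in>UNIV. p j d' * l j d)))"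
      by (simp add: pl if_distrib[of "\<lambda>x. _ * x"] if_distrib[of "\<lambda>x. x * _"] cong: if_cong)
    also have "\<dots> = (\<Sum>b'\<in>UNIV. \<Sum>d'\<in>UNIV. \<Sum>i\<in>UNIV. \<Sum>j\<in>UNIV. l i b * l j d * (c a b' d' * (p i b' * p j d')))"
      unfolding sum_product unfolding sum_distrib_left by (intro sum.cong refl) (simp add: mult_ac)
    also have "\<dots> = (\<Sum>i\<in>UNIV. \<Sum>j\<in>UNIV. \<Sum>b'\<in>UNIV. \<Sum>d'\<in>UNIV. l i b * l j d * (c a b' d' * (p i b' * p j d')))"
      by (rule trans[OF sum_rotate4 sum_rotate4])
    also have "\<dots> = (\<Sum>i\<in>UNIV. \<Sum>j\<in>UNIV. l i b * l j d * (if i = j then p i a else 0))"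
      by (simp only: prod sum_distrib_left[symmetric])
    also have "\<dots> = (\<Sum>i\<in>UNIV. p i a * l i b * l i d)"
      by (simp add: if_distrib[of "\<lambda>x. _ * x"] mult_ac cong: if_cong)
    finally show ?thesis .
  qed
  (* The unit acts as the identity on the lifted idempotents, so all its coordinates in this basis are 1. *)
  have l_unit: "l j e = 1" for j
  proof -
    have "l j e = (\<Sum>i\<in>UNIV. \<Sum>k\<in>UNIV. (if j = i then 1 else 0) * l i e * (if i = k then (if k = j then 1 else 0) else 0))"
      by (simp add: if_distrib[of "\<lambda>x. _ * x"] if_distrib[of "\<lambda>x. x * _"] cong: if_cong)
    also have "\<dots> = (\<Sum>i\<in>UNIV. (if j = i then 1 else 0) * l i e * (if i = j then 1 else 0))"
      by (simp add: if_distrib[of "\<lambda>x. _ * x"] cong: if_cong)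
    also have "\<dots> = (\<Sum>i\<in>UNIV. (\<Sum>a\<in>UNIV. l j a * p i a) * l i e * (\<Sum>b\<in>UNIV. l i b * p j b))"
      by (simp only: lp)
    also have "\<dots> = (\<Sum>a\<in>UNIV. \<Sum>b\<in>UNIV. l j a * (\<Sum>i\<in>UNIV. p i a * l i e * l i b) * p j b)"
    proof -
      have "(\<Sum>i\<in>UNIV. (\<Sum>a\<in>UNIV. l j a * p i a) * l i e * (\<Sum>b\<in>UNIV. l i b * p j b)) =
            (\<Sum>i\<in>UNIV. \<Sum>a\<in>UNIV. \<Sum>b\<in>UNIV. l j a * (p i a * l i e * l i b) * p j b)"
        by (simp add: sum_distrib_left sum_distrib_right mult_ac)
      also have "\<dots> = (\<Sum>a\<in>UNIV. \<Sum>b\<in>UNIV. \<Sum>i\<in>UNIV. l j a * (p i a * l i e * l i b) * p j b)"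
        by (rule sum_rotate3)
      finally show ?thesis by (simp add: sum_distrib_left sum_distrib_right)
    qed
    also have "\<dots> = (\<Sum>a\<in>UNIV. \<Sum>b\<in>UNIV. l j a * (if a = b then 1 else 0) * p j b)"
      by (simp only: diag[symmetric] c_unit)
    also have "\<dots> = (\<Sum>a\<in>UNIV. l j a * p j a)"
      by (simp add: if_distrib[of "\<lambda>x. _ * x"] if_distrib[of "\<lambda>x. x * _"] cong: if_cong)
    finally show ?thesis by (simp add: lp)
  qed
  have "(\<Sum>i\<in>UNIV. p i a) = (if a = e then 1 else 0)" for a
    using pl[of a e] by (simp add: l_unit)
  then show ?thesis
    using that[of p l] lp pl diag P(2) by (simp add: p_def)
qed

end

section \<open>Semisimple flat F-manifolds with Euler field\<close>

lemma deriv_euler: "mfps_deriv b (euler q r a) = (if a = b then mfps_const (1 - q b) else 0)"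
  by (auto simp: euler_def mfps_deriv_X)

lemma degree_of_eq_Suc_0:
  assumes "degree_of k = Suc 0"
  obtains b where "k = (\<lambda>_. 0)(b := Suc 0)"
proof -
  have "k \<noteq> (\<lambda>_. 0)" using assms by auto
  then obtain b where b: "k b \<noteq> 0" by auto
  define k' where "k' = k(b := k b - 1)"
  have k: "k = k'(b := Suc (k' b))" using b by (auto simp: k'_def)
  then have "degree_of k' = 0"
    using assms degree_of_incr[of k' b] by simp
  then have "k' = (\<lambda>_. 0)" by simp
  then show ?thesis using that k by simp
qed

lemma eq_up_to_degree_1:
  fixes f g :: "('v::finite, 'a::comm_ring_1) mfps"
  assumes "const_coeff f = const_coeff g"
    and d: "\<And>b. const_coeff (mfps_deriv b f) = const_coeff (mfps_deriv b g)"
    and k: "degree_of k \<le> 1"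
  shows "mfps_nth f k = mfps_nth g k"
proof (cases "degree_of k")
  case (Suc m)
  then obtain b where "k = (\<lambda>_. 0)(b := Suc 0)"
    using k by (auto elim: degree_of_eq_Suc_0)
  then show ?thesis using d[of b] by (simp add: mfps_nth_deriv)
qed (use assms in auto)

text \<open>The vectors \<open>p i\<close> are the idempotent fields \<open>\<pi>\<^sub>i\<close> in flat coordinates and the covectors \<open>l i\<close> form the dual
  frame.\<close>

locale diagonalized_F_manifold =
  fixes c :: "'v::finite \<Rightarrow> 'v \<Rightarrow> 'v \<Rightarrow> ('v, complex) mfps"
    and e :: 'v and q r :: "'v \<Rightarrow> complex"
    and p l :: "'v \<Rightarrow> 'v \<Rightarrow> ('v, complex) mfps"
  assumes closed: "mfps_deriv f (c a b d) = mfps_deriv b (c a f d)"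
    and homogeneous:
      "(\<Sum>f\<in>UNIV. euler q r f * mfps_deriv f (c a b d)) = mfps_const (q b + q d - q a) * c a b d"
    and lp: "(\<Sum>a\<in>UNIV. l i a * p j a) = (if i = j then 1 else 0)"
    and pl: "(\<Sum>i\<in>UNIV. p i a * l i b) = (if a = b then 1 else 0)"
    and diag: "c a b d = (\<Sum>i\<in>UNIV. p i a * l i b * l i d)"
    and p_unit: "(\<Sum>i\<in>UNIV. p i a) = (if a = e then 1 else 0)"
begin

text \<open>The connection coefficients of the idempotent frame: \<open>\<partial>\<^sub>d \<pi>\<^sub>j = \<Sum>\<^sub>i \<beta>\<^sub>d\<^sup>i\<^sup>j \<pi>\<^sub>i\<close>.\<close>

definition beta :: "'v \<Rightarrow> 'v \<Rightarrow> 'v \<Rightarrow> ('v, complex) mfps" where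
  "beta d i j = (\<Sum>a\<in>UNIV. l i a * mfps_deriv d (p j a))"

lemma expand_in_p: "x a = (\<Sum>i\<in>UNIV. p i a * (\<Sum>b\<in>UNIV. l i b * x b))"
proof -
  have "(\<Sum>i\<in>UNIV. p i a * (\<Sum>b\<in>UNIV. l i b * x b)) = (\<Sum>b\<in>UNIV. (\<Sum>i\<in>UNIV. p i a * l i b) * x b)"
    unfolding sum_distrib_left sum_distrib_right by (subst sum.swap) (simp add: mult_ac)
  then show ?thesis
    by (simp only: pl sum_mult_delta)
qed

lemma expand_in_l: "x b = (\<Sum>j\<in>UNIV. (\<Sum>a\<in>UNIV. x a * p j a) * l j b)"
proof -
  have "(\<Sum>j\<in>UNIV. (\<Sum>a\<in>UNIV. x a * p j a) * l j b) = (\<Sum>a\<in>UNIV. x a * (\<Sum>j\<in>UNIV. p j a * l j b))"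
    unfolding sum_distrib_left sum_distrib_right by (subst sum.swap) (simp add: mult_ac)
  then show ?thesis
    by (simp only: pl sum_mult_delta)
qed

lemma beta_eq_deriv_l: "(\<Sum>a\<in>UNIV. mfps_deriv d (l i a) * p j a) = - beta d i j"
proof -
  have "mfps_deriv d (\<Sum>a\<in>UNIV. l i a * p j a) = 0"
    by (simp add: lp)
  then show ?thesis
    by (simp add: sum.distrib beta_def add_eq_0_iff2)
qed

lemma deriv_p: "mfps_deriv d (p j a) = (\<Sum>i\<in>UNIV. p i a * beta d i j)"
  unfolding beta_def by (rule expand_in_p)

lemma deriv_l: "mfps_deriv d (l i b) = - (\<Sum>j\<in>UNIV. beta d i j * l j b)"
proof -
  have "mfps_deriv d (l i b) = (\<Sum>j\<in>UNIV. (\<Sum>a\<in>UNIV. mfps_deriv d (l i a) * p j a) * l j b)"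
    by (rule expand_in_l)
  then show ?thesis
    by (simp add: beta_eq_deriv_l sum_negf)
qed

text \<open>The sum of the idempotents is the unit, whose components are constant.\<close>

lemma beta_row_sum: "(\<Sum>j\<in>UNIV. beta d i j) = 0"
proof -
  have "(\<Sum>j\<in>UNIV. beta d i j) = (\<Sum>a\<in>UNIV. l i a * mfps_deriv d (\<Sum>j\<in>UNIV. p j a))"
    unfolding beta_def mfps_deriv_sum sum_distrib_left by (rule sum.swap)
  also have "\<dots> = 0" by (simp add: p_unit if_distrib[of "mfps_deriv d"] cong: if_cong)
  finally show ?thesis .
qed

lemma l_eigen: "(\<Sum>a\<in>UNIV. l i a * (\<Sum>k\<in>UNIV. p k a * (y k * l k d))) = y i * l i d"
proof -
  have "(\<Sum>a\<in>UNIV. l i a * (\<Sum>k\<in>UNIV. p k a * (y k * l k d))) =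
        (\<Sum>k\<in>UNIV. (\<Sum>a\<in>UNIV. l i a * p k a) * (y k * l k d))"
    unfolding sum_distrib_left sum_distrib_right by (subst sum.swap) (simp add: mult_ac)
  then show ?thesis
    by (simp only: lp sum_mult_delta)
qed

lemma p_eigen: "(\<Sum>d\<in>UNIV. (\<Sum>k\<in>UNIV. p k a * (y k * l k d)) * p j d) = y j * p j a"
proof -
  have "(\<Sum>d\<in>UNIV. (\<Sum>k\<in>UNIV. p k a * (y k * l k d)) * p j d) =
        (\<Sum>k\<in>UNIV. y k * p k a * (\<Sum>d\<in>UNIV. l k d * p j d))"
    unfolding sum_distrib_left sum_distrib_right by (subst sum.swap) (simp add: mult_ac)
  then show ?thesis
    by (simp only: lp sum_mult_delta)
qed

text \<open>The derivative of the eigenvalue relation \<open>X \<pi>\<^sub>j = y\<^sub>j \<pi>\<^sub>j\<close>, contracted with \<open>\<lambda>\<^sup>i\<close>. It will be applied to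
  multiplication by a coordinate field and to multiplication by the Euler field.\<close>

lemma contract_deriv_diagonal:
  assumes X: "\<And>a d. X a d = (\<Sum>k\<in>UNIV. p k a * (y k * l k d))"
  shows "(\<Sum>a\<in>UNIV. l i a * (\<Sum>d\<in>UNIV. mfps_deriv f (X a d) * p j d)) =
         (y j - y i) * beta f i j + (if i = j then mfps_deriv f (y i) else 0)"
proof -
  have Xp: "(\<Sum>d\<in>UNIV. X a d * p j d) = y j * p j a" for a
    unfolding X by (rule p_eigen)
  have lX: "(\<Sum>a\<in>UNIV. l i a * X a d) = y i * l i d" for d
    unfolding X by (rule l_eigen)
  have "(\<Sum>d\<in>UNIV. mfps_deriv f (X a d) * p j d) + (\<Sum>d\<in>UNIV. X a d * mfps_deriv f (p j d)) =
        mfps_deriv f (y j) * p j a + y j * mfps_deriv f (p j a)" for a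
    using arg_cong[OF Xp[of a], of "mfps_deriv f"] by (simp add: sum.distrib)
  then have step: "(\<Sum>d\<in>UNIV. mfps_deriv f (X a d) * p j d) =
        mfps_deriv f (y j) * p j a + y j * mfps_deriv f (p j a) - (\<Sum>d\<in>UNIV. X a d * mfps_deriv f (p j d))" for a
    unfolding eq_diff_eq .
  have "(\<Sum>a\<in>UNIV. l i a * (\<Sum>d\<in>UNIV. mfps_deriv f (X a d) * p j d)) =
      (\<Sum>a\<in>UNIV. l i a * (mfps_deriv f (y j) * p j a + y j * mfps_deriv f (p j a) -
        (\<Sum>d\<in>UNIV. X a d * mfps_deriv f (p j d))))"
    by (simp only: step)
  also have "\<dots> = mfps_deriv f (y j) * (\<Sum>a\<in>UNIV. l i a * p j a) + y j * beta f i j -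
      (\<Sum>a\<in>UNIV. \<Sum>d\<in>UNIV. l i a * (X a d * mfps_deriv f (p j d)))"
    by (simp add: beta_def algebra_simps sum.distrib sum_subtractf sum_distrib_left)
  also have "(\<Sum>a\<in>UNIV. \<Sum>d\<in>UNIV. l i a * (X a d * mfps_deriv f (p j d))) =
      (\<Sum>d\<in>UNIV. (\<Sum>a\<in>UNIV. l i a * X a d) * mfps_deriv f (p j d))"
    unfolding sum_distrib_right by (subst sum.swap) (simp add: mult_ac)
  also have "\<dots> = y i * beta f i j"
    unfolding lX by (simp add: beta_def sum_distrib_left mult_ac)
  finally show ?thesis
    by (simp add: lp algebra_simps)
qed

lemma beta_symmetry:
  assumes "i \<noteq> j"
  shows "(l j b - l i b) * beta f i j = (l j f - l i f) * beta b i j"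
proof -
  have K: "(\<Sum>a\<in>UNIV. l i a * (\<Sum>d\<in>UNIV. mfps_deriv f (c a b d) * p j d)) = (l j b - l i b) * beta f i j" for b f
  proof -
    have "c a b d = (\<Sum>k\<in>UNIV. p k a * (l k b * l k d))" for a d
      by (simp only: diag mult.assoc)
    from contract_deriv_diagonal[of "\<lambda>a d. c a b d", OF this, of i f j] show ?thesis
      using assms by (simp only: if_False add_0_right)
  qed
  have "(\<Sum>a\<in>UNIV. l i a * (\<Sum>d\<in>UNIV. mfps_deriv f (c a b d) * p j d)) =
        (\<Sum>a\<in>UNIV. l i a * (\<Sum>d\<in>UNIV. mfps_deriv b (c a f d) * p j d))"
    unfolding closed[of f _ b] by (rule refl)
  then show ?thesis
    unfolding K .
qed

text \<open>The canonical coordinate \<open>u\<^sub>i\<close>, the eigenvalue on \<open>\<pi>\<^sub>i\<close> of multiplication by the Euler field.\<close>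

definition canon :: "'v \<Rightarrow> ('v, complex) mfps" where
  "canon i = (\<Sum>b\<in>UNIV. euler q r b * l i b)"

text \<open>The matrix of the grading operator \<open>\<mu>\<close> in the idempotent frame.\<close>

definition conn :: "'v \<Rightarrow> 'v \<Rightarrow> ('v, complex) mfps" where
  "conn i j = (\<Sum>a\<in>UNIV. mfps_const (q a) * (l i a * p j a))"

text \<open>Let \<open>U\<close> be multiplication by \<open>E\<close>. Homogeneity and closedness of \<open>c\<close> give
  \<open>\<partial>\<^sub>f U = C\<^sub>f + [C\<^sub>f, \<mu>]\<close> with \<open>C\<^sub>f\<close> multiplication by \<open>\<partial>\<^sub>f\<close>; this is the statement in the idempotent frame.\<close>

lemma contract_deriv_euler_mult:
  "(canon j - canon i) * beta f i j + (if i = j then mfps_deriv f (canon i) else 0) =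
   (if i = j then l i f else 0) + (l i f - l j f) * conn i j"
proof -
  define U where "U a d = (\<Sum>b\<in>UNIV. euler q r b * c a b d)" for a d
  have U: "U a d = (\<Sum>k\<in>UNIV. p k a * (canon k * l k d))" for a d
    unfolding U_def canon_def diag sum_distrib_left sum_distrib_right
    by (subst sum.swap) (simp add: mult_ac)
  have dU: "mfps_deriv f (U a d) = mfps_const (1 + q d - q a) * c a f d" for a d
  proof -
    have "mfps_deriv f (U a d) = (\<Sum>b\<in>UNIV. (if b = f then mfps_const (1 - q f) else 0) * c a b d) +
        (\<Sum>b\<in>UNIV. euler q r b * mfps_deriv b (c a f d))"
      by (simp add: U_def deriv_euler sum.distrib closed[of f a])
    also have "\<dots> = mfps_const (1 - q f) * c a f d + mfps_const (q f + q d - q a) * c a f d"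
      by (simp add: homogeneous if_distrib[of "\<lambda>x. x * _"] cong: if_cong)
    also have "\<dots> = mfps_const ((1 - q f) + (q f + q d - q a)) * c a f d"
      by (simp only: distrib_right mfps_const_add)
    also have "(1 - q f) + (q f + q d - q a) = 1 + q d - q a"
      by simp
    finally show ?thesis .
  qed
  have lc: "(\<Sum>a\<in>UNIV. l i a * c a f d) = l i f * l i d" for d
    using l_eigen[of i "\<lambda>k. l k f" d] by (simp add: diag mult.assoc)
  have cp: "(\<Sum>d\<in>UNIV. c a f d * p j d) = l j f * p j a" for a
    using p_eigen[of a "\<lambda>k. l k f" j] by (simp add: diag mult.assoc)
  have "(\<Sum>a\<in>UNIV. l i a * (\<Sum>d\<in>UNIV. mfps_deriv f (U a d) * p j d)) =
      (\<Sum>a\<in>UNIV. l i a * (\<Sum>d\<in>UNIV. c a f d * p j d)) +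
      (\<Sum>a\<in>UNIV. \<Sum>d\<in>UNIV. l i a * c a f d * (mfps_const (q d) * p j d)) -
      (\<Sum>a\<in>UNIV. mfps_const (q a) * l i a * (\<Sum>d\<in>UNIV. c a f d * p j d))"
    by (simp add: dU mfps_const_add mfps_const_diff sum_distrib_left sum.distrib sum_subtractf algebra_simps)
  also have "(\<Sum>a\<in>UNIV. \<Sum>d\<in>UNIV. l i a * c a f d * (mfps_const (q d) * p j d)) =
      (\<Sum>d\<in>UNIV. (\<Sum>a\<in>UNIV. l i a * c a f d) * (mfps_const (q d) * p j d))"
    unfolding sum_distrib_right by (rule sum.swap)
  also have "\<dots> = l i f * conn i j"
    unfolding lc by (simp add: conn_def sum_distrib_left mult_ac)
  also have "(\<Sum>a\<in>UNIV. mfps_const (q a) * l i a * (\<Sum>d\<in>UNIV. c a f d * p j d)) = l j f * conn i j"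
    unfolding cp by (simp add: conn_def sum_distrib_left mult_ac)
  also have "(\<Sum>a\<in>UNIV. l i a * (\<Sum>d\<in>UNIV. c a f d * p j d)) = l j f * (\<Sum>a\<in>UNIV. l i a * p j a)"
    unfolding cp by (simp add: sum_distrib_left mult_ac)
  finally have K: "(\<Sum>a\<in>UNIV. l i a * (\<Sum>d\<in>UNIV. mfps_deriv f (U a d) * p j d)) =
      l j f * (\<Sum>a\<in>UNIV. l i a * p j a) + l i f * conn i j - l j f * conn i j" .
  show ?thesis
    unfolding contract_deriv_diagonal[of U canon i f j, OF U, symmetric] K lp
    by (simp add: left_diff_distrib)
qed

lemma deriv_canon: "mfps_deriv f (canon i) = l i f"
  using contract_deriv_euler_mult[of i i f] by simp

lemma canon_diff_beta:
  assumes "i \<noteq> j"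
  shows "(canon j - canon i) * beta f i j = (l i f - l j f) * conn i j"
  using contract_deriv_euler_mult[of j i f] by (simp only: assms if_False add_0_left add_0_right)

definition shifted_canon :: "'v \<Rightarrow> ('v, complex) mfps" where
  "shifted_canon i = canon i - mfps_const (const_coeff (canon i))"

text \<open>The field \<open>\<Sum>\<^sub>i (u\<^sub>i - u\<^sub>i(0)) \<pi>\<^sub>i\<close>; in canonical coordinates centred at the origin it is the Euler operator.\<close>

definition radial :: "'v \<Rightarrow> ('v, complex) mfps" where
  "radial a = (\<Sum>i\<in>UNIV. shifted_canon i * p i a)"

definition radial_deriv :: "('v, complex) mfps \<Rightarrow> ('v, complex) mfps" where
  "radial_deriv f = (\<Sum>a\<in>UNIV. radial a * mfps_deriv a f)"

lemma radial_deriv_mult: "radial_deriv (f * g) = radial_deriv f * g + f * radial_deriv g"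
  by (simp add: radial_deriv_def sum_distrib_left sum_distrib_right algebra_simps sum.distrib)

lemma radial_deriv_diff: "radial_deriv (f - g) = radial_deriv f - radial_deriv g"
  by (simp add: radial_deriv_def algebra_simps sum_subtractf)

lemma radial_deriv_const [simp]: "radial_deriv (mfps_const x) = 0" "radial_deriv 1 = 0"
  by (simp_all add: radial_deriv_def)

lemma sum_radial_l: "(\<Sum>a\<in>UNIV. radial a * l i a) = shifted_canon i"
proof -
  have "(\<Sum>a\<in>UNIV. radial a * l i a) = (\<Sum>k\<in>UNIV. shifted_canon k * (\<Sum>a\<in>UNIV. l i a * p k a))"
    unfolding radial_def sum_distrib_left sum_distrib_right by (subst sum.swap) (simp add: mult_ac)
  then show ?thesis
    by (simp only: lp sum_mult_delta)
qed

lemma radial_deriv_canon: "radial_deriv (canon i) = shifted_canon i"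
  by (simp add: radial_deriv_def deriv_canon sum_radial_l)

lemma radial_deriv_shifted_canon: "radial_deriv (shifted_canon i) = shifted_canon i"
  unfolding shifted_canon_def[of i] radial_deriv_diff
  by (simp add: radial_deriv_canon) (simp add: shifted_canon_def)

text \<open>Since \<open>E\<close> is affine, the terms of order at least two of the radial field are linear in the unknowns.\<close>

lemma radial_eq: "radial a = euler q r a - (\<Sum>i\<in>UNIV. mfps_const (const_coeff (canon i)) * p i a)"
proof -
  have "(\<Sum>i\<in>UNIV. canon i * p i a) = euler q r a"
    unfolding canon_def by (subst expand_in_p[of "euler q r" a]) (simp add: mult.commute)
  then show ?thesis
    by (simp add: radial_def shifted_canon_def algebra_simps sum_subtractf)
qed

text \<open>The linear part is the identity because \<open>\<lambda>\<^sup>i = du\<^sub>i\<close> and \<open>\<pi>\<^sub>i\<close> are dual frames.\<close>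

lemma radial_low:
  assumes "degree_of k \<le> 1"
  shows "mfps_nth (radial a) k = mfps_nth (mfps_X a) k"
proof (rule eq_up_to_degree_1[OF _ _ assms])
  have X0: "const_coeff (mfps_X a :: ('v, complex) mfps) = 0"
    by (auto simp: mfps_X.rep_eq fun_eq_iff)
  show "const_coeff (radial a) = const_coeff (mfps_X a)"
    by (simp add: X0 radial_def shifted_canon_def)
  fix b
  have "const_coeff (mfps_deriv b (radial a)) = (\<Sum>i\<in>UNIV. const_coeff (p i a * l i b))"
    by (simp add: radial_def shifted_canon_def deriv_canon mult.commute)
  also have "\<dots> = const_coeff (\<Sum>i\<in>UNIV. p i a * l i b)"
    by (simp only: mfps_nth_sum)
  also have "\<dots> = const_coeff (mfps_deriv b (mfps_X a))"
    unfolding pl by (simp add: mfps_deriv_X)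
  finally show "const_coeff (mfps_deriv b (radial a)) = const_coeff (mfps_deriv b (mfps_X a))" .
qed

definition radial_beta :: "'v \<Rightarrow> 'v \<Rightarrow> ('v, complex) mfps" where
  "radial_beta i j = (\<Sum>f\<in>UNIV. radial f * beta f i j)"

lemma radial_deriv_p: "radial_deriv (p j a) = (\<Sum>i\<in>UNIV. p i a * radial_beta i j)"
proof -
  have "radial_deriv (p j a) = (\<Sum>f\<in>UNIV. \<Sum>i\<in>UNIV. radial f * (p i a * beta f i j))"
    by (simp only: radial_deriv_def deriv_p sum_distrib_left)
  also have "\<dots> = (\<Sum>i\<in>UNIV. \<Sum>f\<in>UNIV. radial f * (p i a * beta f i j))"
    by (rule sum.swap)
  also have "\<dots> = (\<Sum>i\<in>UNIV. p i a * radial_beta i j)"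
    unfolding radial_beta_def sum_distrib_left by (rule sum.cong[OF refl], rule sum.cong[OF refl mult.left_commute])
  finally show ?thesis .
qed

lemma radial_deriv_l: "radial_deriv (l i b) = - (\<Sum>j\<in>UNIV. radial_beta i j * l j b)"
proof -
  define T where "T f j = radial f * (beta f i j * l j b)" for f j
  have "radial f * mfps_deriv f (l i b) = - (\<Sum>j\<in>UNIV. T f j)" for f
    unfolding T_def deriv_l mult_minus_right sum_distrib_left by (rule refl)
  then have "radial_deriv (l i b) = (\<Sum>f\<in>UNIV. - (\<Sum>j\<in>UNIV. T f j))"
    unfolding radial_deriv_def by (intro sum.cong refl)
  also have "\<dots> = - (\<Sum>f\<in>UNIV. \<Sum>j\<in>UNIV. T f j)"
    by (rule sum_negf)
  also have "(\<Sum>f\<in>UNIV. \<Sum>j\<in>UNIV. T f j) = (\<Sum>j\<in>UNIV. \<Sum>f\<in>UNIV. T f j)"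
    by (rule sum.swap)
  also have "(\<Sum>j\<in>UNIV. \<Sum>f\<in>UNIV. T f j) = (\<Sum>j\<in>UNIV. radial_beta i j * l j b)"
    unfolding T_def radial_beta_def sum_distrib_right mult.assoc by (rule refl)
  finally show ?thesis .
qed

lemma radial_beta_diagonal: "radial_beta i i = - (\<Sum>j\<in>UNIV - {i}. radial_beta i j)"
proof -
  have "(\<Sum>j\<in>UNIV. radial_beta i j) = (\<Sum>f\<in>UNIV. \<Sum>j\<in>UNIV. radial f * beta f i j)"
    unfolding radial_beta_def by (rule sum.swap)
  also have "\<dots> = (\<Sum>f\<in>UNIV. radial f * (\<Sum>j\<in>UNIV. beta f i j))"
    by (simp only: sum_distrib_left)
  also have "\<dots> = 0"
    by (simp add: beta_row_sum)
  also have "(\<Sum>j\<in>UNIV. radial_beta i j) = radial_beta i i + (\<Sum>j\<in>UNIV - {i}. radial_beta i j)"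
    by (rule sum.remove) auto
  finally show ?thesis by (simp only: eq_neg_iff_add_eq_0)
qed

lemma canon_diff_radial_beta:
  assumes "i \<noteq> j"
  shows "(canon j - canon i) * radial_beta i j = (shifted_canon i - shifted_canon j) * conn i j"
proof -
  have "(canon j - canon i) * radial_beta i j = (\<Sum>f\<in>UNIV. radial f * ((canon j - canon i) * beta f i j))"
    unfolding radial_beta_def sum_distrib_left by (simp add: mult_ac)
  also have "\<dots> = ((\<Sum>f\<in>UNIV. radial f * l i f) - (\<Sum>f\<in>UNIV. radial f * l j f)) * conn i j"
    unfolding canon_diff_beta[OF assms] by (simp add: algebra_simps sum_subtractf sum_distrib_left)
  finally show ?thesis by (simp add: sum_radial_l)
qed

lemma l_diff_radial_beta:
  assumes "i \<noteq> j"
  shows "(l j b - l i b) * radial_beta i j = (shifted_canon j - shifted_canon i) * beta b i j"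
proof -
  have "(l j b - l i b) * radial_beta i j = (\<Sum>f\<in>UNIV. radial f * ((l j b - l i b) * beta f i j))"
    unfolding radial_beta_def sum_distrib_left by (simp add: mult_ac)
  also have "\<dots> = ((\<Sum>f\<in>UNIV. radial f * l j f) - (\<Sum>f\<in>UNIV. radial f * l i f)) * beta b i j"
    unfolding beta_symmetry[OF assms, of b] by (simp add: algebra_simps sum_subtractf sum_distrib_left)
  finally show ?thesis by (simp add: sum_radial_l)
qed

text \<open>For coalescing eigenvalues \<open>u\<^sub>j - u\<^sub>i\<close> cannot be inverted. The symmetry of \<open>\<beta>\<close> helps: some component of
  \<open>\<lambda>\<^sup>j - \<lambda>\<^sup>i\<close> is invertible, and multiplied by it the coefficient in question becomes
  \<open>(u\<^sub>j - u\<^sub>i) \<beta>\<^sub>b\<^sup>i\<^sup>j\<close>, which is known.\<close>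

lemma radial_beta_coalescing:
  assumes ij: "i \<noteq> j" and u: "const_coeff (canon i) = const_coeff (canon j)"
  shows "radial_beta i j = - conn i j"
proof -
  have "\<exists>b. const_coeff (l j b - l i b) \<noteq> 0"
  proof (rule ccontr)
    assume "\<not> ?thesis"
    then have eq: "const_coeff (l j b) = const_coeff (l i b)" for b
      by simp
    have "const_coeff (\<Sum>b\<in>UNIV. l j b * p j b) = const_coeff (\<Sum>b\<in>UNIV. l i b * p j b)"
      unfolding mfps_nth_sum const_coeff_mult eq by (rule refl)
    then show False
      unfolding lp using ij by simp
  qed
  then obtain b g where g: "g * (l j b - l i b) = 1"
    using formal_inverse by blast
  have "(l j b - l i b) * radial_beta i j = (l i b - l j b) * conn i j"
    using l_diff_radial_beta[OF ij, of b] canon_diff_beta[OF ij, of b] u by (simp add: shifted_canon_def)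
  then have "(l j b - l i b) * (radial_beta i j + conn i j) = 0"
    by (simp add: algebra_simps)
  then have "g * (l j b - l i b) * (radial_beta i j + conn i j) = 0"
    by (simp add: mult.assoc)
  then show ?thesis
    by (simp add: g eq_neg_iff_add_eq_0)
qed

text \<open>The quotient of \<open>(u\<^sub>j - u\<^sub>j(0)) - (u\<^sub>i - u\<^sub>i(0))\<close> by \<open>u\<^sub>j - u\<^sub>i\<close>; numerator and denominator agree in the coalescing
  case, where the value \<open>1\<close> is prescribed so that no division is needed (this includes \<open>i = j\<close>).\<close>

definition ratio :: "'v \<Rightarrow> 'v \<Rightarrow> ('v, complex) mfps" where
  "ratio i j = (if const_coeff (canon i) = const_coeff (canon j) then 1
     else (shifted_canon j - shifted_canon i) * (SOME g. g * (canon j - canon i) = 1))"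

lemma ratio_cases:
  obtains "ratio i j = 1" "const_coeff (canon i) = const_coeff (canon j)"
  | g where "g * (canon j - canon i) = 1" "ratio i j = (shifted_canon j - shifted_canon i) * g"
proof (cases "const_coeff (canon i) = const_coeff (canon j)")
  case False
  then have "\<exists>g. g * (canon j - canon i) = 1"
    by (intro formal_inverse) auto
  then have "(SOME g. g * (canon j - canon i) = 1) * (canon j - canon i) = 1"
    by (rule someI_ex)
  then show ?thesis using that(2) False by (simp add: ratio_def)
qed (use that(1) in \<open>simp add: ratio_def\<close>)

lemma radial_beta_eq:
  assumes "i \<noteq> j"
  shows "radial_beta i j = - (ratio i j * conn i j)"
proof (cases i j rule: ratio_cases)
  case 1
  then show ?thesis using radial_beta_coalescing[OF assms] by simp
next
  case (2 g)
  have "radial_beta i j = g * ((canon j - canon i) * radial_beta i j)"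
    using 2(1) by (simp add: mult.assoc[symmetric])
  also have "\<dots> = - (ratio i j * conn i j)"
    unfolding canon_diff_radial_beta[OF assms] 2(2) by (simp add: algebra_simps)
  finally show ?thesis .
qed

lemma radial_deriv_ratio: "radial_deriv (ratio i j) = ratio i j - ratio i j * ratio i j
    \<or> ratio i j = 1"
proof (cases i j rule: ratio_cases)
  case (2 g)
  let ?v = "shifted_canon j - shifted_canon i"
  have "radial_deriv (g * (canon j - canon i)) = 0"
    by (simp add: 2(1))
  then have "radial_deriv g * (canon j - canon i) = - (g * ?v)"
    by (simp add: radial_deriv_mult radial_deriv_diff radial_deriv_canon eq_neg_iff_add_eq_0)
  then have "g * (radial_deriv g * (canon j - canon i)) = g * (- (g * ?v))"
    by simp
  then have "(g * (canon j - canon i)) * radial_deriv g = - (g * (g * ?v))"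
    by (simp add: mult_ac)
  then have Dg: "radial_deriv g = - (g * (g * ?v))"
    by (simp add: 2(1))
  have Dv: "radial_deriv ?v = ?v"
    by (simp add: radial_deriv_diff radial_deriv_shifted_canon)
  have "radial_deriv (?v * g) = ?v * g - (?v * g) * (?v * g)"
    unfolding radial_deriv_mult Dv Dg by (simp add: mult_ac)
  then show ?thesis
    unfolding 2(2) by (rule disjI1)
qed simp

text \<open>The radial derivatives of \<open>\<pi>\<close>, \<open>\<lambda>\<close> and the ratios are polynomials of degree at most four in these unknowns,
  so \<open>briot_bouquet\<close> applies.\<close>

theorem structure_constants_geom_bounded: "geom_bounded (c a b d)"
proof -
  define S where "S = (\<Union>i. \<Union>j. {p i j, l i j, ratio i j})"
  have S: "finite S" by (simp add: S_def)
  have in_S: "p i j \<in> S" "l i j \<in> S" "ratio i j \<in> S" for i j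
    by (auto simp: S_def)
  note member = majorized_member[OF S]
  have conn: "majorized S 2 (conn i j)" for i j
  proof -
    have "majorized S 2 (mfps_const (q a) * (l i a * p j a))" for a
      by (rule majorized_mono[OF majorized_mult[OF majorized_const[of S 0]
            majorized_mult[OF member[OF in_S(2)] member[OF in_S(1)]]]]) simp
    then show ?thesis
      unfolding conn_def by (rule majorized_sum)
  qed
  have off: "majorized S 3 (radial_beta i j)" if "i \<noteq> j" for i j
  proof -
    have "majorized S 3 (ratio i j * conn i j)"
      by (rule majorized_mono[OF majorized_mult[OF member[OF in_S(3)] conn]]) simp
    then show ?thesis
      unfolding radial_beta_eq[OF that] by (rule majorized_minus)
  qed
  have rb: "majorized S 3 (radial_beta i j)" for i j
  proof (cases "i = j")
    case True
    then show ?thesis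
      unfolding True radial_beta_diagonal[of j] by (auto intro!: majorized_minus majorized_sum off)
  qed (rule off)
  have dp: "majorized S 4 (radial_deriv (p i j))" for i j
  proof -
    have "majorized S 4 (p k j * radial_beta k i)" for k
      by (rule majorized_mono[OF majorized_mult[OF member[OF in_S(1)] rb]]) simp
    then show ?thesis
      unfolding radial_deriv_p by (rule majorized_sum)
  qed
  have dl: "majorized S 4 (radial_deriv (l i j))" for i j
  proof -
    have "majorized S 4 (radial_beta i k * l k j)" for k
      by (rule majorized_mono[OF majorized_mult[OF rb member[OF in_S(2)]]]) simp
    then show ?thesis
      unfolding radial_deriv_l by (intro majorized_minus majorized_sum)
  qed
  have dr: "majorized S 4 (radial_deriv (ratio i j))" for i j
    using radial_deriv_ratio[of i j]
  proof
    assume *: "radial_deriv (ratio i j) = ratio i j - ratio i j * ratio i j"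
    show ?thesis
      unfolding *
    proof (rule majorized_diff)
      show "majorized S 4 (ratio i j)"
        by (rule majorized_mono[OF member[OF in_S(3)]]) simp
      show "majorized S 4 (ratio i j * ratio i j)"
        by (rule majorized_mono[OF majorized_mult[OF member[OF in_S(3)] member[OF in_S(3)]]]) simp
    qed
  qed (simp add: majorized_zero)
  have bounded: "geom_bounded f" if f: "f \<in> S" for f
  proof (rule briot_bouquet[OF S radial_low _ _ f])
    show "majorized S 4 (\<Sum>a\<in>UNIV. radial a * mfps_deriv a f)" if "f \<in> S" for f
      using that dp dl dr by (auto simp: S_def radial_deriv_def)
    fix a
    let ?u = "\<lambda>i. norm (const_coeff (canon i))"
    have "hnorm (radial a) n \<le> (\<Sum>i\<in>UNIV. ?u i) * (\<Sum>f\<in>S. hnorm f n)" if n: "n \<ge> 2" for n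
    proof -
      have euler: "hnorm (euler q r a) n = 0"
      proof -
        have "mfps_nth (euler q r a) k = 0" if "degree_of k = n" for k
          using that n degree_of_incr[of "\<lambda>_. 0" a]
          by (auto simp: euler_def mfps_nth_const mfps_X.rep_eq)
        then show ?thesis by (simp add: hnorm_def)
      qed
      have "hnorm (radial a) n \<le> (\<Sum>i\<in>UNIV. hnorm (mfps_const (const_coeff (canon i)) * p i a) n)"
      proof -
        have "hnorm (radial a) n \<le> hnorm (euler q r a) n + hnorm (\<Sum>i\<in>UNIV. mfps_const (const_coeff (canon i)) * p i a) n"
          unfolding radial_eq by (rule hnorm_diff_le)
        then show ?thesis
          unfolding euler add_0 by (rule order_trans[OF _ hnorm_sum_le])
      qed
      also have "\<dots> \<le> (\<Sum>i\<in>UNIV. ?u i * (\<Sum>f\<in>S. hnorm f n))"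
        unfolding hnorm_const_mult using S in_S
        by (intro sum_mono mult_left_mono member_le_sum[of "p _ a" S "\<lambda>f. hnorm f n"]) auto
      finally show ?thesis by (simp add: sum_distrib_right)
    qed
    then show "\<exists>B\<ge>0. \<forall>n\<ge>2. hnorm (radial a) n \<le> B * (\<Sum>f\<in>S. hnorm f n)"
      by (intro exI[of _ "\<Sum>i\<in>UNIV. ?u i"]) (auto intro: sum_nonneg)
  qed
  show ?thesis
    unfolding diag by (intro geom_bounded_sum geom_bounded_mult bounded in_S)
qed

end

text \<open>The same for an arbitrary vector potential: semisimplicity at the origin provides the initial values for the
  diagonalization.\<close>

theorem semisimple_flat_F_manifold_geom_bounded:
  fixes \<Phi> :: "'v::finite \<Rightarrow> ('v, complex) mfps"
  defines "c \<equiv> \<lambda>a b d. mfps_deriv2 b d (\<Phi> a)"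
  assumes assoc: "\<And>a b d f. (\<Sum>g\<in>UNIV. c g b d * c a g f) = (\<Sum>g\<in>UNIV. c g f d * c a g b)"
    and unit: "\<And>a b. c a e b = (if a = b then 1 else 0)"
    and homogeneous: "\<And>a b d. (\<Sum>f\<in>UNIV. euler q r f * mfps_deriv f (c a b d)) =
      mfps_const (q b + q d - q a) * c a b d"
    and ss: "semisimple \<Phi>"
  shows "geom_bounded (c a b d)"
proof -
  have commute: "c a b d = c a d b" for a b d
    unfolding c_def mfps_deriv2_def by (rule mfps_deriv_commute)
  interpret formal_algebra c e
    by (rule formal_algebra.intro) (rule commute, rule assoc, rule unit)
  obtain \<pi> where \<pi>: "idempotent_basis \<Phi> \<pi>"
    using ss by (auto simp: semisimple_def)
  have "columns (\<chi> a i. \<pi> i $ a) = range \<pi>"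
    by (auto simp: columns_def column_def)
  then have "\<exists>B. (\<chi> a i. \<pi> i $ a) ** B = mat 1"
    using \<pi> by (simp add: matrix_right_invertible_span_columns idempotent_basis_def)
  then obtain l0 where l0: "l0 ** (\<chi> a i. \<pi> i $ a) = mat 1"
    using matrix_left_right_inverse by blast
  have idem: "(\<Sum>b\<in>UNIV. \<Sum>d\<in>UNIV. const_coeff (c a b d) * (\<pi> i $ b * \<pi> j $ d)) =
      (if i = j then \<pi> i $ a else 0)" for i j a
  proof -
    have "product_at_0 \<Phi> (\<pi> i) (\<pi> j) $ a = (if i = j then \<pi> i $ a else 0)"
      using \<pi> by (simp add: idempotent_basis_def)
    then show ?thesis
      by (simp add: product_at_0_def c_def mult.assoc)
  qed
  obtain p l where "\<And>i a. const_coeff (p i a) = \<pi> i $ a" and pl: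
      "\<And>i j. (\<Sum>a\<in>UNIV. l i a * p j a) = (if i = j then 1 else 0)"
      "\<And>a b. (\<Sum>i\<in>UNIV. p i a * l i b) = (if a = b then 1 else 0)"
      "\<And>a b d. c a b d = (\<Sum>i\<in>UNIV. p i a * l i b * l i d)"
      "\<And>a. (\<Sum>i\<in>UNIV. p i a) = (if a = e then 1 else 0)"
    by (rule formal_diagonalization[OF idem l0]) (rule that)
  have closed: "mfps_deriv f (c a b d) = mfps_deriv b (c a f d)" for a b d f
    unfolding c_def mfps_deriv2_def by (rule mfps_deriv_commute)
  interpret diagonalized_F_manifold c e q r p l
    by (rule diagonalized_F_manifold.intro)
       (rule closed, rule homogeneous, rule pl(1), rule pl(2), rule pl(3), rule pl(4))
  show ?thesis
    by (rule structure_constants_geom_bounded)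
qed

section \<open>The flat F-manifold of a solution of the open WDVV equations\<close>

lemma sum_UNIV_option: "(\<Sum>x\<in>UNIV. f x) = f None + (\<Sum>i\<in>UNIV. f (Some i))"
  for f :: "'n::finite option \<Rightarrow> 'b::comm_monoid_add"
  by (simp add: UNIV_option_conv sum.reindex)

lemma mfps_nth_incl: "mfps_nth (mfps_incl f) k = (if k None = 0 then mfps_nth f (\<lambda>i. k (Some i)) else 0)"
  by (simp add: mfps_incl.rep_eq)

lemma mfps_incl_add [simp]: "mfps_incl (f + g) = mfps_incl f + mfps_incl g"
  and mfps_incl_zero [simp]: "mfps_incl 0 = (0 :: ('n option, 'a) mfps)"
  for f g :: "('n::finite, 'a::comm_ring_1) mfps"
  by (rule mfps_eqI, simp add: mfps_nth_incl)+

lemma mfps_incl_const [simp]: "mfps_incl (mfps_const c) = mfps_const c"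
proof (rule mfps_eqI)
  fix k :: "'a option \<Rightarrow> nat"
  have "k = (\<lambda>_. 0) \<longleftrightarrow> k None = 0 \<and> (\<lambda>i. k (Some i)) = (\<lambda>_. 0)"
    by (metis ext option.exhaust)
  then show "mfps_nth (mfps_incl (mfps_const c)) k = mfps_nth (mfps_const c) k"
    by (simp add: mfps_nth_incl mfps_nth_const)
qed

lemma mfps_incl_sum [simp]:
  fixes f :: "'b \<Rightarrow> ('n::finite, 'a::comm_ring_1) mfps"
  shows "mfps_incl (\<Sum>x\<in>A. f x) = (\<Sum>x\<in>A. mfps_incl (f x))"
  by (induction A rule: infinite_finite_induct) auto

lemma mfps_incl_X [simp]: "mfps_incl (mfps_X i) = mfps_X (Some i)"
proof (rule mfps_eqI)
  fix k :: "'a option \<Rightarrow> nat"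
  have "k = (\<lambda>_. 0)(Some i := 1) \<longleftrightarrow> k None = 0 \<and> (\<lambda>i. k (Some i)) = (\<lambda>_. 0)(i := 1)"
  proof
    assume *: "k None = 0 \<and> (\<lambda>i. k (Some i)) = (\<lambda>_. 0)(i := 1)"
    show "k = (\<lambda>_. 0)(Some i := 1)"
    proof
      fix x show "k x = ((\<lambda>_. 0)(Some i := 1)) x"
        using * fun_cong[of "\<lambda>i. k (Some i)" "(\<lambda>_. 0)(i := 1)"] by (cases x) auto
    qed
  qed (auto simp: fun_eq_iff)
  then show "mfps_nth (mfps_incl (mfps_X i)) k = mfps_nth (mfps_X (Some i)) k"
    by (simp add: mfps_nth_incl mfps_X.rep_eq)
qed

text \<open>A product of two series that do not involve \<open>s\<close> is convolved over exponent vectors whose \<open>s\<close>-entry is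
  zero.\<close>

lemma mfps_incl_mult [simp]:
  fixes f g :: "('n::finite, 'a::comm_ring_1) mfps"
  shows "mfps_incl (f * g) = mfps_incl f * mfps_incl g"
proof (rule mfps_eqI)
  fix k :: "'n option \<Rightarrow> nat"
  show "mfps_nth (mfps_incl (f * g)) k = mfps_nth (mfps_incl f * mfps_incl g) k"
  proof (cases "k None = 0")
    case True
    let ?r = "\<lambda>a :: 'n option \<Rightarrow> nat. \<lambda>i. a (Some i)"
    let ?x = "\<lambda>b :: 'n \<Rightarrow> nat. case_option 0 b"
    have "(\<Sum>b\<le>?r k. mfps_nth f b * mfps_nth g (?r k - b)) =
          (\<Sum>a\<le>k. mfps_nth (mfps_incl f) a * mfps_nth (mfps_incl g) (k - a))"
    proof (rule sum.reindex_bij_witness[of _ ?r ?x])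
      fix a assume "a \<in> {..k}"
      then have le: "a x \<le> k x" for x by (simp add: le_fun_def)
      show "?x (?r a) = a"
      proof
        fix x show "?x (?r a) x = a x" using le[of None] True by (cases x) auto
      qed
      show "?r a \<in> {..?r k}" using le by (simp add: le_fun_def)
    next
      fix b assume b: "b \<in> {..?r k}"
      have "?x b x \<le> k x" for x using b by (cases x) (auto simp: le_fun_def)
      then show "?x b \<in> {..k}" by (simp add: le_fun_def)
      have "?r k - b = (\<lambda>i. (k - ?x b) (Some i))" by (simp add: fun_diff_def)
      then show "mfps_nth (mfps_incl f) (?x b) * mfps_nth (mfps_incl g) (k - ?x b) =
          mfps_nth f b * mfps_nth g (?r k - b)"
        using True by (simp add: mfps_nth_incl fun_diff_def)
    qed simp
    then show ?thesis
      using True by (simp add: mfps_nth_incl mfps_nth_mult)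
  next
    case False
    have "mfps_nth (mfps_incl f) a * mfps_nth (mfps_incl g) (k - a) = 0" for a
      using False by (auto simp: mfps_nth_incl fun_diff_def)
    then show ?thesis
      using False by (simp add: mfps_nth_incl mfps_nth_mult)
  qed
qed

lemma mfps_deriv_incl [simp]:
  fixes f :: "('n::finite, 'a::comm_ring_1) mfps"
  shows "mfps_deriv (Some i) (mfps_incl f) = mfps_incl (mfps_deriv i f)"
    and "mfps_deriv None (mfps_incl f) = 0"
proof -
  have upd: "(\<lambda>j. if j = i then y else k (Some j)) = (\<lambda>j. k (Some j))(i := y)" for k :: "'n option \<Rightarrow> nat" and y
    by auto
  show "mfps_deriv (Some i) (mfps_incl f) = mfps_incl (mfps_deriv i f)"
    by (rule mfps_eqI) (simp add: mfps_nth_deriv mfps_nth_incl upd)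
  show "mfps_deriv None (mfps_incl f) = 0"
    by (rule mfps_eqI) (simp add: mfps_nth_deriv mfps_nth_incl)
qed

lemma geom_bounded_if_incl:
  fixes f :: "('n::finite, complex) mfps"
  assumes "geom_bounded (mfps_incl f)"
  shows "geom_bounded f"
proof -
  let ?x = "\<lambda>b :: 'n \<Rightarrow> nat. case_option 0 b"
  have "hnorm f n \<le> hnorm (mfps_incl f) n" for n
  proof -
    have inj: "inj ?x"
    proof (rule injI)
      fix a b :: "'n \<Rightarrow> nat" assume eq: "?x a = ?x b"
      show "a = b"
      proof
        fix i show "a i = b i" using fun_cong[OF eq, of "Some i"] by simp
      qed
    qed
    have deg: "degree_of (?x b) = degree_of b" for b
      by (simp add: degree_of_def sum_UNIV_option)
    have "hnorm f n = (\<Sum>k\<in>?x ` {b. degree_of b = n}. norm (mfps_nth (mfps_incl f) k))"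
      by (subst sum.reindex) (auto simp: hnorm_def mfps_nth_incl intro: inj_on_subset[OF inj])
    also have "\<dots> \<le> hnorm (mfps_incl f) n"
      unfolding hnorm_def by (intro sum_mono2) (auto simp: finite_degree_eq deg)
    finally show ?thesis .
  qed
  then show ?thesis
    using assms unfolding geom_bounded_def by (meson order_trans)
qed

lemma poly_deg_deriv: "mfps_poly_deg_le (Suc m) f \<Longrightarrow> mfps_poly_deg_le m (mfps_deriv i f)"
  for f :: "('v::finite, 'a::comm_ring_1) mfps"
  unfolding mfps_poly_deg_le_def degree_of_def[symmetric] by (auto simp: mfps_nth_deriv)

lemma deriv_poly_deg_0: "mfps_poly_deg_le 0 f \<Longrightarrow> mfps_deriv i f = 0"
  for f :: "('v::finite, 'a::comm_ring_1) mfps"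
  unfolding mfps_poly_deg_le_def degree_of_def[symmetric] by (auto simp: mfps_nth_deriv mfps_eq_iff fun_eq_iff)

lemma poly_deg_incl: "mfps_poly_deg_le m f \<Longrightarrow> mfps_poly_deg_le m (mfps_incl f)"
  unfolding mfps_poly_deg_le_def by (auto simp: mfps_nth_incl sum_UNIV_option)

lemma euler_homogeneous_deriv:
  assumes "(\<Sum>a\<in>UNIV. euler q r a * mfps_deriv a f) = mfps_const k * f + P"
  shows "(\<Sum>a\<in>UNIV. euler q r a * mfps_deriv a (mfps_deriv b f)) =
    mfps_const (k - (1 - q b)) * mfps_deriv b f + mfps_deriv b P"
proof -
  let ?S = "\<Sum>a\<in>UNIV. euler q r a * mfps_deriv a (mfps_deriv b f)"
  have delta: "(\<Sum>a\<in>UNIV. (if a = b then mfps_const (1 - q b) else 0) * mfps_deriv a f) =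
      mfps_const (1 - q b) * mfps_deriv b f"
    by (simp add: if_distrib[of "\<lambda>x. x * _"] cong: if_cong)
  have "mfps_deriv b (\<Sum>a\<in>UNIV. euler q r a * mfps_deriv a f) = mfps_const (1 - q b) * mfps_deriv b f + ?S"
    by (simp add: sum.distrib deriv_euler delta mfps_deriv_commute[of b])
  then have "mfps_const (1 - q b) * mfps_deriv b f + ?S = mfps_const k * mfps_deriv b f + mfps_deriv b P"
    unfolding assms by simp
  then have "?S = mfps_const k * mfps_deriv b f + mfps_deriv b P - mfps_const (1 - q b) * mfps_deriv b f"
    by (simp only: eq_diff_eq add.commute)
  then show ?thesis
    by (simp only: mfps_const_diff[of k] left_diff_distrib diff_add_eq)
qed

lemma euler_open_Some: "euler (open_q d q) (open_r r rs) (Some i) = mfps_incl (euler q r i)"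
  by (simp add: euler_def open_q_def open_r_def)

lemma euler_open_incl:
  "(\<Sum>a\<in>UNIV. euler (open_q d q) (open_r r rs) a * mfps_deriv a (mfps_incl f)) =
   mfps_incl (\<Sum>i\<in>UNIV. euler q r i * mfps_deriv i f)"
  by (simp add: sum_UNIV_option euler_open_Some)

lemma deriv2_const_mult: "mfps_deriv2 a b (f * mfps_const x) = mfps_deriv2 a b f * mfps_const x"
  by (simp add: mfps_deriv2_def)

lemma deriv2_sum: "mfps_deriv2 a b (\<Sum>x\<in>A. f x) = (\<Sum>x\<in>A. mfps_deriv2 a b (f x))"
  for f :: "_ \<Rightarrow> ('v::finite, complex) mfps"
  by (simp add: mfps_deriv2_def)

locale open_wdvv_solution =
  fixes o1 :: "'n::finite" and \<eta> :: "complex ^ 'n ^ 'n" and d rs :: complex and q r :: "'n \<Rightarrow> complex"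
    and F :: "('n, complex) mfps" and Fo :: "('n option, complex) mfps"
  assumes wdvv: "wdvv o1 \<eta> d q r F" and open_wdvv: "open_wdvv o1 \<eta> d q r rs F Fo"
begin

abbreviation "h \<equiv> matrix_inv \<eta>"

definition F3 :: "'n \<Rightarrow> 'n \<Rightarrow> 'n \<Rightarrow> ('n, complex) mfps" where
  "F3 a b c = mfps_deriv3 a b c F"

lemma F3_swap: "F3 a b c = F3 a c b"
  unfolding F3_def mfps_deriv3_def by (rule arg_cong[OF mfps_deriv_commute])

lemma eta_inverse: "\<eta> ** h = mat 1" "h ** \<eta> = mat 1"
proof -
  have "\<exists>B. \<eta> ** B = mat 1 \<and> B ** \<eta> = mat 1"
    using wdvv unfolding wdvv_def invertible_def by (elim conjE)
  then have "\<eta> ** h = mat 1 \<and> h ** \<eta> = mat 1"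
    unfolding matrix_inv_def by (rule someI_ex)
  then show "\<eta> ** h = mat 1" "h ** \<eta> = mat 1" by auto
qed

lemma sum_eta_h: "(\<Sum>b\<in>UNIV. \<eta> $ a $ b * h $ b $ c) = (if a = c then 1 else 0)"
  and sum_h_eta: "(\<Sum>b\<in>UNIV. h $ a $ b * \<eta> $ b $ c) = (if a = c then 1 else 0)"
  using arg_cong[OF eta_inverse(1), of "\<lambda>A. A $ a $ c"] arg_cong[OF eta_inverse(2), of "\<lambda>A. A $ a $ c"]
  by (simp_all add: matrix_matrix_mult_def mat_def)

lemma F3_unit: "F3 o1 a b = mfps_const (\<eta> $ a $ b)"
proof -
  have "\<forall>a b. mfps_deriv3 o1 a b F = mfps_const (\<eta> $ a $ b)"
    using wdvv unfolding wdvv_def by (elim conjE)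
  then show ?thesis by (simp add: F3_def)
qed

definition c :: "'n option \<Rightarrow> 'n option \<Rightarrow> 'n option \<Rightarrow> ('n option, complex) mfps" where
  "c a x y = mfps_deriv2 x y (open_vector_potential \<eta> F Fo a)"

lemma c_Some_None [simp]: "c (Some i) None x = 0" "c (Some i) x None = 0"
proof -
  show *: "c (Some i) None x = 0" for x
    by (cases x) (simp_all add: c_def open_vector_potential_def mfps_deriv2_def)
  have "c (Some i) x None = c (Some i) None x"
    by (simp add: c_def mfps_deriv2_def mfps_deriv_commute)
  then show "c (Some i) x None = 0" by (simp add: *)
qed

lemma c_Some: "c (Some i) (Some j) (Some k) = (\<Sum>m\<in>UNIV. mfps_incl (F3 j k m) * mfps_const (h $ m $ i))"
  by (simp add: c_def open_vector_potential_def deriv2_sum deriv2_const_mult)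
     (simp add: mfps_deriv2_def F3_def mfps_deriv3_def)

lemma c_None: "c None a b = mfps_deriv2 a b Fo"
  by (simp add: c_def open_vector_potential_def)

lemma c_commute: "c a b f = c a f b"
  by (simp add: c_def mfps_deriv2_def mfps_deriv_commute)

lemma closed_associativity:
  "(\<Sum>g\<in>UNIV. c (Some g) (Some i) (Some j) * c (Some m) (Some g) (Some k)) =
   (\<Sum>g\<in>UNIV. c (Some g) (Some k) (Some j) * c (Some m) (Some g) (Some i))"
proof -
  define W where "W i j v k = (\<Sum>x\<in>UNIV. \<Sum>g\<in>UNIV. F3 i j x * mfps_const (h $ x $ g) * F3 g v k)" for i j v k
  have "\<forall>i j v k. (\<Sum>x\<in>UNIV. \<Sum>g\<in>UNIV. F3 i j x * mfps_const (h $ x $ g) * F3 g v k) =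
      (\<Sum>x\<in>UNIV. \<Sum>g\<in>UNIV. F3 k j x * mfps_const (h $ x $ g) * F3 g v i)"
    using wdvv unfolding wdvv_def F3_def by (elim conjE)
  then have W: "W i j v k = W k j v i" for v
    unfolding W_def by (elim allE)
  have "(\<Sum>g\<in>UNIV. c (Some g) (Some i) (Some j) * c (Some m) (Some g) (Some k)) =
        (\<Sum>v\<in>UNIV. mfps_incl (W i j v k) * mfps_const (h $ v $ m))" for i k
  proof -
    have "(\<Sum>g\<in>UNIV. c (Some g) (Some i) (Some j) * c (Some m) (Some g) (Some k)) =
        (\<Sum>g\<in>UNIV. \<Sum>x\<in>UNIV. \<Sum>v\<in>UNIV.
          mfps_incl (F3 i j x * mfps_const (h $ x $ g) * F3 g v k) * mfps_const (h $ v $ m))"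
      unfolding c_Some sum_product
      by (simp only: F3_swap[of _ k] mult.assoc mfps_incl_mult mfps_incl_const)
    also have "\<dots> = (\<Sum>x\<in>UNIV. \<Sum>v\<in>UNIV. \<Sum>g\<in>UNIV.
          mfps_incl (F3 i j x * mfps_const (h $ x $ g) * F3 g v k) * mfps_const (h $ v $ m))"
      by (rule sum_rotate3)
    also have "\<dots> = (\<Sum>v\<in>UNIV. \<Sum>x\<in>UNIV. \<Sum>g\<in>UNIV.
          mfps_incl (F3 i j x * mfps_const (h $ x $ g) * F3 g v k) * mfps_const (h $ v $ m))"
      by (rule sum.swap)
    also have "\<dots> = (\<Sum>v\<in>UNIV. mfps_incl (W i j v k) * mfps_const (h $ v $ m))"
      unfolding W_def mfps_incl_sum sum_distrib_right by (rule refl)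
    finally show ?thesis .
  qed
  then show ?thesis by (simp only: W)
qed

text \<open>The two open WDVV equations are associativity of the \<open>s\<close>-component of a product of three fields, for three
  fields \<open>\<partial>\<^sub>t\<close> and for two fields \<open>\<partial>\<^sub>t\<close> and one field \<open>\<partial>\<^sub>s\<close>. With \<open>closed_associativity\<close> they cover all cases,
  because \<open>\<partial>\<^sub>s\<close> spans an ideal.\<close>

lemma open_associativity:
  "(\<Sum>g\<in>UNIV. c (Some g) (Some i) (Some j) * c None (Some g) (Some k)) + c None (Some i) (Some j) * c None None (Some k) =
   (\<Sum>g\<in>UNIV. c (Some g) (Some k) (Some j) * c None (Some g) (Some i)) + c None (Some k) (Some j) * c None None (Some i)"
proof -
  have "(\<Sum>g\<in>UNIV. c (Some g) (Some i) (Some j) * c None (Some g) (Some k)) =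
        (\<Sum>x\<in>UNIV. \<Sum>g\<in>UNIV. mfps_incl (F3 i j x) * mfps_const (h $ x $ g) * mfps_deriv2 (Some g) (Some k) Fo)" for i k
    unfolding c_Some c_None sum_distrib_right by (rule sum.swap)
  moreover have "\<forall>i j k. (\<Sum>x\<in>UNIV. \<Sum>g\<in>UNIV. mfps_incl (F3 i j x) * mfps_const (h $ x $ g) * mfps_deriv2 (Some g) (Some k) Fo)
        + mfps_deriv2 (Some i) (Some j) Fo * mfps_deriv2 None (Some k) Fo =
      (\<Sum>x\<in>UNIV. \<Sum>g\<in>UNIV. mfps_incl (F3 k j x) * mfps_const (h $ x $ g) * mfps_deriv2 (Some g) (Some i) Fo)
        + mfps_deriv2 (Some k) (Some j) Fo * mfps_deriv2 None (Some i) Fo"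
    using open_wdvv unfolding open_wdvv_def F3_def by (elim conjE)
  ultimately show ?thesis
    unfolding c_None by (simp only:)
qed

lemma open_associativity_s:
  "(\<Sum>g\<in>UNIV. c (Some g) (Some i) (Some j) * c None (Some g) None) + c None (Some i) (Some j) * c None None None =
   c None None (Some j) * c None None (Some i)"
proof -
  have "(\<Sum>g\<in>UNIV. c (Some g) (Some i) (Some j) * c None (Some g) None) =
        (\<Sum>x\<in>UNIV. \<Sum>g\<in>UNIV. mfps_incl (F3 i j x) * mfps_const (h $ x $ g) * mfps_deriv2 (Some g) None Fo)"
    unfolding c_Some c_None sum_distrib_right by (rule sum.swap)
  moreover have "\<forall>i j. (\<Sum>x\<in>UNIV. \<Sum>g\<in>UNIV. mfps_incl (F3 i j x) * mfps_const (h $ x $ g) * mfps_deriv2 (Some g) None Fo)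
        + mfps_deriv2 (Some i) (Some j) Fo * mfps_deriv2 None None Fo =
      mfps_deriv2 None (Some j) Fo * mfps_deriv2 None (Some i) Fo"
    using open_wdvv unfolding open_wdvv_def F3_def by (elim conjE)
  ultimately show ?thesis
    unfolding c_None by (simp only:)
qed

lemma c_assoc: "(\<Sum>g\<in>UNIV. c g x y * c a g z) = (\<Sum>g\<in>UNIV. c g z y * c a g x)"
proof (cases a)
  case (Some m)
  then show ?thesis
    by (cases x; cases y; cases z) (simp_all add: sum_UNIV_option closed_associativity)
next
  case None
  have swap: "c None (Some j) None = c None None (Some j)" for j
    by (rule c_commute)
  show ?thesis
  proof (cases y)
    case None
    then show ?thesis
      using \<open>a = None\<close> by (cases x; cases z) (simp_all add: sum_UNIV_option swap mult.commute)
  next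
    case y: (Some j)
    show ?thesis
    proof (cases x; cases z)
      fix i k assume "x = Some i" "z = Some k"
      then show ?thesis
        using open_associativity[of i j k] by (simp only: \<open>a = None\<close> y sum_UNIV_option add.commute)
    next
      fix i assume "x = Some i" "z = None"
      then show ?thesis
        using open_associativity_s[of i j] by (simp add: \<open>a = None\<close> y sum_UNIV_option add.commute)
    next
      fix k assume "x = None" "z = Some k"
      then show ?thesis
        using open_associativity_s[of k j] by (simp add: \<open>a = None\<close> y sum_UNIV_option add.commute)
    qed simp
  qed
qed

lemma c_unit: "c a (Some o1) b = (if a = b then 1 else 0)"
proof (cases a)
  case None
  have "\<forall>i. mfps_deriv2 (Some o1) (Some i) Fo = 0"
    using open_wdvv unfolding open_wdvv_def by (elim conjE)
  moreover have "mfps_deriv2 (Some o1) None Fo = 1"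
    using open_wdvv unfolding open_wdvv_def by (elim conjE)
  ultimately show ?thesis
    using None by (cases b) (simp_all add: c_None)
next
  case (Some i)
  show ?thesis
  proof (cases b)
    case b: (Some k)
    have "c (Some i) (Some o1) (Some k) = mfps_const (\<Sum>m\<in>UNIV. \<eta> $ k $ m * h $ m $ i)"
      by (simp add: c_Some F3_unit mfps_const_sum mfps_const_mult)
    then show ?thesis
      by (auto simp: Some b sum_eta_h)
  qed (simp add: Some)
qed

text \<open>Three derivatives annihilate the quadratic inhomogeneity in the Euler equation of \<open>F\<close>.\<close>

lemma homogeneous_F3:
  "(\<Sum>a\<in>UNIV. euler q r a * mfps_deriv a (F3 i j k)) = mfps_const (q i + q j + q k - d) * F3 i j k"
proof -
  have "\<exists>Q. mfps_poly_deg_le 2 Q \<and> (\<Sum>a\<in>UNIV. euler q r a * mfps_deriv a F) = mfps_const (3 - d) * F + Q"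
    using wdvv unfolding wdvv_def by (elim conjE)
  then obtain Q where Q: "mfps_poly_deg_le 2 Q"
    and E: "(\<Sum>a\<in>UNIV. euler q r a * mfps_deriv a F) = mfps_const (3 - d) * F + Q"
    by blast
  have "mfps_deriv i (mfps_deriv j (mfps_deriv k Q)) = 0"
    using Q by (intro deriv_poly_deg_0 poly_deg_deriv) (simp add: numeral_2_eq_2)
  moreover have "3 - d - (1 - q k) - (1 - q j) - (1 - q i) = q i + q j + q k - d"
    by simp
  moreover note euler_homogeneous_deriv[OF euler_homogeneous_deriv[OF euler_homogeneous_deriv[OF E]], of i j k]
  ultimately show ?thesis
    by (simp only: F3_def mfps_deriv3_def add_0_right)
qed

lemma homogeneous_open:
  "(\<Sum>a\<in>UNIV. euler (open_q d q) (open_r r rs) a * mfps_deriv a (c None x y)) =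
   mfps_const (open_q d q x + open_q d q y - open_q d q None) * c None x y"
proof -
  have "\<exists>L. mfps_poly_deg_le 1 L \<and> (\<Sum>a\<in>UNIV. mfps_incl (euler q r a) * mfps_deriv (Some a) Fo)
          + (mfps_const ((1 - d) / 2) * mfps_X None + mfps_const rs) * mfps_deriv None Fo =
        mfps_const ((3 - d) / 2) * Fo + mfps_incl L"
    using open_wdvv unfolding open_wdvv_def by (elim conjE)
  then obtain L where L: "mfps_poly_deg_le 1 L"
    and E: "(\<Sum>a\<in>UNIV. mfps_incl (euler q r a) * mfps_deriv (Some a) Fo)
          + (mfps_const ((1 - d) / 2) * mfps_X None + mfps_const rs) * mfps_deriv None Fo =
        mfps_const ((3 - d) / 2) * Fo + mfps_incl L"
    by blast
  have "euler (open_q d q) (open_r r rs) None = mfps_const ((1 - d) / 2) * mfps_X None + mfps_const rs"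
    by (simp add: euler_def open_q_def open_r_def diff_divide_distrib add_divide_distrib)
  then have E': "(\<Sum>a\<in>UNIV. euler (open_q d q) (open_r r rs) a * mfps_deriv a Fo) =
      mfps_const ((3 - d) / 2) * Fo + mfps_incl L"
    using E by (simp add: sum_UNIV_option euler_open_Some add.commute)
  have "mfps_deriv x (mfps_deriv y (mfps_incl L)) = 0"
    using L by (intro deriv_poly_deg_0 poly_deg_deriv poly_deg_incl) simp
  moreover have "(3 - d) / 2 - (1 - open_q d q y) - (1 - open_q d q x) =
      open_q d q x + open_q d q y - open_q d q None"
    by (simp add: open_q_def[of d q None] field_simps)
  moreover note euler_homogeneous_deriv[OF euler_homogeneous_deriv[OF E'], of x y]
  ultimately show ?thesis
    by (simp only: c_None mfps_deriv2_def add_0_right)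
qed

text \<open>Homogeneity of the constant series \<open>\<partial>\<^sub>1 \<partial>\<^sub>s F\<^sup>o = 1\<close>.\<close>

lemma q_unit: "q o1 = 0"
proof -
  have "mfps_const (q o1) = (0 :: ('n option, complex) mfps)"
    using homogeneous_open[of "Some o1" None] by (simp add: c_unit open_q_def[of d q "Some _"])
  then show ?thesis
    by (metis const_coeff_const mfps_nth_zero)
qed

text \<open>Homogeneity of the constant series \<open>\<partial>\<^sub>1 \<partial>\<^sub>i \<partial>\<^sub>j F = \<eta>\<^sub>i\<^sub>j\<close>.\<close>

lemma q_eta: "(q i + q j - d) * \<eta> $ i $ j = 0"
proof -
  have "mfps_const ((q i + q j - d) * \<eta> $ i $ j) = (0 :: ('n, complex) mfps)"
    using homogeneous_F3[of o1 i j] by (simp add: F3_unit q_unit mfps_const_mult)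
  then show ?thesis
    by (metis const_coeff_const mfps_nth_zero)
qed

text \<open>The relation \<open>\<mu> \<eta> + \<eta> \<mu> = d \<eta>\<close> multiplied by \<open>\<eta>\<^sup>-\<^sup>1\<close> from both sides.\<close>

lemma q_h: "(q i + q j - d) * h $ i $ j = 0"
proof -
  have "0 = (\<Sum>a\<in>UNIV. \<Sum>b\<in>UNIV. h $ i $ a * ((q a + q b - d) * \<eta> $ a $ b) * h $ b $ j)"
    by (simp add: q_eta)
  also have "\<dots> = (\<Sum>a\<in>UNIV. \<Sum>b\<in>UNIV. h $ i $ a * q a * (\<eta> $ a $ b * h $ b $ j)) +
      (\<Sum>a\<in>UNIV. \<Sum>b\<in>UNIV. (h $ i $ a * \<eta> $ a $ b) * ((q b - d) * h $ b $ j))"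
    by (simp add: algebra_simps sum.distrib sum_subtractf)
  also have "(\<Sum>a\<in>UNIV. \<Sum>b\<in>UNIV. h $ i $ a * q a * (\<eta> $ a $ b * h $ b $ j)) = h $ i $ j * q j"
    by (simp only: sum_distrib_left[symmetric] sum_eta_h sum_mult_delta)
  also have "(\<Sum>a\<in>UNIV. \<Sum>b\<in>UNIV. (h $ i $ a * \<eta> $ a $ b) * ((q b - d) * h $ b $ j)) = (q i - d) * h $ i $ j"
    by (subst sum.swap) (simp only: sum_distrib_right[symmetric] sum_h_eta sum_mult_delta)
  finally show ?thesis
    by (simp add: algebra_simps)
qed

lemma homogeneous_c:
  "(\<Sum>f\<in>UNIV. euler (open_q d q) (open_r r rs) f * mfps_deriv f (c a x y)) =
   mfps_const (open_q d q x + open_q d q y - open_q d q a) * c a x y"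
proof (cases a)
  case None
  then show ?thesis by (simp add: homogeneous_open)
next
  case a: (Some i)
  show ?thesis
  proof (cases "x = None \<or> y = None")
    case True
    then show ?thesis by (auto simp: a)
  next
    case False
    then obtain j k where xy: "x = Some j" "y = Some k" by auto
    define G where "G = (\<Sum>m\<in>UNIV. F3 j k m * mfps_const (h $ m $ i))"
    have c: "c (Some i) (Some j) (Some k) = mfps_incl G"
      by (simp add: c_Some G_def)
    have coeff: "mfps_const (q j + q k + q m - d) * F3 j k m * mfps_const (h $ m $ i) =
        mfps_const (q j + q k - q i) * (F3 j k m * mfps_const (h $ m $ i))" for m
    proof -
      have "(q j + q k + q m - d) * h $ m $ i = (q j + q k - q i) * h $ m $ i"
      proof -
        have "(q j + q k + q m - d) * h $ m $ i = (q j + q k - q i) * h $ m $ i + (q m + q i - d) * h $ m $ i"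
          by (simp add: algebra_simps)
        then show ?thesis by (simp only: q_h add_0_right)
      qed
      then have *: "mfps_const (q j + q k + q m - d) * mfps_const (h $ m $ i) =
          mfps_const (q j + q k - q i) * (mfps_const (h $ m $ i) :: ('n, complex) mfps)"
        unfolding mfps_const_mult[symmetric] by (rule arg_cong)
      have "mfps_const (q j + q k + q m - d) * F3 j k m * mfps_const (h $ m $ i) =
          F3 j k m * (mfps_const (q j + q k + q m - d) * mfps_const (h $ m $ i))"
        by (simp only: mult.assoc mult.left_commute)
      also have "\<dots> = mfps_const (q j + q k - q i) * (F3 j k m * mfps_const (h $ m $ i))"
        unfolding * by (rule mult.left_commute)
      finally show ?thesis .
    qed
    have "(\<Sum>a\<in>UNIV. euler q r a * mfps_deriv a G) =
        (\<Sum>m\<in>UNIV. (\<Sum>a\<in>UNIV. euler q r a * mfps_deriv a (F3 j k m)) * mfps_const (h $ m $ i))"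
      unfolding G_def mfps_deriv_sum sum_distrib_left sum_distrib_right
      by (subst sum.swap) (simp add: mult.assoc)
    also have "\<dots> = mfps_const (q j + q k - q i) * G"
      by (simp only: homogeneous_F3 coeff G_def sum_distrib_left)
    finally have "(\<Sum>a\<in>UNIV. euler q r a * mfps_deriv a G) = mfps_const (q j + q k - q i) * G" .
    then show ?thesis
      by (simp only: a xy c euler_open_incl mfps_incl_mult mfps_incl_const open_q_def option.case)
  qed
qed

text \<open>\<open>F\<^sup>o\<close> is recovered from its second derivatives, which are structure constants, and \<open>F\<close> from its third
  derivatives, which are linear combinations of structure constants with coefficients \<open>\<eta>\<close>.\<close>

theorem potentials_geom_bounded:
  assumes ss: "semisimple (open_vector_potential \<eta> F Fo)"
  shows "geom_bounded F" "geom_bounded Fo"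
proof -
  have bounded: "geom_bounded (c a x y)" for a x y
    unfolding c_def
    by (rule semisimple_flat_F_manifold_geom_bounded[where \<Phi> = "open_vector_potential \<eta> F Fo" and e = "Some o1"
          and q = "open_q d q" and r = "open_r r rs", OF c_assoc[unfolded c_def] c_unit[unfolded c_def]
          homogeneous_c[unfolded c_def] ss])
  show "geom_bounded Fo"
    using bounded[of None, unfolded c_None mfps_deriv2_def]
    by (rule geom_bounded_if_derivs[OF geom_bounded_if_derivs])
  have "geom_bounded (F3 j k m)" for j k m
  proof (rule geom_bounded_if_incl)
    have "(\<Sum>i\<in>UNIV. c (Some i) (Some j) (Some k) * mfps_const (\<eta> $ i $ m)) =
        (\<Sum>i\<in>UNIV. \<Sum>l\<in>UNIV. mfps_incl (F3 j k l) * mfps_const (h $ l $ i * \<eta> $ i $ m))"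
      by (simp add: c_Some sum_distrib_right mfps_const_mult mult.assoc)
    also have "\<dots> = (\<Sum>l\<in>UNIV. mfps_incl (F3 j k l) * mfps_const (\<Sum>i\<in>UNIV. h $ l $ i * \<eta> $ i $ m))"
      by (subst sum.swap) (simp only: mfps_const_sum sum_distrib_left)
    also have "\<dots> = mfps_incl (F3 j k m)"
      by (simp add: sum_h_eta if_distrib[of mfps_const] cong: if_cong)
    finally have "mfps_incl (F3 j k m) = (\<Sum>i\<in>UNIV. c (Some i) (Some j) (Some k) * mfps_const (\<eta> $ i $ m))"
      by (rule sym)
    moreover have "geom_bounded \<dots>"
      by (intro geom_bounded_sum geom_bounded_mult bounded geom_bounded_const)
    ultimately show "geom_bounded (mfps_incl (F3 j k m))"
      by (simp only:)
  qed
  then show "geom_bounded F"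
    unfolding F3_def mfps_deriv3_def
    by (rule geom_bounded_if_derivs[OF geom_bounded_if_derivs[OF geom_bounded_if_derivs]])
qed

end

theorem theorem7p13:
  fixes o1 :: "'n::finite"
    and \<eta> :: "complex ^ 'n ^ 'n"
    and d rs :: complex
    and q r :: "'n \<Rightarrow> complex"
    and F :: "('n, complex) mfps"
    and Fo :: "('n option, complex) mfps"
  assumes "wdvv o1 \<eta> d q r F"
    and "open_wdvv o1 \<eta> d q r rs F Fo"
    and "semisimple (open_vector_potential \<eta> F Fo)"
    and "\<not> strictly_doubly_resonant (open_vector_potential \<eta> F Fo) (open_q d q) (open_r r rs)"
  shows "mfps_convergent F \<and> mfps_convergent Fo"
proof -
  interpret open_wdvv_solution o1 \<eta> d rs q r F Fo
    by (rule open_wdvv_solution.intro) (rule assms)+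
  show ?thesis
    using potentials_geom_bounded[OF assms(3)] by (simp add: mfps_convergent_if_geom_bounded)
qed

end
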